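(* There exist constants $\lambda_1\in(0,1)$ and $C>0$ such that for all $\lambda\in(0,\lambda_1)$, all integers $m,n\ge1$ and all sets of constraints $(\eta,\Delta)$, the mixing time of the Glauber dynamics with parameter $\lambda$ on the set $\Omega(\eta,\Delta)$ of triangulations of $\Lambda^0_{m,n}$ compatible with the constraints satisfies $$T_{\mathrm{mix}}\le C\,mn(m+n).$$
   Context: Triangulations. $\Lambda^0_{m,n}=\{0,1,\dots,m\}\times\{0,1,\dots,n\}\subset\mathbb{Z}^2$. An edge is a straight segment joining two points of $\Lambda^0_{m,n}$ and passing through no other integer point. Two edges cross if they are distinct and meet at a point that is not a common endpoint. A (full) triangulation of $\Lambda^0_{m,n}$ is a maximal set of pairwise noncrossing edges. In every triangulation the set of midpoints of the edges is exactly $\Lambda=\Lambda_{m,n}=\bigl(\{0,\frac12,1,\dots,m\}\times\{0,\frac12,1,\dots,n\}\bigr)\setminus\Lambda^0_{m,n}$, each midpoint occurring once; so a triangulation is written $\sigma=\{\sigma_x\}_{x\in\Lambda}$, where $\sigma_x$ is the edge with midpoint $x$. Constraints. A set of constraints $(\eta,\Delta)$ is a subset $\Delta\subseteq\Lambda$ together with pairwise noncrossing edges $\eta=\{\eta_x\}_{x\in\Delta}$, $\eta_x$ having midpoint $x$. $\Omega(\eta,\Delta)$ is the (nonempty) set of triangulations $\sigma$ with $\sigma_x=\eta_x$ for all $x\in\Delta$. Gibbs distribution. $|\sigma_x|$ is the $\ell_1$ length of $\sigma_x$, $|\sigma|=\sum_x|\sigma_x|$, and $\mu(\sigma)=\lambda^{|\sigma|}/Z$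 on $\Omega(\eta,\Delta)$ with $Z=\sum_{\sigma\in\Omega(\eta,\Delta)}\lambda^{|\sigma|}$. Glauber dynamics. An edge $\sigma_x$ lying in two triangles of $\sigma$ is flippable if the two triangles form a convex quadrilateral (then necessarily a parallelogram); the flip replaces $\sigma_x$ by the other diagonal $\sigma_x'$ (also with midpoint $x$). One step from $\sigma\in\Omega(\eta,\Delta)$: pick $x$ uniformly at random in $\Lambda\setminus\Delta$ (midpoints of nonconstraint edges); if $\sigma_x$ is flippable to $\sigma'_x$, flip it with probability $\lambda^{|\sigma'_x|}/(\lambda^{|\sigma'_x|}+\lambda^{|\sigma_x|})$; otherwise do nothing. Mixing time. $T_{\mathrm{mix}}=\inf\{t\in\mathbb{N}:\max_{\sigma}\|p^t(\sigma,\cdot)-\mu\|\le 1/4\}$, where $p^t(\sigma,\cdot)$ is the law after $t$ steps started at $\sigma$ and $\|\cdot\|$ is total variation distance. *)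

theory Defs
  imports "HOL-Probability.Probability"
begin

section \<open>Edges and triangulations\<close>

text \<open>A primitive segment is determined by its endpoints, so an edge is represented by the
  two-element set of its endpoints in \<open>int \<times> int\<close>; its geometric realisation is the convex hull.\<close>

type_synonym point = "int \<times> int"
type_synonym edge = "point set"

definition emb :: "point \<Rightarrow> real \<times> real" where
  "emb p = (real_of_int (fst p), real_of_int (snd p))"

definition hull_of :: "point set \<Rightarrow> (real \<times> real) set" where
  "hull_of S = convex hull (emb ` S)"

definition lattice_points :: "nat \<Rightarrow> nat \<Rightarrow> point set" where
  "lattice_points m n = {0..int m} \<times> {0..int n}"

definition edges :: "nat \<Rightarrow> nat \<Rightarrow> edge set" where
  "edges m n = {{a, b} | a b. a \<in> lattice_points m n \<and> b \<in> lattice_points m n \<and> a \<noteq> b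
      \<and> (\<forall>c. emb c \<in> hull_of {a, b} \<longrightarrow> c \<in> {a, b})}"

definition crosses :: "edge \<Rightarrow> edge \<Rightarrow> bool" where
  "crosses e f \<longleftrightarrow> e \<noteq> f \<and> (\<exists>p \<in> hull_of e \<inter> hull_of f. p \<notin> emb ` (e \<inter> f))"

definition noncrossing :: "edge set \<Rightarrow> bool" where
  "noncrossing T \<longleftrightarrow> (\<forall>e\<in>T. \<forall>f\<in>T. \<not> crosses e f)"

definition triangulations :: "nat \<Rightarrow> nat \<Rightarrow> edge set set" where
  "triangulations m n = {T. T \<subseteq> edges m n \<and> noncrossing T
      \<and> (\<forall>T'. T \<subseteq> T' \<and> T' \<subseteq> edges m n \<and> noncrossing T' \<longrightarrow> T' = T)}"

definition edge_midpoint :: "edge \<Rightarrow> real \<times> real" where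
  "edge_midpoint e = (\<Sum>a\<in>e. emb a) /\<^sub>R 2"

definition midpoints :: "nat \<Rightarrow> nat \<Rightarrow> (real \<times> real) set" where
  "midpoints m n = {(real i / 2, real j / 2) | i j. i \<le> 2 * m \<and> j \<le> 2 * n} - emb ` lattice_points m n"

text \<open>The edge \<open>\<sigma>\<^sub>x\<close> of a triangulation \<open>\<sigma>\<close>; it is well defined for every \<open>x \<in> midpoints m n\<close>.\<close>

definition edge_at :: "edge set \<Rightarrow> real \<times> real \<Rightarrow> edge" where
  "edge_at T x = (THE e. e \<in> T \<and> edge_midpoint e = x)"

section \<open>Constraints\<close>

text \<open>Only the values of \<open>\<eta>\<close> on \<open>\<Delta>\<close> matter.\<close>

definition constraints :: "nat \<Rightarrow> nat \<Rightarrow> (real \<times> real \<Rightarrow> edge) \<Rightarrow> (real \<times> real) set \<Rightarrow> bool" where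
  "constraints m n \<eta> \<Delta> \<longleftrightarrow> \<Delta> \<subseteq> midpoints m n
      \<and> (\<forall>x\<in>\<Delta>. \<eta> x \<in> edges m n \<and> edge_midpoint (\<eta> x) = x)
      \<and> noncrossing (\<eta> ` \<Delta>)"

definition compatible :: "nat \<Rightarrow> nat \<Rightarrow> (real \<times> real \<Rightarrow> edge) \<Rightarrow> (real \<times> real) set \<Rightarrow> edge set set" where
  "compatible m n \<eta> \<Delta> = {T \<in> triangulations m n. \<forall>x\<in>\<Delta>. edge_at T x = \<eta> x}"

section \<open>Gibbs distribution\<close>

text \<open>For an edge with endpoints \<open>a\<close> and \<open>b\<close> the two summands are the horizontal and the
  vertical distance of \<open>a\<close> and \<open>b\<close>, so this is the \<open>\<ell>\<^sub>1\<close> length.\<close>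

definition edge_length :: "edge \<Rightarrow> nat" where
  "edge_length e = nat ((Max (fst ` e) - Min (fst ` e)) + (Max (snd ` e) - Min (snd ` e)))"

definition total_length :: "nat \<Rightarrow> nat \<Rightarrow> edge set \<Rightarrow> nat" where
  "total_length m n T = (\<Sum>x\<in>midpoints m n. edge_length (edge_at T x))"

definition partition_function ::
  "nat \<Rightarrow> nat \<Rightarrow> real \<Rightarrow> (real \<times> real \<Rightarrow> edge) \<Rightarrow> (real \<times> real) set \<Rightarrow> real" where
  "partition_function m n lam \<eta> \<Delta> = (\<Sum>T\<in>compatible m n \<eta> \<Delta>. lam ^ total_length m n T)"

text \<open>The side conditions of \<open>embed_pmf\<close> hold for \<open>lam > 0\<close>, as \<open>compatible m n \<eta> \<Delta>\<close> is finite
  and, for any set of constraints, nonempty.\<close>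

definition gibbs ::
  "nat \<Rightarrow> nat \<Rightarrow> real \<Rightarrow> (real \<times> real \<Rightarrow> edge) \<Rightarrow> (real \<times> real) set \<Rightarrow> edge set pmf" where
  "gibbs m n lam \<eta> \<Delta> = embed_pmf (\<lambda>T. if T \<in> compatible m n \<eta> \<Delta>
      then lam ^ total_length m n T / partition_function m n lam \<eta> \<Delta> else 0)"

section \<open>Glauber dynamics\<close>

text \<open>The triangles of \<open>T\<close> are its faces: three pairwise adjacent vertices do not suffice, because
  the region they bound may contain further edges of \<open>T\<close>.\<close>

definition is_triangle :: "edge set \<Rightarrow> point set \<Rightarrow> bool" where
  "is_triangle T t \<longleftrightarrow> card t = 3 \<and> (\<forall>a\<in>t. \<forall>b\<in>t. a \<noteq> b \<longrightarrow> {a, b} \<in> T)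
      \<and> (\<forall>e\<in>T. hull_of e \<inter> interior (hull_of t) = {})"

text \<open>The condition on extreme points excludes two triangles whose union is a larger triangle
  with an endpoint of the common edge in the middle of one of its sides.\<close>

definition flips_to :: "edge set \<Rightarrow> edge \<Rightarrow> edge \<Rightarrow> bool" where
  "flips_to T e e' \<longleftrightarrow> (\<exists>a b c d. e = {a, b} \<and> e' = {c, d} \<and> c \<noteq> d
      \<and> is_triangle T {a, b, c} \<and> is_triangle T {a, b, d}
      \<and> (let Q = hull_of {a, b, c} \<union> hull_of {a, b, d}
         in convex Q \<and> {p. p extreme_point_of Q} = emb ` {a, b, c, d}))"

definition flippable :: "edge set \<Rightarrow> edge \<Rightarrow> bool" where
  "flippable T e \<longleftrightarrow> (\<exists>e'. flips_to T e e')"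

definition flipped :: "edge set \<Rightarrow> edge \<Rightarrow> edge" where
  "flipped T e = (THE e'. flips_to T e e')"

definition update_at :: "real \<Rightarrow> edge set \<Rightarrow> real \<times> real \<Rightarrow> edge set pmf" where
  "update_at lam T x =
    (let e = edge_at T x; e' = flipped T e in
     if flippable T e
     then map_pmf (\<lambda>b. if b then insert e' (T - {e}) else T)
            (bernoulli_pmf (lam ^ edge_length e' / (lam ^ edge_length e' + lam ^ edge_length e)))
     else return_pmf T)"

text \<open>If every edge is constrained there is nothing to choose, and the chain stays put.\<close>

definition glauber_step ::
  "nat \<Rightarrow> nat \<Rightarrow> real \<Rightarrow> (real \<times> real) set \<Rightarrow> edge set \<Rightarrow> edge set pmf" where
  "glauber_step m n lam \<Delta> T =
    (if midpoints m n - \<Delta> = {} then return_pmf T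
     else bind_pmf (pmf_of_set (midpoints m n - \<Delta>)) (update_at lam T))"

definition glauber_law ::
  "nat \<Rightarrow> nat \<Rightarrow> real \<Rightarrow> (real \<times> real) set \<Rightarrow> nat \<Rightarrow> edge set \<Rightarrow> edge set pmf" where
  "glauber_law m n lam \<Delta> t T = ((\<lambda>p. bind_pmf p (glauber_step m n lam \<Delta>)) ^^ t) (return_pmf T)"

section \<open>Mixing time\<close>

definition total_variation :: "'a pmf \<Rightarrow> 'a pmf \<Rightarrow> real" where
  "total_variation p q = (SUP A. \<bar>measure_pmf.prob p A - measure_pmf.prob q A\<bar>)"

text \<open>The infimum is taken in \<open>enat\<close>, where \<open>Inf {} = \<infinity>\<close>; over \<open>nat\<close> it would be \<open>0\<close>.\<close>

definition mixing_time ::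
  "nat \<Rightarrow> nat \<Rightarrow> real \<Rightarrow> (real \<times> real \<Rightarrow> edge) \<Rightarrow> (real \<times> real) set \<Rightarrow> enat" where
  "mixing_time m n lam \<eta> \<Delta> = Inf (enat ` {t.
      (MAX T \<in> compatible m n \<eta> \<Delta>. total_variation (glauber_law m n lam \<Delta> t T) (gibbs m n lam \<eta> \<Delta>)) \<le> 1 / 4})"

end

theory Submission
  imports Defs
begin

text \<open>The proof is a path coupling argument in dual form: instead of coupling two copies of the chain, one
shows that its one-step operator contracts a Lipschitz seminorm. Two triangulations that differ by a
flip exchanging \<open>e\<close> and \<open>e'\<close> get the distance \<open>16 ^ max \<bar>e\<bar> \<bar>e'\<bar>\<close>,
where the bars denote the length. Let \<open>F\<close> change by at most \<open>K\<close> times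
this distance under every flip, and let \<open>S\<close>, \<open>T\<close> differ by such a flip, with \<open>M\<close> the length of the
longer of the two edges. Update both at the same midpoint \<open>x\<close>. If \<open>x\<close> is the midpoint of the flipped
edge, the two averages of \<open>F\<close> agree. If the edge at \<open>x\<close> is not a side of the flipped parallelogram,
it has the same flip and the same rate in \<open>S\<close> and in \<open>T\<close>, and the outcomes again differ by the flip
from \<open>e\<close> to \<open>e'\<close>, so nothing is lost. At the four sides the two updates may behave differently. But for
\<open>lam \<le> 1/16\<close> the rate of replacing \<open>f\<close> by \<open>f'\<close>, multiplied by the distance of that flip, is at most
\<open>16 ^ \<bar>f\<bar>\<close>, and a side is shorter than \<open>M\<close>, since the longer diagonal is as long as two adjacent
sides together. The loss is therefore at most \<open>4 * 2 * 16 ^ (M - 1) = 16 ^ M / 2\<close>, against the gain of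
\<open>16 ^ M\<close> at the flipped midpoint: averaging over the \<open>N\<close> free midpoints replaces \<open>K\<close> by
\<open>(1 - 1 / (2 * N)) * K\<close> (\<open>step_exp_contract\<close>).

To compare arbitrary \<open>S\<close> and \<open>T\<close> one needs short flip paths between them. Take a longest edge \<open>e\<close>
lying in exactly one of them. It is the longest side of both faces next to it: a longer side would
belong to both triangulations, and the face of the other triangulation over it would contain a still
longer edge lying in one triangulation only. Such faces form a parallelogram, and flipping \<open>e\<close> produces
a shorter edge or an edge of the other triangulation (\<open>longest_difference_flippable\<close>). Hence the total
length of the symmetric difference, which is polynomial in \<open>m\<close> and \<open>n\<close>, bounds the number of flips,
and no flip touches a constraint edge (\<open>flip_lipschitz_global\<close>). Each flip costs at most
\<open>16 ^ (m + n)\<close>, so \<open>t = 32 * N * (m + n)\<close> steps bring the oscillation of the image of every indicator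
function below \<open>1/4\<close>, and stationarity turns this into a bound on total variation.

The geometry rests on integer orientation determinants. The key fact is \<open>triangle_on_side\<close>: over every
edge, on each side containing points of the grid, a triangulation has a face of determinant \<open>1\<close>. It
implies that every midpoint carries an edge (\<open>triangulation_covers_midpoints\<close>), that all faces are
unimodular (\<open>is_triangle_tri\<close>), and that flips exchange the diagonals of unimodular parallelograms
(\<open>flips_to_iff\<close>).\<close>

section \<open>Orientation, primitive segments and crossings\<close>

definition ori :: "point \<Rightarrow> point \<Rightarrow> point \<Rightarrow> int" where
  "ori a b c = (fst b - fst a) * (snd c - snd a) - (snd b - snd a) * (fst c - fst a)"

abbreviation rfst :: "point \<Rightarrow> real" where "rfst p \<equiv> real_of_int (fst p)"

abbreviation rsnd :: "point \<Rightarrow> real" where "rsnd p \<equiv> real_of_int (snd p)"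

definition rori :: "point \<Rightarrow> point \<Rightarrow> real \<times> real \<Rightarrow> real" where
  "rori a b p = (rfst b - rfst a) * (snd p - rsnd a)
     - (rsnd b - rsnd a) * (fst p - rfst a)"

lemma rori_emb [simp]: "rori a b (emb c) = real_of_int (ori a b c)"
  by (simp add: rori_def ori_def emb_def)

lemma ori_rotate: "ori b c a = ori a b c"
  by (simp add: ori_def algebra_simps)

lemma ori_flip: "ori b a c = - ori a b c"
  by (simp add: ori_def algebra_simps)

lemma ori_same [simp]: "ori a b a = 0" "ori a b b = 0" "ori a a b = 0"
  by (simp_all add: ori_def algebra_simps)

lemma emb_eq_iff [simp]: "emb p = emb q \<longleftrightarrow> p = q"
  by (auto simp: emb_def prod_eq_iff)

lemma hull_of_pair: "hull_of {a, b} = closed_segment (emb a) (emb b)"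
  by (simp add: hull_of_def segment_convex_hull)

lemma in_hull_of_pair:
  "p \<in> hull_of {a, b} \<longleftrightarrow> (\<exists>s. 0 \<le> s \<and> s \<le> 1 \<and>
     fst p = (1 - s) * rfst a + s * rfst b \<and>
     snd p = (1 - s) * rsnd a + s * rsnd b)"
  by (cases p) (auto simp: hull_of_pair closed_segment_def emb_def)

lemma hull_of_pairI:
  assumes "0 \<le> s" "s \<le> 1" "fst p = (1 - s) * rfst a + s * rfst b"
    "snd p = (1 - s) * rsnd a + s * rsnd b"
  shows "p \<in> hull_of {a, b}"
  using assms in_hull_of_pair by blast

lemma emb_in_hull: "a \<in> S \<Longrightarrow> emb a \<in> hull_of S"
  by (simp add: hull_of_def hull_inc)

text \<open>A common divisor \<open>g > 1\<close> of the coordinate differences puts a lattice point at parameter \<open>1 / g\<close>.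
Conversely a Bezout combination of the coordinates is an integer at lattice points and equals the
parameter along the segment, so that a lattice point has parameter \<open>0\<close> or \<open>1\<close>.\<close>

lemma primitive_iff_coprime:
  assumes "a \<noteq> b"
  shows "(\<forall>c. emb c \<in> hull_of {a, b} \<longrightarrow> c \<in> {a, b}) \<longleftrightarrow> coprime (fst b - fst a) (snd b - snd a)"
proof
  assume *: "\<forall>c. emb c \<in> hull_of {a, b} \<longrightarrow> c \<in> {a, b}"
  define g where "g = gcd (fst b - fst a) (snd b - snd a)"
  have g0: "g > 0" using assms unfolding g_def by (auto simp: prod_eq_iff gcd_eq_0_iff order.strict_iff_order)
  show "coprime (fst b - fst a) (snd b - snd a)"
  proof (rule ccontr)
    assume "\<not> ?thesis"
    hence "g \<noteq> 1" unfolding g_def coprime_iff_gcd_eq_1 by simp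
    with g0 have g2: "g \<ge> 2" by simp
    obtain x y where x: "fst b - fst a = g * x" and y: "snd b - snd a = g * y"
      unfolding g_def by (meson dvd_def gcd_dvd1 gcd_dvd2)
    let ?c = "(fst a + x, snd a + y)"
    have xy: "x \<noteq> 0 \<or> y \<noteq> 0" using assms x y by (auto simp: prod_eq_iff)
    have rx: "rfst b = rfst a + real_of_int g * real_of_int x"
      using x by (metis add_diff_cancel_left' diff_add_cancel add.commute of_int_add of_int_mult)
    have ry: "rsnd b = rsnd a + real_of_int g * real_of_int y"
      using y by (metis add_diff_cancel_left' diff_add_cancel add.commute of_int_add of_int_mult)
    have gp: "real_of_int g \<ge> 2" using g2 by simp
    have "emb ?c \<in> hull_of {a, b}"
      by (rule hull_of_pairI[of "1 / real_of_int g"]) (use gp in \<open>auto simp: emb_def rx ry field_simps\<close>)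
    hence "?c \<in> {a, b}" using * by blast
    hence "?c = b" using xy by (auto simp: prod_eq_iff)
    hence "x = g * x" "y = g * y" using x[symmetric] y[symmetric] by (auto simp: prod_eq_iff)
    hence "(g - 1) * x = 0" "(g - 1) * y = 0" by (simp_all add: left_diff_distrib)
    thus False using xy g2 by auto
  qed
next
  assume cop: "coprime (fst b - fst a) (snd b - snd a)"
  then obtain u v where uv: "u * (fst b - fst a) + v * (snd b - snd a) = 1"
    by (metis bezout_int coprime_iff_gcd_eq_1)
  show "\<forall>c. emb c \<in> hull_of {a, b} \<longrightarrow> c \<in> {a, b}"
  proof (intro allI impI)
    fix c assume "emb c \<in> hull_of {a, b}"
    then obtain s where s: "0 \<le> s" "s \<le> 1"
      and sx: "rfst c = (1 - s) * rfst a + s * rfst b"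
      and sy: "rsnd c = (1 - s) * rsnd a + s * rsnd b"
      by (auto simp: in_hull_of_pair emb_def)
    let ?k = "u * (fst c - fst a) + v * (snd c - snd a)"
    have "real_of_int ?k = s * real_of_int (u * (fst b - fst a) + v * (snd b - snd a))"
      by (simp add: sx sy algebra_simps)
    also have "\<dots> = s" unfolding uv by simp
    finally have ks: "real_of_int ?k = s" .
    with s have "?k = 0 \<or> ?k = 1" by linarith
    hence "s = 0 \<or> s = 1" using ks by (metis of_int_0 of_int_1)
    thus "c \<in> {a, b}" using sx sy by (auto simp: prod_eq_iff)
  qed
qed

lemma pair_edge_iff:
  "{a, b} \<in> edges m n \<longleftrightarrow> a \<in> lattice_points m n \<and> b \<in> lattice_points m n
     \<and> coprime (fst b - fst a) (snd b - snd a)" (is "?L \<longleftrightarrow> ?R")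
proof
  assume ?L
  then obtain a' b' where ab: "{a, b} = {a', b'}" "a' \<in> lattice_points m n" "b' \<in> lattice_points m n"
     "a' \<noteq> b'" "\<forall>c. emb c \<in> hull_of {a', b'} \<longrightarrow> c \<in> {a', b'}" unfolding edges_def by blast
  have "a \<noteq> b" using ab by (metis doubleton_eq_iff)
  with ab show ?R using primitive_iff_coprime[of a b] by (metis doubleton_eq_iff)
next
  assume R: ?R
  have "a \<noteq> b" using R by auto
  moreover have "\<forall>c. emb c \<in> hull_of {a, b} \<longrightarrow> c \<in> {a, b}"
    using R primitive_iff_coprime[OF \<open>a \<noteq> b\<close>] by simp
  ultimately show ?L using R unfolding edges_def by blast
qed

lemma edge_endpoints:
  assumes "e \<in> edges m n"
  obtains a b where "e = {a, b}" "a \<noteq> b" "a \<in> lattice_points m n" "b \<in> lattice_points m n"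
  using assms unfolding edges_def by blast

lemma edge_ends_neq: "{a, b} \<in> edges m n \<Longrightarrow> a \<noteq> b"
  by (auto simp: pair_edge_iff)

lemma lattice_point_of_edge:
  assumes "e \<in> edges m n" "emb c \<in> hull_of e"
  shows "c \<in> e"
  using assms unfolding edges_def by blast

lemma finite_edges: "finite (edges m n)"
proof -
  have "edges m n \<subseteq> Pow (lattice_points m n)" unfolding edges_def by auto
  moreover have "finite (lattice_points m n)" by (simp add: lattice_points_def)
  ultimately show ?thesis by (meson finite_Pow_iff finite_subset)
qed

lemma coprime_parallel_multiple:
  fixes p q r s :: int
  assumes "coprime p q" "p * s = q * r"
  obtains k where "r = k * p" "s = k * q"
proof -
  obtain u v where uv: "u * p + v * q = 1" using assms(1) by (metis bezout_int coprime_iff_gcd_eq_1)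
  have "r = (u * p + v * q) * r" unfolding uv by simp
  also have "\<dots> = (u * r + v * s) * p" using assms(2) by algebra
  finally have 1: "r = (u * r + v * s) * p" .
  have "s = (u * p + v * q) * s" unfolding uv by simp
  also have "\<dots> = (u * r + v * s) * q" using assms(2) by algebra
  finally show ?thesis using that 1 by blast
qed

lemma coprime_parallel:
  fixes p q r s :: int
  assumes "coprime p q" "coprime r s" "p * s = q * r"
  shows "(r = p \<and> s = q) \<or> (r = - p \<and> s = - q)"
proof -
  obtain k where k: "r = k * p" "s = k * q" by (rule coprime_parallel_multiple[OF assms(1,3)])
  hence "k dvd 1" using assms(2) by (metis coprime_common_divisor dvd_triv_left)
  hence "k = 1 \<or> k = -1" by (simp add: abs_if split: if_splits)
  thus ?thesis using k by auto
qed

lemma rori_affine: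
  "fst p = (1 - s) * x1 + s * x2 \<Longrightarrow> snd p = (1 - s) * y1 + s * y2 \<Longrightarrow>
   rori a b p = (1 - s) * rori a b (x1, y1) + s * rori a b (x2, y2)"
  unfolding rori_def by (simp only: fst_conv snd_conv) (simp add: algebra_simps)

lemma rori_on_pair:
  assumes "fst p = (1 - s) * rfst c + s * rfst d"
    "snd p = (1 - s) * rsnd c + s * rsnd d"
  shows "rori a b p = (1 - s) * real_of_int (ori a b c) + s * real_of_int (ori a b d)"
  using rori_affine[OF assms, of a b] rori_emb[of a b c] rori_emb[of a b d] by (simp add: emb_def)

lemma crosses_sym: "crosses e f \<longleftrightarrow> crosses f e"
  unfolding crosses_def by (metis Int_commute)

lemma meet_at_vertex:
  assumes "\<not> crosses e f" "e \<noteq> f" "p \<in> hull_of e" "p \<in> hull_of f"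
  obtains c where "c \<in> e" "c \<in> f" "p = emb c"
  using assms unfolding crosses_def by blast

text \<open>The common point divides each segment in the ratio of the orientation determinants of its two
endpoints with respect to the other segment.\<close>

lemma proper_imp_crosses:
  assumes 1: "ori a b c * ori a b d < 0" and 2: "ori c d a * ori c d b < 0"
  shows "crosses {a, b} {c, d}"
proof -
  define s where "s = real_of_int (ori c d a) / (real_of_int (ori c d a) - real_of_int (ori c d b))"
  define t where "t = real_of_int (ori a b c) / (real_of_int (ori a b c) - real_of_int (ori a b d))"
  define p where "p = ((1 - s) * rfst a + s * rfst b,
      (1 - s) * rsnd a + s * rsnd b)"
  have m1: "real_of_int (ori a b c) * real_of_int (ori a b d) < 0"
    using 1 by (metis of_int_less_0_iff of_int_mult)
  have m2: "real_of_int (ori c d a) * real_of_int (ori c d b) < 0"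
    using 2 by (metis of_int_less_0_iff of_int_mult)
  have d1: "real_of_int (ori a b c) - real_of_int (ori a b d) \<noteq> 0"
    using m1 by (metis eq_iff_diff_eq_0 not_less zero_le_square)
  have d2: "real_of_int (ori c d a) - real_of_int (ori c d b) \<noteq> 0"
    using m2 by (metis eq_iff_diff_eq_0 not_less zero_le_square)
  have s01: "0 < s" "s < 1" using m2 unfolding s_def
    by (auto simp: mult_less_0_iff field_simps)
  have t01: "0 < t" "t < 1" using m1 unfolding t_def
    by (auto simp: mult_less_0_iff field_simps)
  have den: "real_of_int (ori a b c) - real_of_int (ori a b d)
     = - (real_of_int (ori c d a) - real_of_int (ori c d b))"
    unfolding ori_def by (simp add: algebra_simps)
  have pe: "p \<in> hull_of {a, b}" using s01 by (intro hull_of_pairI[of s]) (auto simp: p_def)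
  define D where "D = real_of_int (ori c d a) - real_of_int (ori c d b)"
  have sD: "s * D = real_of_int (ori c d a)" using d2 unfolding s_def D_def by simp
  have tD: "t * D = - real_of_int (ori a b c)"
  proof -
    have "D = - (real_of_int (ori a b c) - real_of_int (ori a b d))" using den unfolding D_def by linarith
    hence "t * D = - (t * (real_of_int (ori a b c) - real_of_int (ori a b d)))" by (simp only: mult_minus_right)
    thus ?thesis using d1 unfolding t_def by simp
  qed
  have key: "(1 - s) * real_of_int (u a) + s * real_of_int (u b) = (1 - t) * real_of_int (u c) + t * real_of_int (u d)"
    if u: "u = fst \<or> u = snd" for u :: "point \<Rightarrow> int"
  proof -
    have "D * ((1 - s) * real_of_int (u a) + s * real_of_int (u b)
     - ((1 - t) * real_of_int (u c) + t * real_of_int (u d)))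
     = D * (real_of_int (u a) - real_of_int (u c)) + (s * D) * (real_of_int (u b) - real_of_int (u a))
       - (t * D) * (real_of_int (u d) - real_of_int (u c))" by (simp add: algebra_simps)
    also have "\<dots> = 0" unfolding sD tD unfolding D_def ori_def using u by (auto simp: algebra_simps)
    finally show ?thesis using d2 unfolding D_def by simp
  qed
  have pf: "p \<in> hull_of {c, d}" using t01 key[of fst] key[of snd] by (intro hull_of_pairI[of t]) (auto simp: p_def)
  have disj: "{a, b} \<inter> {c, d} = {}" using 1 2 by auto
  have "c \<notin> {a, b}" using disj by auto
  hence "{a, b} \<noteq> {c, d}" by blast
  thus ?thesis unfolding crosses_def disj using pe pf by blast
qed

text \<open>A crossing point is not a lattice point, hence it is interior to both segments. If the line through
\<open>a\<close> and \<open>b\<close> did not strictly separate \<open>c\<close> from \<open>d\<close>, all four points would be collinear, and two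
overlapping primitive segments on one line coincide.\<close>

lemma crosses_imp_separated:
  assumes e: "{a, b} \<in> edges m n" and f: "{c, d} \<in> edges m n" and cr: "crosses {a, b} {c, d}"
  shows "ori a b c * ori a b d < 0"
proof -
  obtain p where ne: "{a, b} \<noteq> {c, d}" and pe: "p \<in> hull_of {a, b}" and pf: "p \<in> hull_of {c, d}"
    and pn: "p \<notin> emb ` ({a, b} \<inter> {c, d})" using cr unfolding crosses_def by blast
  have nl: "p \<noteq> emb q" for q
    using pn lattice_point_of_edge[OF e, of q] lattice_point_of_edge[OF f, of q] pe pf by blast
  obtain s where s: "0 \<le> s" "s \<le> 1" and
     sx: "fst p = (1 - s) * rfst a + s * rfst b" and
     sy: "snd p = (1 - s) * rsnd a + s * rsnd b"
    using pe in_hull_of_pair by auto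
  obtain t where t: "0 \<le> t" "t \<le> 1" and
     tx: "fst p = (1 - t) * rfst c + t * rfst d" and
     ty: "snd p = (1 - t) * rsnd c + t * rsnd d"
    using pf in_hull_of_pair by auto
  have "s \<noteq> 0" "s \<noteq> 1" using sx sy nl[of a] nl[of b] by (auto simp: emb_def prod_eq_iff)
  with s have s: "0 < s" "s < 1" by auto
  have "t \<noteq> 0" "t \<noteq> 1" using tx ty nl[of c] nl[of d] by (auto simp: emb_def prod_eq_iff)
  with t have t: "0 < t" "t < 1" by auto
  have z: "(1 - t) * real_of_int (ori a b c) + t * real_of_int (ori a b d) = 0"
    using rori_on_pair[OF tx ty, of a b] rori_on_pair[OF sx sy, of a b] by simp
  show ?thesis
  proof (cases "ori a b c = 0")
    case False
    have "t * real_of_int (ori a b d) = - (1 - t) * real_of_int (ori a b c)" using z by (simp add: algebra_simps)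
    hence "real_of_int (ori a b c) * (t * real_of_int (ori a b d)) = real_of_int (ori a b c) * (- (1 - t) * real_of_int (ori a b c))"
      by (rule arg_cong)
    hence "t * (real_of_int (ori a b c) * real_of_int (ori a b d)) = - (1 - t) * (real_of_int (ori a b c))\<^sup>2"
      by (simp only: power2_eq_square mult_ac)
    also have "\<dots> < 0" using t False by (simp add: mult_neg_pos)
    finally have "real_of_int (ori a b c) * real_of_int (ori a b d) < 0"
      using t by (metis mult_less_0_iff order_less_asym)
    thus ?thesis by (metis of_int_less_0_iff of_int_mult)
  next
    case True
    hence od: "ori a b d = 0" using z t by simp
    have cop: "coprime (fst b - fst a) (snd b - snd a)" using e pair_edge_iff by simp
    have "\<exists>k. ori a b q = 0 \<longrightarrow> fst q = fst a + k * (fst b - fst a) \<and> snd q = snd a + k * (snd b - snd a)" for q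
    proof (cases "ori a b q = 0")
      case True
      hence "(fst b - fst a) * (snd q - snd a) = (snd b - snd a) * (fst q - fst a)" unfolding ori_def by simp
      then obtain k where "fst q - fst a = k * (fst b - fst a)" "snd q - snd a = k * (snd b - snd a)"
        by (rule coprime_parallel_multiple[OF cop])
      hence "fst q = fst a + k * (fst b - fst a) \<and> snd q = snd a + k * (snd b - snd a)" by linarith
      thus ?thesis by blast
    qed blast
    then obtain k where par: "\<And>q. ori a b q = 0 \<Longrightarrow> fst q = fst a + k q * (fst b - fst a) \<and> snd q = snd a + k q * (snd b - snd a)"
      by metis
    have cop2: "coprime (fst d - fst c) (snd d - snd c)" using f pair_edge_iff by simp
    have "fst d - fst c = (k d - k c) * (fst b - fst a)" "snd d - snd c = (k d - k c) * (snd b - snd a)"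
      using par[OF True] par[OF od] by (auto simp: algebra_simps)
    hence "k d - k c dvd 1" using cop2 by (metis coprime_common_divisor dvd_triv_left)
    hence kk: "\<bar>k d - k c\<bar> = 1" by simp
    have sk: "s = (1 - t) * real_of_int (k c) + t * real_of_int (k d)" (is "s = ?k")
    proof -
      have rc: "rfst c = rfst a + k c * (rfst b - rfst a)" "rsnd c = rsnd a + k c * (rsnd b - rsnd a)"
        and rd: "rfst d = rfst a + k d * (rfst b - rfst a)" "rsnd d = rsnd a + k d * (rsnd b - rsnd a)"
        using par[OF True] par[OF od] by (simp_all add: of_int_add[symmetric] of_int_mult[symmetric]
          of_int_diff[symmetric] del: of_int_add of_int_mult of_int_diff)
      have "(s - ?k) * (rfst b - rfst a) = 0" using sx tx unfolding rc rd by algebra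
      moreover have "(s - ?k) * (rsnd b - rsnd a) = 0" using sy ty unfolding rc rd by algebra
      moreover have "rfst b \<noteq> rfst a \<or> rsnd b \<noteq> rsnd a" using edge_ends_neq[OF e] by (auto simp: prod_eq_iff)
      ultimately show ?thesis by auto
    qed
    \<comment> \<open>the integers \<open>k c\<close> and \<open>k d\<close> are consecutive and enclose a number strictly between \<open>0\<close> and \<open>1\<close>\<close>
    have kcd: "(k c = 0 \<and> k d = 1) \<or> (k c = 1 \<and> k d = 0)"
    proof (cases "k d = k c + 1")
      case True
      have "s = real_of_int (k c) + t" using sk True by (simp add: algebra_simps)
      hence "k c = 0" using s t by linarith
      thus ?thesis using True by simp
    next
      case False
      hence kd: "k d = k c - 1" using kk by linarith
      have "s = real_of_int (k c) - t" using sk kd by (simp add: algebra_simps)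
      hence "k c = 1" using s t by linarith
      thus ?thesis using kd by simp
    qed
    have "{a, b} = {c, d}" using kcd par[OF True] par[OF od] by (auto simp: prod_eq_iff)
    with ne show ?thesis by simp
  qed
qed

section \<open>Faces over an edge\<close>

lemma triangulation_edges: "T \<in> triangulations m n \<Longrightarrow> e \<in> T \<Longrightarrow> e \<in> edges m n"
  unfolding triangulations_def by blast

lemma triangulation_noncrossing:
  "T \<in> triangulations m n \<Longrightarrow> e \<in> T \<Longrightarrow> f \<in> T \<Longrightarrow> \<not> crosses e f"
  unfolding triangulations_def noncrossing_def by blast

lemma triangulation_maximal:
  assumes "T \<in> triangulations m n" "e \<in> edges m n" "\<And>f. f \<in> T \<Longrightarrow> \<not> crosses e f"
  shows "e \<in> T"
proof -
  have "\<not> crosses e e" by (simp add: crosses_def)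
  hence "noncrossing (insert e T)"
    using assms crosses_sym unfolding triangulations_def noncrossing_def by blast
  moreover have "insert e T \<subseteq> edges m n" using assms unfolding triangulations_def by blast
  ultimately show ?thesis using assms(1) unfolding triangulations_def by blast
qed

lemma integer_in_interval:
  fixes x h :: int
  assumes "h \<ge> 1"
  obtains k where "x \<le> k * h" "k * h \<le> x + h - 1"
proof
  let ?k = "- ((- x) div h)"
  have "?k * h = x + (- x) mod h" unfolding minus_mult_div_eq_mod[symmetric] by algebra
  moreover have "0 \<le> (- x) mod h" "(- x) mod h < h" using assms by auto
  ultimately show "x \<le> ?k * h" "?k * h \<le> x + h - 1" by linarith+
qed

text \<open>In lattice coordinates that put the given edge at \<open>(0, 0), (1, 0)\<close>, every edge crossing the strip of
heights between \<open>0\<close> and \<open>1\<close> passes either to the left or to the right of it. Such an edge \<open>f\<close> meets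
height \<open>0\<close> at \<open>s f\<close> and height \<open>1\<close> at \<open>t f\<close> and ends at \<open>(x f, h f)\<close>. Among the rightmost edge on
the left and the leftmost edge on the right, the one that ends lower has an end visible from the given
edge, and no edge enters the triangle spanned by that end and the given edge. At height \<open>1\<close> this triangle is the interval from
\<open>x f / h f\<close> to \<open>(x f + h f - 1) / h f\<close>, which contains an integer \<open>k\<close>. So all left edges
pass to the left of the point \<open>(k, 1)\<close> and all right edges to its right.\<close>

lemma strip_apex:
  fixes S :: "'f set" and s t :: "'f \<Rightarrow> real" and x h :: "'f \<Rightarrow> int"
  assumes fin: "finite S" and ne: "S \<noteq> {}"
    and t: "\<And>f. f \<in> S \<Longrightarrow> s f + (t f - s f) * h f = x f"
    and h: "\<And>f. f \<in> S \<Longrightarrow> h f \<ge> 1"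
    and s: "\<And>f. f \<in> S \<Longrightarrow> s f \<le> 0 \<or> s f \<ge> 1"
    and nc: "\<And>f g (y::real). f \<in> S \<Longrightarrow> g \<in> S \<Longrightarrow> s f \<le> 0 \<Longrightarrow> s g \<ge> 1 \<Longrightarrow> 0 \<le> y \<Longrightarrow> y \<le> h f \<Longrightarrow> y \<le> h g
       \<Longrightarrow> s f + (t f - s f) * y \<le> s g + (t g - s g) * y"
  shows "\<exists>f\<in>S. \<exists>k::int. x f \<le> k * h f \<and> k * h f \<le> x f + h f - 1 \<and>
     (\<forall>g\<in>S. s g \<le> 0 \<longrightarrow> t g \<le> k) \<and> (\<forall>g\<in>S. s g \<ge> 1 \<longrightarrow> k \<le> t g)"
proof -
  define L where "L = {f \<in> S. s f \<le> 0}"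
  define R where "R = {f \<in> S. s f \<ge> 1}"
  have LR: "S = L \<union> R" using s unfolding L_def R_def by auto
  have finL: "finite L" "finite R" using fin unfolding L_def R_def by auto
  have lo: "t g * H \<le> X" if "s g + (t g - s g) * H \<le> X" "s g \<le> 0" "H \<ge> 1" for g and X H :: real
  proof -
    have "s g * (H - 1) \<le> 0" using that by (simp add: mult_nonpos_nonneg)
    thus ?thesis using that by (simp add: algebra_simps)
  qed
  have hi: "X + H - 1 \<le> t g * H" if "X \<le> s g + (t g - s g) * H" "s g \<ge> 1" "H \<ge> 1" for g and X H :: real
  proof -
    have "(s g - 1) * (H - 1) \<ge> 0" using that by simp
    thus ?thesis using that by (simp add: algebra_simps)
  qed
  have "\<exists>f\<in>S. (\<forall>g\<in>L. t g * h f \<le> x f) \<and> (\<forall>g\<in>R. x f + h f - 1 \<le> t g * h f)"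
  proof -
    have L1: "\<exists>f\<in>L. \<forall>g\<in>L. t g \<le> t f" if "L \<noteq> {}"
    proof -
      have "Max (t ` L) \<in> t ` L" using that finL by (intro Max_in) auto
      then obtain f where "f \<in> L" "t f = Max (t ` L)" by auto
      thus ?thesis using finL by (intro bexI[of _ f]) auto
    qed
    have R1: "\<exists>f\<in>R. \<forall>g\<in>R. t f \<le> t g" if "R \<noteq> {}"
    proof -
      have "Min (t ` R) \<in> t ` R" using that finL by (intro Min_in) auto
      then obtain f where "f \<in> R" "t f = Min (t ` R)" by auto
      thus ?thesis using finL by (intro bexI[of _ f]) auto
    qed
    have mono: "t g * h f \<le> x f" if "t f' * h f \<le> x f" "t g \<le> t f'" "f \<in> S" for f f' g
    proof -
      have "t g * h f \<le> t f' * h f" using that(2) h[OF that(3)] by (intro mult_right_mono) auto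
      thus ?thesis using that(1) by linarith
    qed
    have mono2: "x f + h f - 1 \<le> t g * h f" if "x f + h f - 1 \<le> t f' * h f" "t f' \<le> t g" "f \<in> S" for f f' g
    proof -
      have "t f' * h f \<le> t g * h f" using that(2) h[OF that(3)] by (intro mult_right_mono) auto
      thus ?thesis using that(1) by linarith
    qed
    have own_l: "t f * h f \<le> x f" if "f \<in> L" for f
      using lo[of f "h f" "x f"] t[of f] h[of f] that unfolding L_def by auto
    have own_r: "x f + h f - 1 \<le> t f * h f" if "f \<in> R" for f
      using hi[of "x f" f "h f"] t[of f] h[of f] that unfolding R_def by auto
    show ?thesis
    proof (cases "L = {} \<or> R = {}")
      case True
      show ?thesis
      proof (cases "L = {}")
        case True
        then obtain f where "f \<in> R" "\<forall>g\<in>R. t f \<le> t g" using R1 ne LR by auto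
        thus ?thesis using own_r[of f] mono2[of f f] True LR by blast
      next
        case False
        then obtain f where "f \<in> L" "\<forall>g\<in>L. t g \<le> t f" using L1 by auto
        thus ?thesis using own_l[of f] mono[of f f] False True LR by blast
      qed
    next
      case False
      then obtain f g where f: "f \<in> L" "\<forall>g\<in>L. t g \<le> t f" and g: "g \<in> R" "\<forall>f\<in>R. t g \<le> t f"
        using L1 R1 by blast
      have fS: "f \<in> S" "g \<in> S" "s f \<le> 0" "s g \<ge> 1" using f g unfolding L_def R_def by auto
      show ?thesis
      proof (cases "h f \<le> h g")
        case True
        have "x f \<le> s g + (t g - s g) * h f"
          using nc[OF fS, of "h f"] t[of f] h[of f] fS True by auto
        hence "x f + h f - 1 \<le> t g * h f" using hi[of "x f" g "h f"] h[of f] fS by auto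
        thus ?thesis using own_l[of f] mono[of f f] mono2[of f g] f g fS by blast
      next
        case False
        have "s f + (t f - s f) * h g \<le> x g"
          using nc[OF fS, of "h g"] t[of g] h[of g] fS False by auto
        hence "t f * h g \<le> x g" using lo[of f "h g" "x g"] h[of g] fS by auto
        thus ?thesis using own_r[of g] mono[of f g] mono2[of g g] f g fS by blast
      qed
    qed
  qed
  then obtain f where f: "f \<in> S" and fl: "\<And>g. g \<in> L \<Longrightarrow> t g * h f \<le> x f"
    and fr: "\<And>g. g \<in> R \<Longrightarrow> x f + h f - 1 \<le> t g * h f" by blast
  have hf: "h f \<ge> 1" using h f by blast
  obtain k where k: "x f \<le> k * h f" "k * h f \<le> x f + h f - 1" by (rule integer_in_interval[OF hf])
  have kr: "real_of_int (x f) \<le> real_of_int k * h f" "real_of_int k * h f \<le> x f + h f - 1"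
    using k by (metis of_int_le_iff of_int_mult, metis (no_types, lifting) k(2) of_int_1 of_int_add of_int_diff of_int_le_iff of_int_mult)
  have "t g \<le> k" if "g \<in> S" "s g \<le> 0" for g
  proof -
    have "t g * h f \<le> real_of_int k * real_of_int (h f)" 
      by (rule order_trans[OF fl kr(1)]) (use that in \<open>simp add: L_def\<close>)
    thus ?thesis by (rule mult_right_le_imp_le) (use hf in simp)
  qed
  moreover have "k \<le> t g" if "g \<in> S" "s g \<ge> 1" for g
  proof -
    have "real_of_int k * real_of_int (h f) \<le> t g * h f" 
      by (rule order_trans[OF kr(2) fr]) (use that in \<open>simp add: R_def\<close>)
    thus ?thesis by (rule mult_right_le_imp_le) (use hf in simp)
  qed
  ultimately show ?thesis using f k by blast
qed

text \<open>The apex \<open>c\<close> is found at height \<open>1\<close> over the edge by \<open>strip_apex\<close>. It lies in the triangle spanned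
by the edge and a point of the grid, hence in the grid. By the choice of \<open>c\<close> the segments from \<open>c\<close> to
\<open>a\<close> and \<open>b\<close> cross no edge of \<open>T\<close>, so they belong to \<open>T\<close> by maximality.\<close>

lemma triangle_on_side:
  assumes T: "T \<in> triangulations m n" and ab: "{a, b} \<in> T"
    and P: "P \<in> lattice_points m n" and above: "ori a b P > 0"
  shows "\<exists>c\<in>lattice_points m n. ori a b c = 1 \<and> {a, c} \<in> T \<and> {b, c} \<in> T"
proof -
  have abE: "{a, b} \<in> edges m n" using T ab triangulation_edges by blast
  hence aL: "a \<in> lattice_points m n" "b \<in> lattice_points m n"
    and cop: "coprime (fst b - fst a) (snd b - snd a)" by (auto simp: pair_edge_iff)
  obtain u v where uv: "u * (fst b - fst a) + v * (snd b - snd a) = 1"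
    using cop by (metis bezout_int coprime_iff_gcd_eq_1)
  define c0 where "c0 = (fst a - v, snd a + u)"
  have c0: "ori a b c0 = 1" using uv unfolding c0_def ori_def by (simp add: algebra_simps)
  \<comment> \<open>coordinates with respect to the lattice basis \<open>b - a\<close>, \<open>c0 - a\<close>: \<open>X\<close> along the edge, \<open>H\<close> the height above it\<close>
  define X where "X q = - ori a c0 q" for q
  define H where "H q = ori a b q" for q
  define rX where "rX p = - rori a c0 p" for p
  define rH where "rH p = rori a b p" for p
  have rXe [simp]: "rX (emb q) = X q" for q by (simp add: rX_def X_def)
  have rHe [simp]: "rH (emb q) = H q" for q by (simp add: rH_def H_def)
  have [simp]: "X a = 0" "H a = 0" "H b = 0" by (simp_all add: X_def H_def)
  have Xb: "X b = 1" using c0 unfolding X_def ori_def by (simp add: algebra_simps)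
  have fst_q: "fst q = fst a + X q * (fst b - fst a) + H q * (fst c0 - fst a)" for q
  proof -
    have "(fst q - fst a) * ori a b c0 = X q * (fst b - fst a) + H q * (fst c0 - fst a)"
      unfolding X_def H_def ori_def by (simp add: algebra_simps)
    thus ?thesis unfolding c0 by simp
  qed
  have snd_q: "snd q = snd a + X q * (snd b - snd a) + H q * (snd c0 - snd a)" for q
  proof -
    have "(snd q - snd a) * ori a b c0 = X q * (snd b - snd a) + H q * (snd c0 - snd a)"
      unfolding X_def H_def ori_def by (simp add: algebra_simps)
    thus ?thesis unfolding c0 by simp
  qed
  define dx dy ex ey where d: "dx = rfst b - rfst a"
    "dy = rsnd b - rsnd a"
    "ex = rfst c0 - rfst a"
    "ey = rsnd c0 - rsnd a"
  have rc0: "dx * ey - dy * ex = 1"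
    using arg_cong[OF c0, of real_of_int] unfolding ori_def d by simp
  have inj: "p = q" if "rX p = rX q" "rH p = rH q" for p q
  proof -
    define w z where wz: "w = fst p - fst q" "z = snd p - snd q"
    have "ey * w - ex * z = rX p - rX q" unfolding rX_def rori_def d wz by (simp add: algebra_simps)
    hence 1: "ey * w - ex * z = 0" using that by simp
    have "dx * z - dy * w = rH p - rH q" unfolding rH_def rori_def d wz by (simp add: algebra_simps)
    hence 2: "dx * z - dy * w = 0" using that by simp
    have "w = (dx * ey - dy * ex) * w" unfolding rc0 by simp
    also have "\<dots> = dx * (ey * w - ex * z) + ex * (dx * z - dy * w)" by (simp add: algebra_simps)
    finally have w0: "w = 0" unfolding 1 2 by simp
    have "z = (dx * ey - dy * ex) * z" unfolding rc0 by simp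
    also have "\<dots> = dy * (ey * w - ex * z) + ey * (dx * z - dy * w)" by (simp add: algebra_simps)
    finally have "z = 0" unfolding 1 2 by simp
    thus ?thesis using w0 unfolding wz by (simp add: prod_eq_iff)
  qed
  have on_pair: "\<exists>r::real. 0 \<le> r \<and> r \<le> 1 \<and> rX p = (1 - r) * X c + r * X d \<and> rH p = (1 - r) * H c + r * H d"
    if "p \<in> hull_of {c, d}" for p c d
  proof -
    obtain r where r: "0 \<le> r" "r \<le> 1"
      "fst p = (1 - r) * rfst c + r * rfst d"
      "snd p = (1 - r) * rsnd c + r * rsnd d"
      using \<open>p \<in> hull_of {c, d}\<close> in_hull_of_pair by auto
    have 1: "rX p = (1 - r) * X c + r * X d"
      unfolding rX_def X_def rori_on_pair[OF r(3,4)] of_int_minus by algebra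
    have 2: "rH p = (1 - r) * H c + r * H d"
      unfolding rH_def H_def by (rule rori_on_pair[OF r(3,4)])
    show ?thesis by (intro exI[of _ r] conjI r(1,2) 1 2)
  qed
  have pair_pt: "\<exists>p\<in>hull_of {c, d}. rX p = (1 - r) * X c + r * X d \<and> rH p = (1 - r) * H c + r * H d"
    if "0 \<le> r" "r \<le> 1" for r :: real and c d
  proof -
    let ?p = "((1 - r) * rfst c + r * rfst d, (1 - r) * rsnd c + r * rsnd d)"
    have "?p \<in> hull_of {c, d}" by (rule hull_of_pairI[OF that]) auto
    moreover have "rX ?p = (1 - r) * X c + r * X d"
      unfolding rX_def X_def of_int_minus by (subst rori_on_pair[of ?p r c d]; (simp only: fst_conv snd_conv)?; algebra)
    moreover have "rH ?p = (1 - r) * H c + r * H d"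
      unfolding rH_def H_def by (rule rori_on_pair) simp_all
    ultimately show ?thesis by blast
  qed

  define F where "F = {f \<in> T. \<exists>p q. f = {p, q} \<and> H p \<ge> 1 \<and> H q \<le> 0}"
  have "\<forall>f\<in>F. \<exists>p q. f = {p, q} \<and> H p \<ge> 1 \<and> H q \<le> 0" unfolding F_def by blast
  then obtain top bot where tb: "\<And>f. f \<in> F \<Longrightarrow> f = {top f, bot f} \<and> H (top f) \<ge> 1 \<and> H (bot f) \<le> 0"
    by metis
  \<comment> \<open>first coordinate of the point of \<open>f\<close> at height \<open>y\<close>\<close>
  define pos where "pos f y = X (bot f) + (real_of_int (X (top f)) - real_of_int (X (bot f))) * ((y - H (bot f)) / (real_of_int (H (top f)) - real_of_int (H (bot f))))"
    for f and y :: real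
  have FT: "f \<in> T" if "f \<in> F" for f using that unfolding F_def by blast
  have den: "real_of_int (H (top f)) - real_of_int (H (bot f)) > 0" if "f \<in> F" for f using tb[OF that] by auto
  have pos_aff: "pos f y = pos f 0 + (pos f 1 - pos f 0) * y" for f and y :: real
    unfolding pos_def by (simp add: algebra_simps diff_divide_distrib)
  have pos_top: "pos f (H (top f)) = X (top f)" if "f \<in> F" for f
    using den[OF that] unfolding pos_def by simp
  have on_f: "rX p = pos f (rH p)" if f: "f \<in> F" and p: "p \<in> hull_of f" for p f
  proof -
    have "p \<in> hull_of {top f, bot f}" using tb[OF f] p by metis
    then obtain r :: real where r: "rX p = (1 - r) * X (top f) + r * X (bot f)" "rH p = (1 - r) * H (top f) + r * H (bot f)"
      using on_pair by blast
    have E: "(rH p - H (bot f)) / (real_of_int (H (top f)) - real_of_int (H (bot f))) = 1 - r"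
      unfolding r using den[OF f] by (simp add: field_simps)
    show ?thesis unfolding pos_def E r(1) by algebra
  qed
  have f_pt: "\<exists>p\<in>hull_of f. rX p = pos f y \<and> rH p = y" if f: "f \<in> F" and y: "0 \<le> y" "y \<le> H (top f)" for f and y :: real
  proof -
    let ?r = "(y - H (bot f)) / (real_of_int (H (top f)) - real_of_int (H (bot f)))"
    have "0 \<le> ?r" "?r \<le> 1" using den[OF f] tb[OF f] y by (auto simp: field_simps)
    then obtain p where p: "p \<in> hull_of {bot f, top f}" "rX p = (1 - ?r) * X (bot f) + ?r * X (top f)"
      "rH p = (1 - ?r) * H (bot f) + ?r * H (top f)" using pair_pt[of ?r] by blast
    have "p \<in> hull_of f" using p(1) tb[OF f] by (metis insert_commute)
    moreover have "rX p = pos f y" unfolding p pos_def by algebra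
    moreover have "?r * (real_of_int (H (top f)) - real_of_int (H (bot f))) = y - H (bot f)" using den[OF f] by simp
    hence "rH p = y" unfolding p(3) by algebra
    ultimately show ?thesis by blast
  qed
  have s_side: "pos f 0 \<le> 0 \<or> pos f 0 \<ge> 1" if f: "f \<in> F" for f
  proof (rule ccontr)
    assume "\<not> ?thesis"
    hence s: "0 < pos f 0" "pos f 0 < 1" by auto
    obtain p where p: "p \<in> hull_of f" "rX p = pos f 0" "rH p = 0" using f_pt[OF f, of 0] tb[OF f] by auto
    obtain q where q: "q \<in> hull_of {a, b}" "rX q = pos f 0" "rH q = 0"
      using pair_pt[of "pos f 0" a b] s Xb by auto
    have "q = p" using inj p q by simp
    have "{a, b} \<noteq> f" using tb[OF f] by (metis \<open>H a = 0\<close> \<open>H b = 0\<close> insertE insertI1 not_one_le_zero singletonD)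
    then obtain c where "c \<in> {a, b}" "p = emb c"
      using meet_at_vertex[OF triangulation_noncrossing[OF T ab FT[OF f]]] q(1) p(1) \<open>q = p\<close> by metis
    hence "X c = pos f 0" using p by (metis rXe)
    thus False using s \<open>c \<in> {a, b}\<close> Xb by auto
  qed
  \<comment> \<open>a change of order would be a common point interior to \<open>f\<close>, that is, a crossing\<close>
  have order: "pos f y \<le> pos g y" if f: "f \<in> F" and g: "g \<in> F" and s: "pos f 0 < pos g 0"
    and y: "0 \<le> y" "y \<le> H (top f)" "y \<le> H (top g)" for f g and y :: real
  proof (rule ccontr)
    assume gt: "\<not> ?thesis"
    define D where "D = (pos f y - pos g y) - (pos f 0 - pos g 0)"
    define z where "z = (pos g 0 - pos f 0) * y / D"
    have D: "D > 0" "D > pos g 0 - pos f 0" using s gt unfolding D_def by auto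
    have y0: "y > 0" using y gt s by (cases "y = 0") auto
    define q where "q = (pos g 0 - pos f 0) / D"
    have q: "0 < q" "q < 1" unfolding q_def using D s by auto
    have zq: "z = q * y" unfolding z_def q_def by simp
    have z: "0 < z" "z < y" unfolding zq using q y0 by auto
    have "D = (pos f 1 - pos f 0 - (pos g 1 - pos g 0)) * y"
      unfolding D_def using pos_aff[of f y] pos_aff[of g y] by algebra
    hence Dz: "(pos f 1 - pos f 0 - (pos g 1 - pos g 0)) = D / y" using y0 by simp
    have "pos f z - pos g z = (pos f 0 - pos g 0) + (D / y) * z"
      unfolding Dz[symmetric] using pos_aff[of f z] pos_aff[of g z] by algebra
    also have "\<dots> = 0" unfolding z_def using D y0 by simp
    finally have eq: "pos f z = pos g z" by simp
    obtain p where p: "p \<in> hull_of f" "rX p = pos f z" "rH p = z" using f_pt[OF f, of z] z y by auto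
    obtain q where q: "q \<in> hull_of g" "rX q = pos g z" "rH q = z" using f_pt[OF g, of z] z y by auto
    have "q = p" using inj p q eq by simp
    moreover have "f \<noteq> g" using s by auto
    ultimately obtain c where "c \<in> f" "p = emb c"
      using meet_at_vertex[OF triangulation_noncrossing[OF T FT[OF f] FT[OF g]]] q(1) p(1) by metis
    hence "H c = z" using p by (metis rHe)
    moreover have "c = top f \<or> c = bot f" using \<open>c \<in> f\<close> tb[OF f] by blast
    ultimately show False using z y tb[OF f] by auto
  qed

  have "\<exists>Q k::int. Q \<in> lattice_points m n \<and> H Q \<ge> 1 \<and> X Q \<le> k * H Q \<and> k * H Q \<le> X Q + H Q - 1 \<and>
     (\<forall>g\<in>F. pos g 0 \<le> 0 \<longrightarrow> pos g 1 \<le> k) \<and> (\<forall>g\<in>F. pos g 0 \<ge> 1 \<longrightarrow> k \<le> pos g 1)"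
  proof (cases "F = {}")
    case True
    have HP: "H P \<ge> 1" using above unfolding H_def by simp
    obtain k where "X P \<le> k * H P" "k * H P \<le> X P + H P - 1" by (rule integer_in_interval[OF HP])
    thus ?thesis using True P HP by blast
  next
    case False
    have "finite F" using finite_edges T unfolding F_def triangulations_def by (auto intro: finite_subset)
    have "\<exists>f\<in>F. \<exists>k::int. X (top f) \<le> k * H (top f) \<and> k * H (top f) \<le> X (top f) + H (top f) - 1 \<and>
       (\<forall>g\<in>F. pos g 0 \<le> 0 \<longrightarrow> pos g 1 \<le> k) \<and> (\<forall>g\<in>F. pos g 0 \<ge> 1 \<longrightarrow> k \<le> pos g 1)"
    proof (rule strip_apex[where s = "\<lambda>f. pos f 0"])
      show "pos f 0 + (pos f 1 - pos f 0) * H (top f) = X (top f)" if "f \<in> F" for f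
        using pos_top[OF that] pos_aff[of f "H (top f)"] by simp
      show "pos f 0 + (pos f 1 - pos f 0) * y \<le> pos g 0 + (pos g 1 - pos g 0) * y"
        if "f \<in> F" "g \<in> F" "pos f 0 \<le> 0" "pos g 0 \<ge> 1" "0 \<le> y" "y \<le> H (top f)" "y \<le> H (top g)" for f g and y :: real
        using order[OF that(1,2) _ that(5,6,7)] that(3,4) pos_aff[of f y] pos_aff[of g y] by linarith
    qed (use \<open>finite F\<close> False tb s_side in auto)
    then obtain f k where fk: "f \<in> F" "X (top f) \<le> k * H (top f)" "k * H (top f) \<le> X (top f) + H (top f) - 1"
      "\<forall>g\<in>F. pos g 0 \<le> 0 \<longrightarrow> pos g 1 \<le> k" "\<forall>g\<in>F. pos g 0 \<ge> 1 \<longrightarrow> k \<le> pos g 1"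
      by blast
    have "top f \<in> f" using tb[OF fk(1)] by blast
    hence "top f \<in> lattice_points m n"
      using triangulation_edges[OF T FT[OF fk(1)]] unfolding edges_def by auto
    thus ?thesis using fk tb[OF fk(1)] by blast
  qed
  then obtain Q k where Q: "Q \<in> lattice_points m n" "H Q \<ge> 1" "X Q \<le> k * H Q" "k * H Q \<le> X Q + H Q - 1"
    and Lk: "\<And>g. g \<in> F \<Longrightarrow> pos g 0 \<le> 0 \<Longrightarrow> pos g 1 \<le> real_of_int k"
    and Rk: "\<And>g. g \<in> F \<Longrightarrow> pos g 0 \<ge> 1 \<Longrightarrow> real_of_int k \<le> pos g 1" by blast
  define c where "c = (fst a + k * (fst b - fst a) + (fst c0 - fst a), snd a + k * (snd b - snd a) + (snd c0 - snd a))"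
  have "H c = ori a b c0" unfolding H_def ori_def c_def by (simp add: algebra_simps)
  hence Hc: "H c = 1" using c0 by simp
  have "X c = k * ori a b c0" unfolding X_def ori_def c_def by (simp add: algebra_simps)
  hence Xc: "X c = k" using c0 by simp
  have cL: "c \<in> lattice_points m n"
  proof -
    have w: "X Q + H Q - 1 - k * H Q \<ge> 0" "k * H Q - X Q \<ge> 0" using Q by auto
    have f: "H Q * fst c = (X Q + H Q - 1 - k * H Q) * fst a + (k * H Q - X Q) * fst b + fst Q"
      unfolding fst_q[of Q] c_def fst_conv by (simp add: algebra_simps)
    have s: "H Q * snd c = (X Q + H Q - 1 - k * H Q) * snd a + (k * H Q - X Q) * snd b + snd Q"
      unfolding snd_q[of Q] c_def snd_conv by (simp add: algebra_simps)
    have bound: "0 \<le> z \<and> z \<le> M" if "H Q * z = (X Q + H Q - 1 - k * H Q) * x1 + (k * H Q - X Q) * x2 + x3"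
      "0 \<le> x1" "x1 \<le> M" "0 \<le> x2" "x2 \<le> M" "0 \<le> x3" "x3 \<le> M" for z x1 x2 x3 M
    proof -
      have "0 \<le> H Q * z" unfolding that(1) using w that by simp
      moreover have "H Q * z \<le> (X Q + H Q - 1 - k * H Q) * M + (k * H Q - X Q) * M + M"
        unfolding that(1) using w that by (intro add_mono mult_left_mono) auto
      hence "H Q * z \<le> H Q * M" by (simp add: algebra_simps)
      ultimately show ?thesis using Q(2) by (simp add: zero_le_mult_iff)
    qed
    show ?thesis using bound[OF f, of "int m"] bound[OF s, of "int n"] aL Q(1)
      by (auto simp: lattice_points_def mem_Times_iff)
  qed
  have Hab: "H q = ori a b q" for q by (simp add: H_def)
  have cop_ac: "{a, c} \<in> edges m n"
  proof -
    have "(fst b - fst a) * (snd c - snd a) - (snd b - snd a) * (fst c - fst a) = 1"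
      using Hc unfolding H_def ori_def .
    hence "coprime (fst c - fst a) (snd c - snd a)"
      by (metis coprimeI dvd_diff dvd_mult)
    thus ?thesis using aL cL by (simp add: pair_edge_iff)
  qed
  have cop_bc: "{b, c} \<in> edges m n"
  proof -
    have "(fst b - fst a) * (snd c - snd b) - (snd b - snd a) * (fst c - fst b) = 1"
      using Hc unfolding H_def ori_def by (simp add: algebra_simps)
    hence "coprime (fst c - fst b) (snd c - snd b)"
      by (metis coprimeI dvd_diff dvd_mult)
    thus ?thesis using aL cL by (simp add: pair_edge_iff)
  qed
  \<comment> \<open>heights of lattice points are integers\<close>
  have strip_only: "f \<in> F" if f: "f \<in> T" and p: "p \<in> hull_of f" "0 < rH p" "rH p < 1" for f p
  proof -
    obtain P' Q' where pq: "f = {P', Q'}" using triangulation_edges[OF T f] edge_endpoints by metis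
    obtain r :: real where r: "0 \<le> r" "r \<le> 1" "rH p = (1 - r) * H P' + r * H Q'" using on_pair p(1) pq by blast
    have "H P' \<ge> 1 \<or> H Q' \<ge> 1"
    proof (rule ccontr)
      assume "\<not> ?thesis"
      hence "real_of_int (H P') \<le> 0" "real_of_int (H Q') \<le> 0" by auto
      hence "(1 - r) * H P' \<le> 0" "r * H Q' \<le> 0" using r by (auto simp: mult_nonneg_nonpos)
      thus False using r p by linarith
    qed
    moreover have "H P' \<le> 0 \<or> H Q' \<le> 0"
    proof (rule ccontr)
      assume "\<not> ?thesis"
      hence "real_of_int (H P') \<ge> 1" "real_of_int (H Q') \<ge> 1" by auto
      hence "(1 - r) * 1 \<le> (1 - r) * H P'" "r * 1 \<le> r * H Q'" using r by (intro mult_left_mono; simp)+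
      hence "(1 - r) * 1 + r * 1 \<le> rH p" unfolding r(3) by (rule add_mono)
      thus False using p by simp
    qed
    ultimately show ?thesis using f unfolding F_def pq by (smt (verit) insert_commute mem_Collect_eq)
  qed
  have side: "\<not> crosses {d, c} f" if f: "f \<in> T" and d: "d = a \<or> d = b" for f d
  proof
    assume cr: "crosses {d, c} f"
    have dc: "{d, c} \<in> edges m n" using d cop_ac cop_bc by auto
    have fE: "f \<in> edges m n" using triangulation_edges T f by blast
    obtain p where nf: "{d, c} \<noteq> f" and p: "p \<in> hull_of {d, c}" "p \<in> hull_of f" "p \<notin> emb ` ({d, c} \<inter> f)"
      using cr unfolding crosses_def by blast
    have nl: "p \<noteq> emb q" for q
      using p lattice_point_of_edge[OF dc, of q] lattice_point_of_edge[OF fE, of q] by blast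
    obtain y :: real where y: "0 \<le> y" "y \<le> 1" "rX p = (1 - y) * X d + y * real_of_int k" "rH p = y"
      using on_pair[OF p(1)] d Hc Xc by auto
    have "y \<noteq> 0" using inj[of p "emb d"] nl[of d] y d by auto
    moreover have "y \<noteq> 1" using inj[of p "emb c"] nl[of c] y d Xc Hc by auto
    ultimately have y01: "0 < y" "y < 1" using y by auto
    have fF: "f \<in> F" using strip_only[OF f p(2)] y y01 by auto
    have px: "(1 - y) * pos f 0 + y * pos f 1 = (1 - y) * X d + y * real_of_int k"
      using on_f[OF fF p(2)] y pos_aff[of f y] by (simp add: algebra_simps)
    have "pos f 0 = X d \<and> pos f 1 = k"
    proof (cases "pos f 0 \<le> 0")
      case True
      have 1: "pos f 0 \<le> X d" using True d Xb by auto
      have 2: "pos f 1 \<le> k" using Lk fF True by blast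
      have "(1 - y) * (X d - pos f 0) \<ge> 0" "y * (k - pos f 1) \<ge> 0" using 1 2 y01 by auto
      moreover have "(1 - y) * (X d - pos f 0) + y * (k - pos f 1) = 0" using px by (simp add: algebra_simps)
      ultimately have "(1 - y) * (X d - pos f 0) = 0" "y * (k - pos f 1) = 0" by linarith+
      thus ?thesis using y01 by simp
    next
      case False
      hence F1: "pos f 0 \<ge> 1" using s_side[OF fF] by auto
      have 1: "pos f 0 \<ge> X d" using F1 d Xb by auto
      have 2: "pos f 1 \<ge> k" using Rk fF F1 by blast
      have "(1 - y) * (pos f 0 - X d) \<ge> 0" "y * (pos f 1 - k) \<ge> 0" using 1 2 y01 by auto
      moreover have "(1 - y) * (pos f 0 - X d) + y * (pos f 1 - k) = 0" using px by (simp add: algebra_simps)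
      ultimately have "(1 - y) * (pos f 0 - X d) = 0" "y * (pos f 1 - k) = 0" by linarith+
      thus ?thesis using y01 by simp
    qed
    moreover have h1: "real_of_int (H (top f)) \<ge> 1" using tb[OF fF] by simp
    ultimately have "emb d \<in> hull_of f" "emb c \<in> hull_of f"
      using f_pt[OF fF, of 0] f_pt[OF fF, of 1] inj[of _ "emb d"] inj[of _ "emb c"] d Hc Xc by auto
    hence "d \<in> f" "c \<in> f" using lattice_point_of_edge[OF fE] by auto
    moreover have "d \<noteq> c" using d Hc by auto
    ultimately have "f = {d, c}" using tb[OF fF] by (metis doubleton_eq_iff insertE singletonD)
    thus False using nf by simp
  qed
  have "{a, c} \<in> T" using triangulation_maximal[OF T cop_ac] side by blast
  moreover have "{b, c} \<in> T" using triangulation_maximal[OF T cop_bc] side by blast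
  ultimately show ?thesis using cL Hc unfolding H_def by blast
qed

lemma edge_subset_lattice: "e \<in> edges m n \<Longrightarrow> e \<subseteq> lattice_points m n"
  by (auto elim: edge_endpoints)

section \<open>One edge at every midpoint\<close>

lemma hull_edge_in_triangulation:
  assumes T: "T \<in> triangulations m n" and e: "{a, b} \<in> edges m n"
    and side: "\<And>q. q \<in> lattice_points m n \<Longrightarrow> ori a b q \<ge> 0"
  shows "{a, b} \<in> T"
proof (rule triangulation_maximal[OF T e])
  fix f assume f: "f \<in> T"
  then obtain c d where cd: "f = {c, d}" "c \<in> lattice_points m n" "d \<in> lattice_points m n"
    using triangulation_edges[OF T] edge_endpoints by metis
  have "ori a b c * ori a b d \<ge> 0" using side cd by simp
  thus "\<not> crosses {a, b} f"
    using crosses_imp_separated[of a b m n c d] e f triangulation_edges[OF T f] cd by auto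
qed

lemma edge_midpoint_pair:
  "a \<noteq> b \<Longrightarrow> edge_midpoint {a, b} =
     ((rfst a + rfst b) / 2, (rsnd a + rsnd b) / 2)"
  by (simp add: edge_midpoint_def emb_def)

lemma edge_midpoint_eq_iff:
  assumes "a \<noteq> b" "c \<noteq> d"
  shows "edge_midpoint {a, b} = edge_midpoint {c, d} \<longleftrightarrow>
     fst a + fst b = fst c + fst d \<and> snd a + snd b = snd c + snd d"
proof -
  have "real_of_int x / 2 = real_of_int y / 2 \<longleftrightarrow> x = y" for x y by simp
  thus ?thesis
    unfolding edge_midpoint_pair[OF assms(1)] edge_midpoint_pair[OF assms(2)]
    by (simp only: of_int_add[symmetric] prod.inject)
qed

lemma edge_midpoint_not_lattice:
  assumes "e \<in> edges m n"
  shows "edge_midpoint e \<noteq> emb c"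
proof
  assume eq: "edge_midpoint e = emb c"
  obtain a b where ab: "e = {a, b}" "a \<noteq> b" using assms edge_endpoints by metis
  have "real_of_int (fst a + fst b) = real_of_int (2 * fst c)" "real_of_int (snd a + snd b) = real_of_int (2 * snd c)"
    using eq unfolding ab(1) edge_midpoint_pair[OF ab(2)] by (auto simp: emb_def field_simps)
  hence "fst a + fst b = 2 * fst c" "snd a + snd b = 2 * snd c" by linarith+
  hence "fst b - fst a = 2 * (fst c - fst a)" "snd b - snd a = 2 * (snd c - snd a)" by simp_all
  hence "2 dvd fst b - fst a" "2 dvd snd b - snd a" by (metis dvd_triv_left)+
  moreover have "coprime (fst b - fst a) (snd b - snd a)" using assms ab pair_edge_iff by simp
  ultimately have "is_unit (2::int)" using coprime_common_divisor by blast
  thus False by simp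
qed

lemma edge_midpoint_in_hull: "e \<in> edges m n \<Longrightarrow> edge_midpoint e \<in> hull_of e"
proof -
  assume "e \<in> edges m n"
  then obtain a b where ab: "e = {a, b}" "a \<noteq> b" using edge_endpoints by metis
  show ?thesis unfolding ab(1) edge_midpoint_pair[OF ab(2)]
    by (rule hull_of_pairI[of "1/2"]) (auto simp: field_simps)
qed

lemma edge_midpoint_in_midpoints:
  assumes e: "e \<in> edges m n"
  shows "edge_midpoint e \<in> midpoints m n"
proof -
  obtain a b where ab: "e = {a, b}" "a \<noteq> b" "a \<in> lattice_points m n" "b \<in> lattice_points m n"
    using e edge_endpoints by metis
  have ge: "0 \<le> fst a" "0 \<le> snd a" "0 \<le> fst b" "0 \<le> snd b" "fst a \<le> m" "fst b \<le> m" "snd a \<le> n" "snd b \<le> n"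
    using ab by (auto simp: lattice_points_def)
  have "edge_midpoint e = (real (nat (fst a + fst b)) / 2, real (nat (snd a + snd b)) / 2)"
    unfolding ab(1) edge_midpoint_pair[OF ab(2)] using ge by simp
  moreover have "nat (fst a + fst b) \<le> 2 * m" "nat (snd a + snd b) \<le> 2 * n" using ge by auto
  moreover have "edge_midpoint e \<notin> emb ` lattice_points m n" using edge_midpoint_not_lattice[OF e] by blast
  ultimately show ?thesis unfolding midpoints_def by blast
qed

lemma same_midpoint_noncrossing:
  assumes "e \<in> edges m n" "f \<in> edges m n" "\<not> crosses e f" "edge_midpoint e = edge_midpoint f"
  shows "e = f"
proof (rule ccontr)
  assume "e \<noteq> f"
  obtain c where "edge_midpoint e = emb c"
    using meet_at_vertex[OF assms(3) \<open>e \<noteq> f\<close> edge_midpoint_in_hull[OF assms(1)]]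
      edge_midpoint_in_hull[OF assms(2)] assms(4) by metis
  thus False using edge_midpoint_not_lattice[OF assms(1)] by simp
qed

lemma triangulation_same_midpoint:
  assumes "T \<in> triangulations m n" "e \<in> T" "f \<in> T" "edge_midpoint e = edge_midpoint f"
  shows "e = f"
  by (rule same_midpoint_noncrossing[OF triangulation_edges[OF assms(1,2)] triangulation_edges[OF assms(1,3)]
        triangulation_noncrossing[OF assms(1-3)] assms(4)])

text \<open>The coordinates \<open>phi\<close> and \<open>psi\<close> stand for \<open>fst\<close> and \<open>snd\<close> in either order, and \<open>(X, Y)\<close> is twice the
half-lattice point under consideration. The line on which \<open>phi\<close> equals \<open>X / 2\<close> contains no lattice
point, so it is crossed only by interiors of edges; \<open>W a b\<close> measures how far the point lies on the
positive side of the edge from \<open>a\<close> to \<open>b\<close>. Among the edges that cross this line below the point, take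
the one crossing it highest. If it does not pass through the point, the face over it has another side
crossing the line still higher, hence above the point, and the point would be interior to a unimodular
triangle. That is impossible, as its three barycentric weights, doubled, would be positive integers of
sum two.\<close>

lemma column_cover:
  fixes phi psi :: "point \<Rightarrow> int" and X Y :: int and T :: "edge set"
  defines "D \<equiv> \<lambda>a b c. (phi b - phi a) * (psi c - psi a) - (psi b - psi a) * (phi c - phi a)"
  defines "W \<equiv> \<lambda>a b. (phi b - phi a) * (Y - 2 * psi a) - (psi b - psi a) * (X - 2 * phi a)"
  assumes tri: "\<And>a b P. {a, b} \<in> T \<Longrightarrow> P \<in> L \<Longrightarrow> D a b P > 0 \<Longrightarrow>
      \<exists>c\<in>L. D a b c = 1 \<and> {a, c} \<in> T \<and> {b, c} \<in> T"
    and L: "finite L" "\<Union>T \<subseteq> L" and X: "odd X"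
    and pq: "p \<in> L" "q \<in> L" "phi p + phi q = X" "psi p + psi q = Y"
    and base: "{a0, b0} \<in> T" "2 * phi a0 < X" "X < 2 * phi b0" "W a0 b0 \<ge> 0"
  shows "\<exists>a b. {a, b} \<in> T \<and> 2 * phi a < X \<and> X < 2 * phi b \<and> W a b = 0"
proof -
  define S where "S = {(a, b). {a, b} \<in> T \<and> 2 * phi a < X \<and> X < 2 * phi b \<and> W a b \<ge> 0}"
  define r where "r = (\<lambda>(a, b). real_of_int (W a b) / real_of_int (phi b - phi a))"
  have "S \<subseteq> L \<times> L" using L unfolding S_def by auto
  hence finS: "finite S" using L finite_subset by blast
  have "(a0, b0) \<in> S" using base unfolding S_def by simp
  hence neS: "S \<noteq> {}" by blast
  have "Min (r ` S) \<in> r ` S" using finS neS by (intro Min_in) auto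
  then obtain ab where "ab \<in> S" "r ab = Min (r ` S)" by auto
  then obtain a b where ab: "(a, b) \<in> S" and mn: "r (a, b) = Min (r ` S)" by (cases ab) auto
  have minr: "r (a, b) \<le> r z" if "z \<in> S" for z unfolding mn using finS that by auto
  have abT: "{a, b} \<in> T" "2 * phi a < X" "X < 2 * phi b" "W a b \<ge> 0" using ab unfolding S_def by auto
  show ?thesis
  proof (cases "W a b = 0")
    case True thus ?thesis using abT by blast
  next
    case False
    hence Wp: "W a b > 0" using abT by simp
    have "D a b p + D a b q = W a b"
      unfolding D_def W_def pq(3,4)[symmetric] by (simp add: algebra_simps)
    hence "D a b p > 0 \<or> D a b q > 0" using Wp by linarith
    then obtain c where c: "c \<in> L" "D a b c = 1" "{a, c} \<in> T" "{b, c} \<in> T"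
      using tri[OF abT(1)] pq by blast
    have sum: "W a b + W b c + W c a = 2 * D a b c" unfolding W_def D_def by (simp add: algebra_simps)
    \<comment> \<open>the values of \<open>W\<close> are the doubled barycentric weights of the point in the face\<close>
    have bary: "W b c * (2 * phi a - X) + W c a * (2 * phi b - X) + W a b * (2 * phi c - X) = 0"
      unfolding W_def by (simp add: algebra_simps)
    have anti: "W c b = - W b c" "W a c = - W c a" unfolding W_def by (simp_all add: algebra_simps)
    have below: "W x y < 0" if xy: "{x, y} \<in> T" "2 * phi x < X" "X < 2 * phi y"
      and lt: "W x y * (phi b - phi a) < W a b * (phi y - phi x)" for x y
    proof (rule ccontr)
      assume "\<not> ?thesis"
      hence "(x, y) \<in> S" using xy unfolding S_def by simp
      hence le: "r (a, b) \<le> r (x, y)" by (rule minr)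
      have "real_of_int (W x y) * real_of_int (phi b - phi a) < real_of_int (W a b) * real_of_int (phi y - phi x)"
        using lt by (metis of_int_less_iff of_int_mult)
      moreover have "real_of_int (phi b - phi a) > 0" "real_of_int (phi y - phi x) > 0" using abT xy by auto
      ultimately have "r (x, y) < r (a, b)"
        unfolding r_def by (simp add: divide_simps mult_ac del: of_int_diff)
      thus False using le by simp
    qed
    have "2 * phi c \<noteq> X" using X by auto
    then consider "2 * phi c < X" | "2 * phi c > X" by linarith
    hence False
    proof cases
      case 1
      have "W a b * (phi b - phi c) - W c b * (phi b - phi a) = D a b c * (2 * phi b - X)"
        unfolding W_def D_def by (simp add: algebra_simps)
      hence "W c b * (phi b - phi a) < W a b * (phi b - phi c)" using c abT by simp
      hence "W c b < 0" using 1 c abT by (intro below) (auto simp: insert_commute)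
      hence w: "W b c \<ge> 1" "W a b \<ge> 1" "W c a \<le> 0" using anti Wp sum c by auto
      have "W b c * (2 * phi a - X) < 0" using w abT by (intro mult_pos_neg) auto
      moreover have "W c a * (2 * phi b - X) \<le> 0" using w abT by (intro mult_nonpos_nonneg) auto
      moreover have "W a b * (2 * phi c - X) < 0" using w 1 by (intro mult_pos_neg) auto
      ultimately show False using bary by linarith
    next
      case 2
      have "W a b * (phi c - phi a) - W a c * (phi b - phi a) = D a b c * (X - 2 * phi a)"
        unfolding W_def D_def by (simp add: algebra_simps)
      hence "W a c * (phi b - phi a) < W a b * (phi c - phi a)" using c abT by simp
      hence "W a c < 0" using 2 c abT by (intro below) auto
      hence w: "W c a \<ge> 1" "W a b \<ge> 1" "W b c \<le> 0" using anti Wp sum c by auto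
      have "W c a * (2 * phi b - X) > 0" using w abT by (intro mult_pos_pos) auto
      moreover have "W b c * (2 * phi a - X) \<ge> 0" using w abT by (intro mult_nonpos_nonpos) auto
      moreover have "W a b * (2 * phi c - X) > 0" using w 2 by (intro mult_pos_pos) auto
      ultimately show False using bary by linarith
    qed
    thus ?thesis ..
  qed
qed

lemma halfway_on_primitive_segment:
  fixes p q r s :: int
  assumes cop: "coprime p q" and par: "p * s = q * r" and between: "0 < r \<and> r < 2 * p \<or> 0 < s \<and> s < 2 * q"
  shows "r = p \<and> s = q"
proof -
  obtain k where k: "r = k * p" "s = k * q" by (rule coprime_parallel_multiple[OF cop par])
  have "k = 1" if "0 < k * z" "k * z < 2 * z" for z
  proof -
    have z: "z > 0" using that by linarith
    have "0 < k" using that(1) z by (simp add: zero_less_mult_iff)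
    moreover have "k < 2" using mult_right_less_imp_less[OF that(2)] z by simp
    ultimately show ?thesis by simp
  qed
  hence "k = 1" using between k by blast
  thus ?thesis using k by simp
qed

text \<open>One of the two doubled coordinates is odd, which makes one of the two axis-parallel lines through the
midpoint free of lattice points. An edge through a half-lattice point has it as midpoint.\<close>

lemma triangulation_covers_midpoints:
  assumes T: "T \<in> triangulations m n" and x: "x \<in> midpoints m n"
  shows "\<exists>e\<in>T. edge_midpoint e = x"
proof -
  obtain i j where ij: "x = (real i / 2, real j / 2)" "i \<le> 2 * m" "j \<le> 2 * n"
    and nl: "x \<notin> emb ` lattice_points m n" using x unfolding midpoints_def by auto
  have "\<not> (even i \<and> even j)"
  proof
    assume "even i \<and> even j"
    then obtain i' j' where "i = 2 * i'" "j = 2 * j'" by (auto elim!: evenE)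
    hence "x = emb (int i', int j')" "(int i', int j') \<in> lattice_points m n"
      using ij by (auto simp: emb_def lattice_points_def)
    thus False using nl by blast
  qed
  hence odd: "odd i \<or> odd j" by blast
  let ?L = "lattice_points m n"
  have "finite ?L" by (simp add: lattice_points_def)
  moreover have "\<Union>T \<subseteq> ?L"
    using triangulation_edges[OF T] edge_subset_lattice by blast
  ultimately have L: "finite ?L" "\<Union>T \<subseteq> ?L" by auto
  define p where "p = (int i div 2, int j div 2)"
  define q where "q = (int i - int i div 2, int j - int j div 2)"
  have pq: "p \<in> ?L" "q \<in> ?L" using ij unfolding p_def q_def lattice_points_def by auto
  have found: "edge_midpoint {a, b} = x" if "{a, b} \<in> T" "fst a + fst b = int i" "snd a + snd b = int j" for a b
  proof -
    have "a \<noteq> b" using triangulation_edges[OF T that(1)] edge_ends_neq by blast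
    have "rfst a + rfst b = real i" "rsnd a + rsnd b = real j"
      using that by (metis of_int_add of_int_of_nat_eq)+
    thus ?thesis unfolding edge_midpoint_pair[OF \<open>a \<noteq> b\<close>] ij by simp
  qed
  have tri: "\<exists>c\<in>?L. ori a b c = 1 \<and> {a, c} \<in> T \<and> {b, c} \<in> T" if "{a, b} \<in> T" "P \<in> ?L" "ori a b P > 0" for a b P
    using triangle_on_side[OF T that] .
  have cop: "coprime (fst b - fst a) (snd b - snd a)" if "{a, b} \<in> T" for a b
    using triangulation_edges[OF T that] pair_edge_iff by simp
  show ?thesis
  proof (cases "odd i")
    case True
    then obtain i' where i': "i = 2 * i' + 1" by (rule oddE)
    let ?a0 = "(int i', 0) :: point" and ?b0 = "(int i' + 1, 0) :: point"
    have "{?a0, ?b0} \<in> T"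
      by (rule hull_edge_in_triangulation[OF T])
         (use ij i' in \<open>auto simp: pair_edge_iff lattice_points_def ori_def\<close>)
    hence "\<exists>a b. {a, b} \<in> T \<and> 2 * fst a < int i \<and> int i < 2 * fst b \<and>
        (fst b - fst a) * (int j - 2 * snd a) - (snd b - snd a) * (int i - 2 * fst a) = 0"
      by (intro column_cover[where L = ?L and p = p and q = q and ?a0.0 = ?a0 and ?b0.0 = ?b0])
         (use tri L True pq i' in \<open>simp_all add: ori_def p_def q_def\<close>)
    then obtain a b where ab: "{a, b} \<in> T" "2 * fst a < int i" "int i < 2 * fst b"
      "(fst b - fst a) * (int j - 2 * snd a) = (snd b - snd a) * (int i - 2 * fst a)" by auto
    have "int i - 2 * fst a = fst b - fst a \<and> int j - 2 * snd a = snd b - snd a"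
      by (rule halfway_on_primitive_segment[OF cop[OF ab(1)] ab(4)]) (use ab(2,3) in auto)
    hence "fst a + fst b = int i" "snd a + snd b = int j" by auto
    thus ?thesis using ab found by blast
  next
    case False
    hence oj: "odd j" using odd by simp
    then obtain j' where j': "j = 2 * j' + 1" by (rule oddE)
    let ?a0 = "(0, int j') :: point" and ?b0 = "(0, int j' + 1) :: point"
    have "{?b0, ?a0} \<in> T"
      by (rule hull_edge_in_triangulation[OF T])
         (use ij j' in \<open>auto simp: pair_edge_iff lattice_points_def ori_def\<close>)
    hence b0: "{?a0, ?b0} \<in> T" by (simp add: insert_commute)
    have tri2: "\<exists>c\<in>?L. ori b a c = 1 \<and> {a, c} \<in> T \<and> {b, c} \<in> T" if "{a, b} \<in> T" "P \<in> ?L" "ori b a P > 0" for a b P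
      using tri[of b a P] that by (auto simp: insert_commute)
    have o: "(snd b - snd a) * (fst c - fst a) - (fst b - fst a) * (snd c - snd a) = ori b a c" for a b c
      unfolding ori_def by (simp add: algebra_simps)
    have "\<exists>a b. {a, b} \<in> T \<and> 2 * snd a < int j \<and> int j < 2 * snd b \<and>
        (snd b - snd a) * (int i - 2 * fst a) - (fst b - fst a) * (int j - 2 * snd a) = 0"
      by (intro column_cover[where L = ?L and p = p and q = q and ?a0.0 = ?a0 and ?b0.0 = ?b0]; (unfold o)?)
         (use tri2 L oj pq j' b0 in \<open>simp_all add: p_def q_def\<close>)
    then obtain a b where ab: "{a, b} \<in> T" "2 * snd a < int j" "int j < 2 * snd b"
      "(fst b - fst a) * (int j - 2 * snd a) = (snd b - snd a) * (int i - 2 * fst a)" by auto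
    have "int i - 2 * fst a = fst b - fst a \<and> int j - 2 * snd a = snd b - snd a"
      by (rule halfway_on_primitive_segment[OF cop[OF ab(1)] ab(4)]) (use ab(2,3) in auto)
    hence "fst a + fst b = int i" "snd a + snd b = int j" by auto
    thus ?thesis using ab found by blast
  qed
qed

text \<open>Maximality comes for free once all midpoints are taken, because two edges with the same midpoint
cross.\<close>

lemma triangulationI:
  assumes "T \<subseteq> edges m n" "noncrossing T" "\<And>x. x \<in> midpoints m n \<Longrightarrow> \<exists>e\<in>T. edge_midpoint e = x"
  shows "T \<in> triangulations m n"
proof -
  have "T' = T" if T': "T \<subseteq> T'" "T' \<subseteq> edges m n" "noncrossing T'" for T'
  proof
    show "T' \<subseteq> T"
    proof
      fix e assume e: "e \<in> T'"
      hence eE: "e \<in> edges m n" using T' by blast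
      obtain f where f: "f \<in> T" "edge_midpoint f = edge_midpoint e"
        using assms(3)[OF edge_midpoint_in_midpoints[OF eE]] by blast
      have "\<not> crosses e f" using e f T' unfolding noncrossing_def by blast
      moreover have "f \<in> edges m n" using f assms(1) by blast
      ultimately have "e = f" using same_midpoint_noncrossing[OF eE] f by simp
      thus "e \<in> T" using f by simp
    qed
  qed (use T' in simp)
  thus ?thesis using assms(1,2) unfolding triangulations_def by simp
qed

lemma edge_at_eq:
  assumes "T \<in> triangulations m n" "e \<in> T"
  shows "edge_at T (edge_midpoint e) = e"
  unfolding edge_at_def
proof (rule the_equality)
  show "e \<in> T \<and> edge_midpoint e = edge_midpoint e" using assms(2) by simp
  show "f = e" if "f \<in> T \<and> edge_midpoint f = edge_midpoint e" for f
    using triangulation_same_midpoint[OF assms(1) _ assms(2)] that by blast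
qed

lemma edge_at_in:
  assumes "T \<in> triangulations m n" "x \<in> midpoints m n"
  shows "edge_at T x \<in> T" "edge_midpoint (edge_at T x) = x"
proof -
  obtain e where "e \<in> T" "edge_midpoint e = x" using triangulation_covers_midpoints[OF assms] by blast
  thus "edge_at T x \<in> T" "edge_midpoint (edge_at T x) = x" using edge_at_eq[OF assms(1)] by metis+
qed

lemma finite_midpoints: "finite (midpoints m n)"
  and card_midpoints: "card (midpoints m n) \<le> (2 * m + 1) * (2 * n + 1)"
proof -
  let ?f = "\<lambda>(i::nat, j::nat). (real i / 2, real j / 2)"
  have sub: "midpoints m n \<subseteq> ?f ` ({..2 * m} \<times> {..2 * n})" unfolding midpoints_def by auto
  show "finite (midpoints m n)" using sub by (rule finite_subset) auto
  have "card (midpoints m n) \<le> card (?f ` ({..2 * m} \<times> {..2 * n}))" using sub by (intro card_mono) auto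
  also have "\<dots> \<le> card ({..2 * m} \<times> {..2 * n})" by (rule card_image_le) auto
  finally show "card (midpoints m n) \<le> (2 * m + 1) * (2 * n + 1)" by simp
qed

lemma card_triangulation:
  assumes "T \<in> triangulations m n"
  shows "finite T" "card T = card (midpoints m n)"
proof -
  show "finite T" using assms finite_edges finite_subset unfolding triangulations_def by blast
  have "bij_betw edge_midpoint T (midpoints m n)"
  proof (rule bij_betw_imageI)
    show "inj_on edge_midpoint T"
      using triangulation_same_midpoint[OF assms] by (auto intro: inj_onI)
    show "edge_midpoint ` T = midpoints m n"
    proof
      show "edge_midpoint ` T \<subseteq> midpoints m n"
        using edge_midpoint_in_midpoints triangulation_edges[OF assms] by blast
      show "midpoints m n \<subseteq> edge_midpoint ` T"
      proof
        fix x assume "x \<in> midpoints m n"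
        then obtain e where "e \<in> T" "edge_midpoint e = x" using triangulation_covers_midpoints[OF assms] by blast
        thus "x \<in> edge_midpoint ` T" by blast
      qed
    qed
  qed
  thus "card T = card (midpoints m n)" by (rule bij_betw_same_card)
qed

section \<open>Faces are unimodular\<close>

lemma convex_halfplane: "convex {p. rori x y p \<ge> 0}"
proof (rule convexI)
  fix p q :: "real \<times> real" and u v :: real
  assume pq: "p \<in> {p. rori x y p \<ge> 0}" "q \<in> {p. rori x y p \<ge> 0}" "0 \<le> u" "0 \<le> v" "u + v = 1"
  have u: "u = 1 - v" using pq by simp
  have "rori x y (u *\<^sub>R p + v *\<^sub>R q) = u * rori x y p + v * rori x y q"
    unfolding u by (simp add: rori_def algebra_simps)
  thus "u *\<^sub>R p + v *\<^sub>R q \<in> {p. rori x y p \<ge> 0}" using pq by simp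
qed

lemma hull_in_halfplane:
  assumes "\<And>s. s \<in> S \<Longrightarrow> ori x y s \<ge> 0" "p \<in> hull_of S"
  shows "rori x y p \<ge> 0"
proof -
  have "emb ` S \<subseteq> {p. rori x y p \<ge> 0}" using assms(1) by auto
  hence "hull_of S \<subseteq> {p. rori x y p \<ge> 0}"
    unfolding hull_of_def using hull_minimal[of "emb ` S" "{p. rori x y p \<ge> 0}" convex] convex_halfplane by blast
  thus ?thesis using assms(2) by blast
qed

text \<open>The three determinants, divided by \<open>ori a b c\<close>, are the barycentric coordinates.\<close>

lemma triangle_hull_iff:
  assumes D: "ori a b c > 0"
  shows "p \<in> hull_of {a, b, c} \<longleftrightarrow> rori a b p \<ge> 0 \<and> rori b c p \<ge> 0 \<and> rori c a p \<ge> 0"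
proof
  assume p: "p \<in> hull_of {a, b, c}"
  have 1: "ori b c a = ori a b c" "ori c a b = ori a b c" by (simp_all add: ori_def algebra_simps)
  show "rori a b p \<ge> 0 \<and> rori b c p \<ge> 0 \<and> rori c a p \<ge> 0"
    by (intro conjI hull_in_halfplane[OF _ p]) (use 1 D in auto)
next
  assume r: "rori a b p \<ge> 0 \<and> rori b c p \<ge> 0 \<and> rori c a p \<ge> 0"
  let ?D = "real_of_int (ori a b c)"
  have Dp: "?D > 0" using D by simp
  have sum: "rori b c p + rori c a p + rori a b p = ?D"
    unfolding rori_def ori_def by (simp add: algebra_simps)
  have f: "rori b c p * rfst a + rori c a p * rfst b + rori a b p * rfst c = ?D * fst p"
    unfolding rori_def ori_def by (simp add: algebra_simps)
  have s: "rori b c p * rsnd a + rori c a p * rsnd b + rori a b p * rsnd c = ?D * snd p"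
    unfolding rori_def ori_def by (simp add: algebra_simps)
  have "p = (rori b c p / ?D) *\<^sub>R emb a + (rori c a p / ?D) *\<^sub>R emb b + (rori a b p / ?D) *\<^sub>R emb c"
  proof -
    have "fst p = (rori b c p * rfst a + rori c a p * rfst b + rori a b p * rfst c) / ?D"
      unfolding f using Dp by simp
    moreover have "snd p = (rori b c p * rsnd a + rori c a p * rsnd b + rori a b p * rsnd c) / ?D"
      unfolding s using Dp by simp
    ultimately show ?thesis by (simp add: prod_eq_iff emb_def add_divide_distrib)
  qed
  moreover have "rori b c p / ?D + rori c a p / ?D + rori a b p / ?D = 1"
    unfolding add_divide_distrib[symmetric] sum using Dp by simp
  moreover have "rori b c p / ?D \<ge> 0" "rori c a p / ?D \<ge> 0" "rori a b p / ?D \<ge> 0" using r Dp by auto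
  ultimately show "p \<in> hull_of {a, b, c}"
    unfolding hull_of_def by (simp only: image_insert image_empty convex_hull_3) blast
qed

lemma strictly_inside_interior:
  assumes "ori a b p > 0" "ori b c p > 0" "ori c a p > 0"
  shows "emb p \<in> interior (hull_of {a, b, c})"
proof -
  let ?U = "{q. rori a b q > 0} \<inter> {q. rori b c q > 0} \<inter> {q. rori c a q > 0}"
  have "continuous_on UNIV (\<lambda>q. rori x y q)" for x y
    unfolding rori_def by (intro continuous_intros)
  hence "open {q. rori x y q > 0}" for x y
    by (rule open_Collect_less[OF continuous_on_const])
  hence "open ?U" by blast
  moreover have "ori a b p + ori b c p + ori c a p = ori a b c" by (simp add: ori_def algebra_simps)
  hence "ori a b c > 0" using assms by linarith
  hence "?U \<subseteq> hull_of {a, b, c}" using triangle_hull_iff[of a b c] by (auto simp del: split_paired_All)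
  moreover have "emb p \<in> ?U" using assms by simp
  ultimately show ?thesis using interiorI by blast
qed

text \<open>The barycentric coordinates are nonnegative integers with sum one.\<close>

lemma lattice_point_of_unimodular_triangle:
  assumes D: "ori a b c = 1" and p: "emb p \<in> hull_of {a, b, c}"
  shows "p \<in> {a, b, c}"
proof -
  have "rori a b (emb p) \<ge> 0" "rori b c (emb p) \<ge> 0" "rori c a (emb p) \<ge> 0"
    using triangle_hull_iff[of a b c] D p by auto
  hence r: "ori a b p \<ge> 0" "ori b c p \<ge> 0" "ori c a p \<ge> 0" by auto
  have "ori b c p + ori c a p + ori a b p = 1"
    using D unfolding ori_def by (simp add: algebra_simps)
  hence cases: "(ori b c p = 1 \<and> ori c a p = 0 \<and> ori a b p = 0) \<or>
     (ori b c p = 0 \<and> ori c a p = 1 \<and> ori a b p = 0) \<or> (ori b c p = 0 \<and> ori c a p = 0 \<and> ori a b p = 1)"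
    using r by linarith
  have "ori b c p * fst a + ori c a p * fst b + ori a b p * fst c = ori a b c * fst p"
    unfolding ori_def by (simp add: algebra_simps)
  moreover have "ori b c p * snd a + ori c a p * snd b + ori a b p * snd c = ori a b c * snd p"
    unfolding ori_def by (simp add: algebra_simps)
  ultimately show ?thesis using cases unfolding D by (auto simp: prod_eq_iff)
qed

lemma interior_triangle_disjoint_sides:
  assumes "q \<in> hull_of {x, y}" "x \<in> {a, b, c}" "y \<in> {a, b, c}"
  shows "q \<notin> interior (hull_of {a, b, c})"
proof -
  have i: "interior (convex hull {emb a, emb b, emb c}) = convex hull {emb a, emb b, emb c} -
    (closed_segment (emb a) (emb b) \<union> closed_segment (emb b) (emb c) \<union> closed_segment (emb c) (emb a))"
    by (rule interior_of_triangle) simp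
  have "q \<in> closed_segment (emb a) (emb b) \<union> closed_segment (emb b) (emb c) \<union> closed_segment (emb c) (emb a)"
    using assms unfolding hull_of_pair
    by (auto simp: closed_segment_commute)
  thus ?thesis unfolding hull_of_def using i by simp
qed

text \<open>An edge that enters the interior has to leave it in both directions. Without crossing a side it can
leave only through vertices of the triangle, and these must be its own endpoints; so it would be a
side.\<close>

lemma unimodular_triangle_empty:
  assumes D: "ori a b c = 1" and f: "f \<in> edges m n"
    and sides: "{a, b} \<in> edges m n" "{b, c} \<in> edges m n" "{c, a} \<in> edges m n"
    and nc: "\<not> crosses f {a, b}" "\<not> crosses f {b, c}" "\<not> crosses f {c, a}"
    and p: "p \<in> hull_of f"
  shows "p \<notin> interior (hull_of {a, b, c})"
proof
  let ?T = "hull_of {a, b, c}"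
  assume int: "p \<in> interior ?T"
  have pT: "p \<in> ?T" using int interior_subset by blast
  have pn: "p \<noteq> emb v" if "v \<in> {a, b, c}" for v
  proof
    assume "p = emb v"
    hence "p \<in> hull_of {v, v}" by (simp add: emb_in_hull)
    thus False using interior_triangle_disjoint_sides[of p v v a b c] that int by blast
  qed
  have pn: "p \<noteq> emb v" for v
    using pn[of v] lattice_point_of_unimodular_triangle[OF D, of v] pT by blast
  have fns: "f \<noteq> {x, y}" if "x \<in> {a, b, c}" "y \<in> {a, b, c}" for x y
    using interior_triangle_disjoint_sides[of p x y a b c] that p int by blast
  obtain P Q where PQ: "f = {P, Q}" "P \<noteq> Q" using f edge_endpoints by metis
  have key: "P' \<in> {a, b, c}" if PQ': "f = {P', Q'}" "P' \<noteq> Q'" for P' Q'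
  proof -
    have P'i: "emb P' \<notin> interior ?T"
    proof
      assume i: "emb P' \<in> interior ?T"
      hence "emb P' \<in> ?T" using interior_subset by blast
      hence "P' \<in> {a, b, c}" using lattice_point_of_unimodular_triangle[OF D] by blast
      moreover have "emb P' \<in> hull_of {P', P'}" by (simp add: emb_in_hull)
      ultimately show False using interior_triangle_disjoint_sides[of "emb P'" P' P' a b c] i by blast
    qed
    \<comment> \<open>walking from \<open>p\<close> towards the endpoint \<open>P'\<close> one meets the boundary\<close>
    have "closed_segment p (emb P') \<inter> frontier ?T \<noteq> {}"
    proof (cases "emb P' \<in> ?T")
      case True
      hence "emb P' \<in> frontier ?T" using P'i closure_subset unfolding frontier_def by blast
      thus ?thesis by auto
    next
      case False
      show ?thesis by (rule connected_Int_frontier) (use False pT in auto)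
    qed
    then obtain q where q: "q \<in> closed_segment p (emb P')" "q \<in> frontier ?T" by blast
    have "frontier ?T = closed_segment (emb a) (emb b) \<union> closed_segment (emb b) (emb c) \<union> closed_segment (emb c) (emb a)"
      unfolding hull_of_def by (simp add: frontier_of_triangle)
    hence "q \<in> hull_of {a, b} \<or> q \<in> hull_of {b, c} \<or> q \<in> hull_of {c, a}"
      using q(2) unfolding hull_of_pair by blast
    then obtain x y where xy: "x \<in> {a, b, c}" "y \<in> {a, b, c}" "q \<in> hull_of {x, y}" "\<not> crosses f {x, y}"
      using nc by blast
    have pf: "p \<in> closed_segment (emb P') (emb Q')" using p PQ' hull_of_pair by simp
    have "q \<in> hull_of f"
    proof -
      have "closed_segment p (emb P') \<subseteq> closed_segment (emb P') (emb Q')"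
        using pf by (simp add: subset_closed_segment)
      thus ?thesis using q(1) PQ' hull_of_pair by auto
    qed
    then obtain v where v: "v \<in> f" "v \<in> {x, y}" "q = emb v"
      using meet_at_vertex[OF xy(4) fns[OF xy(1,2)] _ xy(3)] by metis
    have "v \<noteq> Q'"
    proof
      assume vQ: "v = Q'"
      obtain s where s: "0 \<le> s" "s \<le> 1" "p = (1 - s) *\<^sub>R emb P' + s *\<^sub>R emb Q'"
        using pf by (auto simp: in_segment)
      obtain t where t: "0 \<le> t" "t \<le> 1" "emb Q' = (1 - t) *\<^sub>R p + t *\<^sub>R emb P'"
        using q(1) v(3) vQ by (auto simp: in_segment)
      define z where "z = emb P' - emb Q'"
      have "(1 - (1 - t) * s) *\<^sub>R z = 0"
      proof -
        have "emb Q' = (1 - t) *\<^sub>R ((1 - s) *\<^sub>R emb P' + s *\<^sub>R emb Q') + t *\<^sub>R emb P'" using t(3) s(3) by simp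
        hence e: "(1 - t) *\<^sub>R ((1 - s) *\<^sub>R emb P' + s *\<^sub>R emb Q') + t *\<^sub>R emb P' - emb Q' = 0" by simp
        have "(1 - (1 - t) * s) *\<^sub>R z = (1 - t) *\<^sub>R ((1 - s) *\<^sub>R emb P' + s *\<^sub>R emb Q') + t *\<^sub>R emb P' - emb Q'"
          unfolding z_def by (simp add: algebra_simps)
        thus ?thesis using e by simp
      qed
      moreover have "z \<noteq> 0" unfolding z_def using PQ' by simp
      ultimately have e1: "(1 - t) * s = 1" by simp
      have "(1 - t) * s \<le> 1 * s" using s t by (intro mult_right_mono) auto
      hence "s = 1" using e1 s by simp
      hence "p = emb Q'" using s by simp
      thus False using pn by blast
    qed
    hence "v = P'" using v PQ' by blast
    thus "P' \<in> {a, b, c}" using v(2) xy(1,2) by blast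
  qed
  have "P \<in> {a, b, c}" using key[OF PQ] .
  moreover have "Q \<in> {a, b, c}" using key[of Q P] PQ by (simp add: insert_commute)
  ultimately show False using fns PQ by blast
qed

lemma triangulation_edge_coprime:
  assumes "T \<in> triangulations m n" "{a, b} \<in> T"
  shows "coprime (fst b - fst a) (snd b - snd a)"
  using triangulation_edges[OF assms] pair_edge_iff by blast

lemma ori_edge_eq:
  assumes "{a, c} \<in> edges m n" "{a, c'} \<in> edges m n" "ori a c c' = 0" "ori a b c * ori a b c' > 0"
  shows "c = c'"
proof -
  have cop: "coprime (fst c - fst a) (snd c - snd a)" "coprime (fst c' - fst a) (snd c' - snd a)"
    using assms(1,2) pair_edge_iff by blast+
  have "(fst c - fst a) * (snd c' - snd a) = (snd c - snd a) * (fst c' - fst a)"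
    using assms(3) unfolding ori_def by simp
  from coprime_parallel[OF cop this] show ?thesis
  proof
    assume "fst c' - fst a = fst c - fst a \<and> snd c' - snd a = snd c - snd a"
    thus ?thesis by (simp add: prod_eq_iff)
  next
    assume "fst c' - fst a = - (fst c - fst a) \<and> snd c' - snd a = - (snd c - snd a)"
    hence e: "fst c' = 2 * fst a - fst c" "snd c' = 2 * snd a - snd c" by linarith+
    have "ori a b c' = - ori a b c" unfolding ori_def e by (simp add: algebra_simps)
    hence "ori a b c * ori a b c' \<le> 0" by simp
    thus ?thesis using assms(4) by linarith
  qed
qed

text \<open>For two apexes over the same edge on the same side, the signs of \<open>ori a c c'\<close> and \<open>ori b c c'\<close> decide
which of them lies inside the angles of the other triangle. If neither apex lies inside both angles of
the other triangle, two of the four sides cross; and \<open>c\<close> cannot lie inside the unimodular triangle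
over \<open>c'\<close>. What remains is equality or \<open>c'\<close> strictly inside the triangle over \<open>c\<close>.\<close>

lemma same_side_apex:
  assumes E: "{a, c} \<in> edges m n" "{b, c} \<in> edges m n" "{a, c'} \<in> edges m n" "{b, c'} \<in> edges m n"
    and nc: "\<not> crosses {a, c'} {b, c}" "\<not> crosses {b, c'} {a, c}"
    and o: "ori a b c > 0" "ori a b c' = 1"
  shows "c' = c \<or> (ori a b c' > 0 \<and> ori b c c' > 0 \<and> ori c a c' > 0)"
proof (cases "ori a c c' = 0 \<or> ori b c c' = 0")
  case True
  have "ori a b c * ori a b c' > 0" "ori b a c * ori b a c' > 0"
    using o unfolding ori_flip[of b a] by simp_all
  thus ?thesis using True ori_edge_eq[OF E(1,3)] ori_edge_eq[OF E(2,4)] by blast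
next
  case False
  have id1: "ori a b c + ori b c' c + ori c' a c = ori a b c'" by (simp add: ori_def algebra_simps)
  have id2: "ori b c' c = - ori b c c'" "ori c' a c = ori a c c'" "ori c a c' = - ori a c c'"
    "ori a c' b = - ori a b c'" "ori a c' c = - ori a c c'" "ori b c a = ori a b c" "ori b c' a = ori a b c'"
    "ori a c b = - ori a b c"
    by (simp_all add: ori_def algebra_simps)
  have "\<not> (ori a c c' < 0 \<and> ori b c c' < 0)"
  proof
    assume h: "ori a c c' < 0 \<and> ori b c c' < 0"
    have "crosses {a, c'} {b, c}"
      by (rule proper_imp_crosses) (use h o in \<open>simp_all add: id2 mult_less_0_iff\<close>)
    thus False using nc by simp
  qed
  moreover have "\<not> (ori a c c' > 0 \<and> ori b c c' > 0)"
  proof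
    assume h: "ori a c c' > 0 \<and> ori b c c' > 0"
    have "crosses {b, c'} {a, c}"
      by (rule proper_imp_crosses) (use h o in \<open>simp_all add: id2 mult_less_0_iff\<close>)
    thus False using nc by simp
  qed
  moreover have "\<not> (ori a c c' > 0 \<and> ori b c c' < 0)"
    using id1 id2 o by linarith
  ultimately have "ori a c c' < 0 \<and> ori b c c' > 0" using False by linarith
  thus ?thesis using o id2 by simp
qed

text \<open>A unimodular face, listed counterclockwise. Its emptiness follows, see \<open>tri_is_triangle\<close>.\<close>

definition tri :: "edge set \<Rightarrow> point \<Rightarrow> point \<Rightarrow> point \<Rightarrow> bool" where
  "tri T a b c \<longleftrightarrow> ori a b c = 1 \<and> {a, b} \<in> T \<and> {a, c} \<in> T \<and> {b, c} \<in> T"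

lemma tri_rotate: "tri T a b c \<Longrightarrow> tri T b c a"
  unfolding tri_def using ori_rotate[of b c a] by (auto simp: insert_commute)

lemma tri_unique:
  assumes T: "T \<in> triangulations m n" and 1: "tri T a b c" and 2: "tri T a b c'"
  shows "c = c'"
proof (rule ccontr)
  assume ne: "c \<noteq> c'"
  have "ori a b c' > 0 \<and> ori b c c' > 0 \<and> ori c a c' > 0"
    using same_side_apex[of a c m n b c'] 1 2 ne triangulation_edges[OF T] triangulation_noncrossing[OF T]
    unfolding tri_def by fastforce
  moreover have "ori a b c' + ori b c c' + ori c a c' = ori a b c" by (simp add: ori_def algebra_simps)
  ultimately show False using 1 unfolding tri_def by linarith
qed

lemma tri_is_triangle:
  assumes T: "T \<in> triangulations m n" and t: "tri T a b c"
  shows "is_triangle T {a, b, c}"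
proof -
  have s: "{a, b} \<in> T" "{b, c} \<in> T" "{c, a} \<in> T" "ori a b c = 1"
    using t unfolding tri_def by (auto simp: insert_commute)
  have "a \<noteq> b" "b \<noteq> c" "c \<noteq> a" using s(4) by auto
  hence "card {a, b, c} = 3" by simp
  moreover have "hull_of e \<inter> interior (hull_of {a, b, c}) = {}" if e: "e \<in> T" for e
    using unimodular_triangle_empty[OF s(4) triangulation_edges[OF T e] triangulation_edges[OF T s(1)]
      triangulation_edges[OF T s(2)] triangulation_edges[OF T s(3)]
      triangulation_noncrossing[OF T e s(1)] triangulation_noncrossing[OF T e s(2)]
      triangulation_noncrossing[OF T e s(3)]] by blast
  moreover have "{x, y} \<in> T" if "x \<in> {a, b, c}" "y \<in> {a, b, c}" "x \<noteq> y" for x y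
    using that s by (auto simp: insert_commute)
  ultimately show ?thesis unfolding is_triangle_def by blast
qed

text \<open>The unimodular face on the same side of \<open>{a, b}\<close> has the same apex, as otherwise its apex would be an
endpoint of an edge reaching into the interior of the given face.\<close>

lemma is_triangle_tri_pos:
  assumes T: "T \<in> triangulations m n" and t: "is_triangle T {a, b, c}" and pos: "ori a b c > 0"
  shows "tri T a b c"
proof -
  have ne: "a \<noteq> b" "b \<noteq> c" "a \<noteq> c" using pos by auto
  have s: "{a, b} \<in> T" "{a, c} \<in> T" "{b, c} \<in> T" using t ne unfolding is_triangle_def by blast+
  have cL: "c \<in> lattice_points m n" using edge_subset_lattice[OF triangulation_edges[OF T s(2)]] by blast
  obtain c' where c': "ori a b c' = 1" "{a, c'} \<in> T" "{b, c'} \<in> T"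
    using triangle_on_side[OF T s(1) cL pos] by blast
  have "c' = c \<or> (ori a b c' > 0 \<and> ori b c c' > 0 \<and> ori c a c' > 0)"
    by (rule same_side_apex[of a c m n b c'])
       (use s c' pos triangulation_edges[OF T] triangulation_noncrossing[OF T] in auto)
  moreover have "\<not> (ori a b c' > 0 \<and> ori b c c' > 0 \<and> ori c a c' > 0)"
  proof
    assume "ori a b c' > 0 \<and> ori b c c' > 0 \<and> ori c a c' > 0"
    hence "emb c' \<in> interior (hull_of {a, b, c})" using strictly_inside_interior by blast
    moreover have "emb c' \<in> hull_of {a, c'}" by (simp add: emb_in_hull)
    ultimately show False using t c'(2) unfolding is_triangle_def by blast
  qed
  ultimately show ?thesis using c' s unfolding tri_def by auto
qed

text \<open>A degenerate face is excluded by primitivity: of three collinear points with pairwise primitive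
differences two coincide.\<close>

lemma is_triangle_tri:
  assumes T: "T \<in> triangulations m n" and t: "is_triangle T {a, b, c}"
  shows "tri T a b c \<or> tri T b a c"
proof -
  have "card {a, b, c} = 3" using t unfolding is_triangle_def by simp
  hence ne: "a \<noteq> b" "b \<noteq> c" "a \<noteq> c" by (auto simp: card_insert_if split: if_splits)
  have s: "{a, b} \<in> T" "{a, c} \<in> T" "{b, c} \<in> T" using t ne unfolding is_triangle_def by blast+
  have "ori a b c \<noteq> 0"
  proof
    assume z: "ori a b c = 0"
    have c1: "coprime (fst b - fst a) (snd b - snd a)" and c2: "coprime (fst c - fst a) (snd c - snd a)"
      and c3: "coprime (fst c - fst b) (snd c - snd b)"
      using triangulation_edge_coprime[OF T] s by blast+
    have "(fst b - fst a) * (snd c - snd a) = (snd b - snd a) * (fst c - fst a)"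
      using z unfolding ori_def by simp
    from coprime_parallel[OF c1 c2 this] show False
    proof
      assume "fst c - fst a = fst b - fst a \<and> snd c - snd a = snd b - snd a"
      thus False using ne by (simp add: prod_eq_iff)
    next
      assume "fst c - fst a = - (fst b - fst a) \<and> snd c - snd a = - (snd b - snd a)"
      hence "fst c - fst b = 2 * (fst a - fst b)" "snd c - snd b = 2 * (snd a - snd b)" by auto
      hence "2 dvd fst c - fst b" "2 dvd snd c - snd b" by (metis dvd_triv_left)+
      hence "is_unit (2::int)" using c3 coprime_common_divisor by blast
      thus False by simp
    qed
  qed
  then consider "ori a b c > 0" | "ori b a c > 0" using ori_flip[of b a c] by linarith
  thus ?thesis
  proof cases
    case 1 thus ?thesis using is_triangle_tri_pos[OF T t] by blast
  next
    case 2
    have "is_triangle T {b, a, c}" using t by (simp add: insert_commute)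
    thus ?thesis using is_triangle_tri_pos[OF T _ 2] by blast
  qed
qed

section \<open>Flips exchange the diagonals of unimodular parallelograms\<close>

text \<open>The parallelogram with vertices \<open>a, d, b, c\<close> in counterclockwise order, whose diagonal \<open>{a, b}\<close> is
present.\<close>

definition flip_quad :: "edge set \<Rightarrow> point \<Rightarrow> point \<Rightarrow> point \<Rightarrow> point \<Rightarrow> bool" where
  "flip_quad T a b c d \<longleftrightarrow> tri T a b c \<and> tri T b a d \<and>
     fst a + fst b = fst c + fst d \<and> snd a + snd b = snd c + snd d"

lemma opposite_apexes:
  assumes cop: "coprime (fst b - fst a) (snd b - snd a)" and o: "ori a b c = 1" "ori b a d = 1"
  obtains k where "fst c + fst d - fst a - fst b = k * (fst b - fst a)"
    "snd c + snd d - snd a - snd b = k * (snd b - snd a)"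
proof -
  have "(fst b - fst a) * (snd c + snd d - snd a - snd b) = (snd b - snd a) * (fst c + fst d - fst a - fst b)"
    using o unfolding ori_def by (simp add: algebra_simps)
  thus ?thesis by (rule coprime_parallel_multiple[OF cop]) (rule that)
qed

text \<open>The two faces have opposite heights over their common edge, so \<open>c + d = a + b + k * (b - a)\<close> for an
integer \<open>k\<close>. By convexity the midpoint of \<open>c\<close> and \<open>d\<close> lies on the common edge, which leaves
\<open>k \<in> {-1, 0, 1}\<close>; for \<open>k = 1\<close> and \<open>k = -1\<close> it would be an endpoint of that edge, contradicting that
the endpoints are extreme.\<close>

lemma opposite_flip_quad:
  assumes T: "T \<in> triangulations m n" and 1: "tri T a b c" and 2: "tri T b a d"
    and conv: "convex (hull_of {a, b, c} \<union> hull_of {a, b, d})"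
    and ext: "{p. p extreme_point_of (hull_of {a, b, c} \<union> hull_of {a, b, d})} = emb ` {a, b, c, d}"
  shows "flip_quad T a b c d"
proof -
  let ?Q = "hull_of {a, b, c} \<union> hull_of {a, b, d}"
  have cop: "coprime (fst b - fst a) (snd b - snd a)"
    using 1 triangulation_edge_coprime[OF T] unfolding tri_def by blast
  have o: "ori a b c = 1" "ori b a d = 1" using 1 2 unfolding tri_def by auto
  obtain k where k: "fst c + fst d - fst a - fst b = k * (fst b - fst a)"
     "snd c + snd d - snd a - snd b = k * (snd b - snd a)"
    by (rule opposite_apexes[OF cop o])
  have cQ: "emb c \<in> ?Q" "emb d \<in> ?Q" by (simp_all add: emb_in_hull)
  define M where "M = midpoint (emb c) (emb d)"
  have "closed_segment (emb c) (emb d) \<subseteq> ?Q" by (rule closed_segment_subset[OF cQ conv])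
  hence M: "M \<in> ?Q" unfolding M_def using midpoint_in_closed_segment by blast
  have Mx: "fst M = (rfst a + rfst b + real_of_int k * (rfst b - rfst a)) / 2"
    using arg_cong[OF k(1), of real_of_int] unfolding M_def midpoint_def emb_def by (simp add: field_simps)
  have My: "snd M = (rsnd a + rsnd b + real_of_int k * (rsnd b - rsnd a)) / 2"
    using arg_cong[OF k(2), of real_of_int] unfolding M_def midpoint_def emb_def by (simp add: field_simps)
  define r where "r = (1 + real_of_int k) / 2"
  have mx: "fst M = (1 - r) * rfst a + r * rfst b"
    unfolding Mx r_def by (simp add: field_simps)
  have my: "snd M = (1 - r) * rsnd a + r * rsnd b"
    unfolding My r_def by (simp add: field_simps)
  have oo: "ori b c a = 1" "ori c a b = 1" "ori a d b = 1" "ori d b a = 1"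
    using o unfolding ori_def by (simp_all add: algebra_simps)
  have r1: "rori b c M = (1 - real_of_int k) / 2" "rori c a M = (1 + real_of_int k) / 2"
    and r2: "rori a d M = (1 + real_of_int k) / 2" "rori d b M = (1 - real_of_int k) / 2"
    unfolding rori_on_pair[OF mx my] oo by (simp_all add: r_def field_simps)
  have "- 1 \<le> k \<and> k \<le> 1"
  proof -
    from M have "M \<in> hull_of {a, b, c} \<or> M \<in> hull_of {b, a, d}" by (simp add: insert_commute)
    thus ?thesis
    proof
      assume "M \<in> hull_of {a, b, c}"
      hence "rori b c M \<ge> 0" "rori c a M \<ge> 0" using triangle_hull_iff[of a b c] o by auto
      thus ?thesis using r1 by simp
    next
      assume "M \<in> hull_of {b, a, d}"
      hence "rori a d M \<ge> 0" "rori d b M \<ge> 0" using triangle_hull_iff[of b a d] o by auto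
      thus ?thesis using r2 by simp
    qed
  qed
  hence "k = -1 \<or> k = 0 \<or> k = 1" by linarith
  moreover have "c \<noteq> d" using o ori_flip[of a b c] by auto
  hence Mo: "M \<in> open_segment (emb c) (emb d)" unfolding M_def by simp
  have "k \<noteq> 1"
  proof
    assume "k = 1"
    hence "M = emb b" using Mx My by (simp add: prod_eq_iff emb_def)
    moreover have "emb b extreme_point_of ?Q" using ext by blast
    ultimately show False using Mo cQ unfolding extreme_point_of_def by auto
  qed
  moreover have "k \<noteq> -1"
  proof
    assume "k = -1"
    hence "M = emb a" using Mx My by (simp add: prod_eq_iff emb_def)
    moreover have "emb a extreme_point_of ?Q" using ext by blast
    ultimately show False using Mo cQ unfolding extreme_point_of_def by auto
  qed
  ultimately have "k = 0" by blast
  thus ?thesis using k 1 2 unfolding flip_quad_def by auto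
qed

lemma parallelogram_hull:
  assumes o: "ori a b c = 1" "ori b a d = 1"
    and s: "fst a + fst b = fst c + fst d" "snd a + snd b = snd c + snd d"
  shows "hull_of {a, b, c} \<union> hull_of {a, b, d} = hull_of {a, b, c, d}"
    and "{p. p extreme_point_of hull_of {a, b, c, d}} = emb ` {a, b, c, d}"
proof -
  have d: "fst d = fst a + fst b - fst c" "snd d = snd a + snd b - snd c" using s by auto
  have os: "ori a d c = 1" "ori a d b = 1" "ori d b a = 1" "ori d b c = 1" "ori b c a = 1" "ori b c d = 1" "ori c a b = 1" "ori c a d = 1"
    "ori c d a = -1" "ori d c b = -1" "ori a b d = -1" "ori b a c = -1" "ori c d b = 1" "ori d c a = 1"
    using o(1) unfolding ori_def d by (simp_all add: algebra_simps)
  show U: "hull_of {a, b, c} \<union> hull_of {a, b, d} = hull_of {a, b, c, d}"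
  proof
    show "hull_of {a, b, c} \<union> hull_of {a, b, d} \<subseteq> hull_of {a, b, c, d}"
      unfolding hull_of_def by (intro Un_least hull_mono) auto
    show "hull_of {a, b, c, d} \<subseteq> hull_of {a, b, c} \<union> hull_of {a, b, d}"
    proof
      fix p assume p: "p \<in> hull_of {a, b, c, d}"
      have r: "rori a d p \<ge> 0" "rori d b p \<ge> 0" "rori b c p \<ge> 0" "rori c a p \<ge> 0"
        by (rule hull_in_halfplane[OF _ p]; use os in auto)+
      have fl: "rori b a p = - rori a b p" unfolding rori_def by (simp add: algebra_simps)
      show "p \<in> hull_of {a, b, c} \<union> hull_of {a, b, d}"
      proof (cases "rori a b p \<ge> 0")
        case True
        thus ?thesis using triangle_hull_iff[of a b c p] o r by simp
      next
        case False
        hence "rori b a p \<ge> 0" using fl by simp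
        hence "p \<in> hull_of {b, a, d}" using triangle_hull_iff[of b a d p] o r by simp
        thus ?thesis by (simp add: insert_commute)
      qed
    qed
  qed
  have sep: "emb x \<notin> hull_of S" if "ori y z x < 0" "\<And>s. s \<in> S \<Longrightarrow> ori y z s \<ge> 0" for x y z S
    using hull_in_halfplane[of S y z "emb x", OF that(2)] that(1) by auto
  have ne: "a \<noteq> b" "a \<noteq> c" "a \<noteq> d" "b \<noteq> c" "b \<noteq> d" "c \<noteq> d" using os by auto
  have A: "emb a \<notin> hull_of {b, c, d}" by (rule sep[of c d a]) (use os in auto)
  have B: "emb b \<notin> hull_of {a, c, d}" by (rule sep[of d c b]) (use os in auto)
  have C: "emb c \<notin> hull_of {a, b, d}" by (rule sep[of b a c]) (use os o in auto)
  have D: "emb d \<notin> hull_of {a, b, c}" by (rule sep[of a b d]) (use os o in auto)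
  have ind: "x \<notin> convex hull (emb ` {a, b, c, d} - {x})" if "x \<in> emb ` {a, b, c, d}" for x
  proof -
    have E: "emb ` {a, b, c, d} - {emb a} = emb ` {b, c, d}" "emb ` {a, b, c, d} - {emb b} = emb ` {a, c, d}"
      "emb ` {a, b, c, d} - {emb c} = emb ` {a, b, d}" "emb ` {a, b, c, d} - {emb d} = emb ` {a, b, c}"
      using ne by auto
    from that consider "x = emb a" | "x = emb b" | "x = emb c" | "x = emb d" by blast
    thus ?thesis
    proof cases
      case 1 show ?thesis unfolding 1 E(1) using A unfolding hull_of_def .
    next
      case 2 show ?thesis unfolding 2 E(2) using B unfolding hull_of_def .
    next
      case 3 show ?thesis unfolding 3 E(3) using C unfolding hull_of_def .
    next
      case 4 show ?thesis unfolding 4 E(4) using D unfolding hull_of_def .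
    qed
  qed
  have "compact (emb ` {a, b, c, d})" by (intro finite_imp_compact) auto
  from extreme_point_of_convex_hull_convex_independent[OF this ind]
  show "{p. p extreme_point_of hull_of {a, b, c, d}} = emb ` {a, b, c, d}"
    unfolding hull_of_def by blast
qed

text \<open>From here on flips are treated combinatorially: only the edges present in \<open>T\<close> and integer
determinants matter.\<close>

lemma flips_to_iff:
  assumes T: "T \<in> triangulations m n"
  shows "flips_to T e e' \<longleftrightarrow> (\<exists>a b c d. e = {a, b} \<and> e' = {c, d} \<and> flip_quad T a b c d)"
proof
  assume "flips_to T e e'"
  then obtain a b c d where e: "e = {a, b}" "e' = {c, d}" and cd: "c \<noteq> d"
    and t: "is_triangle T {a, b, c}" "is_triangle T {a, b, d}"
    and Q: "convex (hull_of {a, b, c} \<union> hull_of {a, b, d})"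
      "{p. p extreme_point_of (hull_of {a, b, c} \<union> hull_of {a, b, d})} = emb ` {a, b, c, d}"
    unfolding flips_to_def Let_def by blast
  have ab: "tri T a b c \<or> tri T b a c" "tri T a b d \<or> tri T b a d"
    using is_triangle_tri[OF T] t by auto
  have "\<not> (tri T a b c \<and> tri T a b d)" "\<not> (tri T b a c \<and> tri T b a d)"
    using tri_unique[OF T] cd by blast+
  with ab consider "tri T a b c" "tri T b a d" | "tri T b a c" "tri T a b d" by blast
  thus "\<exists>a b c d. e = {a, b} \<and> e' = {c, d} \<and> flip_quad T a b c d"
  proof cases
    case 1
    thus ?thesis using opposite_flip_quad[OF T 1 Q] e by blast
  next
    case 2
    have s: "{b, a, c} = {a, b, c}" "{b, a, d} = {a, b, d}" "{b, a, c, d} = {a, b, c, d}" by auto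
    have "flip_quad T b a c d"
      by (rule opposite_flip_quad[OF T 2]; unfold s; rule Q)
    thus ?thesis using e by (metis insert_commute)
  qed
next
  assume "\<exists>a b c d. e = {a, b} \<and> e' = {c, d} \<and> flip_quad T a b c d"
  then obtain a b c d where e: "e = {a, b}" "e' = {c, d}" and q: "flip_quad T a b c d" by blast
  have t: "tri T a b c" "tri T b a d" and s: "fst a + fst b = fst c + fst d" "snd a + snd b = snd c + snd d"
    using q unfolding flip_quad_def by auto
  have o: "ori a b c = 1" "ori b a d = 1" using t unfolding tri_def by auto
  have "c \<noteq> d" using o ori_flip[of a b c] by auto
  moreover have "is_triangle T {a, b, c}" using tri_is_triangle[OF T t(1)] .
  moreover have "is_triangle T {a, b, d}" using tri_is_triangle[OF T t(2)] by (simp add: insert_commute)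
  moreover have "convex (hull_of {a, b, c} \<union> hull_of {a, b, d})"
    unfolding parallelogram_hull(1)[OF o s] unfolding hull_of_def by (rule convex_convex_hull)
  moreover have "{p. p extreme_point_of (hull_of {a, b, c} \<union> hull_of {a, b, d})} = emb ` {a, b, c, d}"
    unfolding parallelogram_hull(1)[OF o s] by (rule parallelogram_hull(2)[OF o s])
  ultimately show "flips_to T e e'" unfolding flips_to_def Let_def using e by blast
qed

lemma flips_toE:
  assumes "T \<in> triangulations m n" "flips_to T e e'"
  obtains a b c d where "e = {a, b}" "e' = {c, d}" "flip_quad T a b c d"
proof -
  have "\<exists>a b c d. e = {a, b} \<and> e' = {c, d} \<and> flip_quad T a b c d"
    using assms(2) unfolding flips_to_iff[OF assms(1)] .
  thus ?thesis using that by (elim exE conjE)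
qed

lemma flips_toI:
  assumes "T \<in> triangulations m n" "flip_quad T a b c d"
  shows "flips_to T {a, b} {c, d}"
  unfolding flips_to_iff[OF assms(1)] by (intro exI[of _ a] exI[of _ b] exI[of _ c] exI[of _ d] conjI refl assms(2))

lemma flips_to_unique:
  assumes T: "T \<in> triangulations m n" and 1: "flips_to T e e1" and 2: "flips_to T e e2"
  shows "e1 = e2"
proof -
  obtain a b c d where e: "e = {a, b}" "e1 = {c, d}" and q: "flip_quad T a b c d"
    by (rule flips_toE[OF T 1])
  obtain a' b' c' d' where e': "e = {a', b'}" "e2 = {c', d'}" and q': "flip_quad T a' b' c' d'"
    by (rule flips_toE[OF T 2])
  have "(a' = a \<and> b' = b) \<or> (a' = b \<and> b' = a)" 

  proof -
    have "{a', b'} = {a, b}" using e(1) e'(1) by simp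
    thus ?thesis by (rule doubleton_eq_iff[THEN iffD1])
  qed
  hence "(c' = c \<and> d' = d) \<or> (c' = d \<and> d' = c)"
  proof
    assume h: "a' = a \<and> b' = b"
    have "c' = c" "d' = d"
      by (rule tri_unique[OF T]; use q q' h in \<open>auto simp: flip_quad_def\<close>)+
    thus ?thesis by blast
  next
    assume h: "a' = b \<and> b' = a"
    have "c' = d" "d' = c"
      by (rule tri_unique[OF T]; use q q' h in \<open>auto simp: flip_quad_def\<close>)+
    thus ?thesis by blast
  qed
  thus ?thesis using e e' by auto
qed

lemma flipped_eq:
  assumes "T \<in> triangulations m n" "flips_to T e e'"
  shows "flipped T e = e'"
  unfolding flipped_def
proof (rule the_equality)
  show "flips_to T e e'" by (rule assms(2))
  show "f = e'" if "flips_to T e f" for f by (rule flips_to_unique[OF assms(1) that assms(2)])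
qed

lemma triangulation_meets_triangle_in_sides:
  assumes T: "T \<in> triangulations m n" and t: "tri T a b c" and f: "f \<in> T"
    and p: "p \<in> hull_of f" "p \<in> hull_of {a, b, c}"
  shows "p \<in> hull_of {a, b} \<or> p \<in> hull_of {b, c} \<or> p \<in> hull_of {c, a}"
proof -
  have "\<forall>e\<in>T. hull_of e \<inter> interior (hull_of {a, b, c}) = {}"
    using tri_is_triangle[OF T t] unfolding is_triangle_def by (elim conjE)
  hence "hull_of f \<inter> interior (hull_of {a, b, c}) = {}" using f by (rule bspec)
  hence "p \<notin> interior (convex hull {emb a, emb b, emb c})" using p unfolding hull_of_def by auto
  moreover have "interior (convex hull {emb a, emb b, emb c}) = convex hull {emb a, emb b, emb c} -
    (closed_segment (emb a) (emb b) \<union> closed_segment (emb b) (emb c) \<union> closed_segment (emb c) (emb a))"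
    by (rule interior_of_triangle) simp
  moreover have "p \<in> convex hull {emb a, emb b, emb c}" using p(2) unfolding hull_of_def by simp
  ultimately show ?thesis unfolding hull_of_pair by blast
qed

lemma unimodular_coprime:
  assumes "ori a b c = 1"
  shows "coprime (fst b - fst a) (snd b - snd a)"
proof -
  have "(fst b - fst a) * (snd c - snd a) - (snd b - snd a) * (fst c - fst a) = 1"
    using assms unfolding ori_def .
  thus ?thesis by (metis coprimeI dvd_diff dvd_mult2)
qed

definition flip_edge :: "edge set \<Rightarrow> edge \<Rightarrow> edge \<Rightarrow> edge set" where
  "flip_edge T e e' = insert e' (T - {e})"

lemma flip_quad_ori:
  assumes "flip_quad T a b c d"
  shows "ori c d b = 1" "ori d c a = 1" "ori a b c = 1" "ori b a d = 1"
proof -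
  have o: "ori a b c = 1" "ori b a d = 1" using assms unfolding flip_quad_def tri_def by auto
  have d: "fst d = fst a + fst b - fst c" "snd d = snd a + snd b - snd c"
    using assms unfolding flip_quad_def by auto
  show "ori c d b = 1" "ori d c a = 1" "ori a b c = 1" "ori b a d = 1"
    using o unfolding ori_def d by (simp_all add: algebra_simps)
qed

lemma flip_quad_sides:
  assumes "flip_quad T a b c d"
  shows "{a, b} \<in> T" "{a, c} \<in> T" "{b, c} \<in> T" "{a, d} \<in> T" "{b, d} \<in> T"
    "a \<noteq> b" "a \<noteq> c" "a \<noteq> d" "b \<noteq> c" "b \<noteq> d" "c \<noteq> d"
  using assms flip_quad_ori[OF assms] unfolding flip_quad_def tri_def by (auto simp: insert_commute)

lemma flip_quad_midpoint:
  assumes "flip_quad T a b c d"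
  shows "edge_midpoint {c, d} = edge_midpoint {a, b}"
  using assms edge_midpoint_eq_iff[of c d a b] flip_quad_sides[OF assms] unfolding flip_quad_def by auto

lemma flip_quad_new_edge:
  assumes T: "T \<in> triangulations m n" and q: "flip_quad T a b c d"
  shows "{c, d} \<in> edges m n" "{c, d} \<notin> T"
proof -
  note s = flip_quad_sides[OF q]
  have "c \<in> lattice_points m n" "d \<in> lattice_points m n"
    using edge_subset_lattice[OF triangulation_edges[OF T s(2)]]
      edge_subset_lattice[OF triangulation_edges[OF T s(4)]] by auto
  thus "{c, d} \<in> edges m n" using unimodular_coprime[OF flip_quad_ori(1)[OF q]] pair_edge_iff by blast
  show "{c, d} \<notin> T"
  proof
    assume "{c, d} \<in> T"
    hence "{c, d} = {a, b}" using triangulation_same_midpoint[OF T _ s(1)] flip_quad_midpoint[OF q] by blast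
    thus False using s by (auto simp: doubleton_eq_iff)
  qed
qed

text \<open>A crossing point would lie in one of the two faces and, these being empty, on one of their sides. On the
old diagonal this is a crossing with an edge of \<open>T\<close>, and the other four sides meet the new diagonal
only at its endpoints.\<close>

lemma flip_quad_new_edge_crossing:
  assumes T: "T \<in> triangulations m n" and q: "flip_quad T a b c d" and f: "f \<in> T" "f \<noteq> {a, b}"
  shows "\<not> crosses {c, d} f"
proof
  assume "crosses {c, d} f"
  then obtain p where p: "p \<in> hull_of {c, d}" "p \<in> hull_of f" "p \<notin> emb ` ({c, d} \<inter> f)"
    unfolding crosses_def by blast
  note s = flip_quad_sides[OF q]
  note cd = flip_quad_new_edge[OF T q]
  have nl: "p \<noteq> emb v" for v
    using p lattice_point_of_edge[OF cd(1), of v] lattice_point_of_edge[OF triangulation_edges[OF T f(1)], of v] by blast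
  have t: "tri T a b c" "tri T b a d" using q unfolding flip_quad_def by auto
  have "hull_of {c, d} \<subseteq> hull_of {a, b, c, d}" unfolding hull_of_def by (intro hull_mono) auto
  hence "p \<in> hull_of {a, b, c} \<or> p \<in> hull_of {b, a, d}"
    using p(1) parallelogram_hull(1)[of a b c d] flip_quad_ori[OF q] q
    unfolding flip_quad_def by (auto simp: insert_commute)
  hence "p \<in> hull_of {a, b} \<or> p \<in> hull_of {c, b} \<or> p \<in> hull_of {c, a} \<or> p \<in> hull_of {d, a} \<or> p \<in> hull_of {d, b}"
    using triangulation_meets_triangle_in_sides[OF T t(1) f(1) p(2)]
      triangulation_meets_triangle_in_sides[OF T t(2) f(1) p(2)] by (auto simp: insert_commute)
  moreover have "p \<notin> hull_of {a, b}"
  proof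
    assume h: "p \<in> hull_of {a, b}"
    show False
      by (rule meet_at_vertex[OF triangulation_noncrossing[OF T f(1) s(1)] f(2) p(2) h]) (use nl in auto)
  qed
  ultimately obtain z w where zw: "p \<in> hull_of {z, w}" "z \<in> {c, d}" "w \<in> {a, b}" by blast
  have "{z, w} \<in> T" using zw s by (auto simp: insert_commute)
  hence zwE: "{z, w} \<in> edges m n" using triangulation_edges[OF T] by blast
  have "crosses {c, d} {z, w}"
  proof -
    have "w \<notin> {c, d}" using zw s by auto
    hence "{c, d} \<noteq> {z, w}" by blast
    thus ?thesis unfolding crosses_def using p(1) zw(1) nl by blast
  qed
  hence "ori c d z * ori c d w < 0" by (rule crosses_imp_separated[OF cd(1) zwE])
  thus False using zw(2) by auto
qed

lemma flip_quad_triangulation: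
  assumes T: "T \<in> triangulations m n" and q: "flip_quad T a b c d"
  shows "flip_edge T {a, b} {c, d} \<in> triangulations m n"
    and "flip_quad (flip_edge T {a, b} {c, d}) c d b a"
proof -
  let ?T = "flip_edge T {a, b} {c, d}"
  note s = flip_quad_sides[OF q]
  note cd = flip_quad_new_edge[OF T q]
  show "?T \<in> triangulations m n"
  proof (rule triangulationI)
    show "?T \<subseteq> edges m n" using cd triangulation_edges[OF T] unfolding flip_edge_def by blast
    show "noncrossing ?T"
      unfolding noncrossing_def
    proof (intro ballI)
      fix f g assume "f \<in> ?T" "g \<in> ?T"
      moreover have "\<not> crosses {c, d} {c, d}" by (simp add: crosses_def)
      ultimately show "\<not> crosses f g"
        using flip_quad_new_edge_crossing[OF T q] crosses_sym triangulation_noncrossing[OF T]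
        unfolding flip_edge_def by blast
    qed
    fix x assume "x \<in> midpoints m n"
    then obtain e where e: "e \<in> T" "edge_midpoint e = x" using triangulation_covers_midpoints[OF T] by blast
    show "\<exists>e\<in>?T. edge_midpoint e = x"
    proof (cases "e = {a, b}")
      case True
      thus ?thesis using e flip_quad_midpoint[OF q] unfolding flip_edge_def by auto
    next
      case False
      thus ?thesis using e unfolding flip_edge_def by auto
    qed
  qed
  have ne: "{a, c} \<noteq> {a, b}" "{b, c} \<noteq> {a, b}" "{a, d} \<noteq> {a, b}" "{b, d} \<noteq> {a, b}"
    using s by (auto simp: doubleton_eq_iff)
  have sd: "{c, b} \<in> ?T" "{c, a} \<in> ?T" "{d, a} \<in> ?T" "{d, b} \<in> ?T" "{c, d} \<in> ?T" "{d, c} \<in> ?T"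
    using s ne unfolding flip_edge_def by (auto simp: insert_commute)
  show "flip_quad ?T c d b a"
    using sd flip_quad_ori[OF q] q unfolding flip_quad_def tri_def by auto
qed

lemma flips_to_flip_edge:
  assumes T: "T \<in> triangulations m n" and f: "flips_to T e e'"
  shows "flip_edge T e e' \<in> triangulations m n" "flips_to (flip_edge T e e') e' e"
    "flip_edge (flip_edge T e e') e' e = T"
    "e \<in> T" "e' \<notin> T" "edge_midpoint e' = edge_midpoint e" "e' \<in> edges m n"
proof -
  obtain a b c d where e: "e = {a, b}" "e' = {c, d}" and q: "flip_quad T a b c d"
    by (rule flips_toE[OF T f])
  note t = flip_quad_triangulation[OF T q] and n = flip_quad_new_edge[OF T q]
  show 1: "flip_edge T e e' \<in> triangulations m n" using t e by simp
  have "flip_quad (flip_edge T e e') c d b a" using t e by simp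
  from flips_toI[OF 1 this] show "flips_to (flip_edge T e e') e' e" unfolding e by (simp add: insert_commute)
  show 2: "e \<in> T" "e' \<notin> T" using flip_quad_sides[OF q] n e by auto
  show "flip_edge (flip_edge T e e') e' e = T" using 2 unfolding flip_edge_def by blast
  show "edge_midpoint e' = edge_midpoint e" using flip_quad_midpoint[OF q] e by simp
  show "e' \<in> edges m n" using n e by simp
qed

section \<open>Lengths\<close>

lemma edge_length_pair:
  "int (edge_length {a, b}) = \<bar>fst b - fst a\<bar> + \<bar>snd b - snd a\<bar>"
  unfolding edge_length_def by (auto simp: max_def min_def)

lemma edge_length_le:
  assumes "e \<in> edges m n"
  shows "edge_length e \<le> m + n"
proof -
  obtain a b where ab: "e = {a, b}" "a \<in> lattice_points m n" "b \<in> lattice_points m n"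
    using assms edge_endpoints by metis
  have "\<bar>fst b - fst a\<bar> \<le> int m" "\<bar>snd b - snd a\<bar> \<le> int n" using ab by (auto simp: lattice_points_def)
  hence "int (edge_length e) \<le> int (m + n)" unfolding ab(1) edge_length_pair by simp
  thus ?thesis by simp
qed

lemma edge_length_pos:
  assumes "a \<noteq> b"
  shows "edge_length {a, b} > 0"
proof -
  have "int (edge_length {a, b}) > 0" unfolding edge_length_pair using assms by (auto simp: prod_eq_iff)
  thus ?thesis by simp
qed

text \<open>The product of \<open>p * r\<close> and \<open>q * s\<close> is the product of the consecutive integers \<open>p * s\<close> and \<open>q * r\<close>,
hence nonnegative. Thus either the two vectors or one of them and the negative of the other lie in a
common closed quadrant, where the length is additive.\<close>

lemma unimodular_same_quadrant:
  fixes p q r s :: int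
  assumes "\<bar>p * s - q * r\<bar> = 1"
  shows "(p * r \<ge> 0 \<and> q * s \<ge> 0) \<or> (p * r \<le> 0 \<and> q * s \<le> 0)"
proof (rule ccontr)
  assume "\<not> ?thesis"
  hence "(p * r < 0 \<and> q * s > 0) \<or> (p * r > 0 \<and> q * s < 0)" by linarith
  hence "(p * r) * (q * s) < 0" by (elim disjE conjE) (simp_all only: mult_neg_pos mult_pos_neg)
  moreover have "(p * r) * (q * s) = (p * s) * (q * r)" by (simp add: algebra_simps)
  moreover have "(p * s) * (q * r) \<ge> 0"
  proof -
    define x where "x = p * s"
    have y: "q * r = x + 1 \<or> q * r = x - 1" using assms unfolding x_def by linarith
    consider "x \<ge> 1" | "x = 0" | "x \<le> -1" by linarith
    hence "x * (q * r) \<ge> 0"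
    proof cases
      case 1
      hence "q * r \<ge> 0" using y by linarith
      thus ?thesis by (rule mult_nonneg_nonneg[rotated]) (use 1 in simp)
    next
      case 3
      hence "q * r \<le> 0" using y by linarith
      thus ?thesis by (rule mult_nonpos_nonpos[rotated]) (use 3 in simp)
    qed simp
    thus ?thesis unfolding x_def .
  qed
  ultimately show False by linarith
qed

lemma abs_add_same_sign:
  fixes x y :: int
  assumes "x * y \<ge> 0"
  shows "\<bar>x + y\<bar> = \<bar>x\<bar> + \<bar>y\<bar>"
  using assms by (auto simp: zero_le_mult_iff)

text \<open>Used for the vectors from a vertex of an edge to the other apexes at height \<open>1\<close>, which differ by
multiples of the edge vector.\<close>

lemma abs_shear:
  fixes x y k :: int
  assumes "x * y \<ge> 0" "k \<ge> 1"
  shows "\<bar>x + k * (x + y)\<bar> \<ge> \<bar>x + y\<bar> + \<bar>x\<bar>"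
proof -
  have "x * (x + y) \<ge> 0" using assms(1) by (simp add: distrib_left)
  hence "x * (k * (x + y)) \<ge> 0" using assms(2) by (metis mult.left_commute mult_nonneg_nonneg order_trans zero_le_one)
  hence "\<bar>x + k * (x + y)\<bar> = \<bar>x\<bar> + \<bar>k * (x + y)\<bar>" by (rule abs_add_same_sign)
  also have "\<bar>k * (x + y)\<bar> \<ge> \<bar>x + y\<bar>"
  proof -
    have "1 * \<bar>x + y\<bar> \<le> k * \<bar>x + y\<bar>" using assms(2) by (intro mult_right_mono) auto
    thus ?thesis using assms(2) by (simp add: abs_mult)
  qed
  ultimately show ?thesis by linarith
qed

lemma flip_quad_lengths:
  assumes q: "flip_quad T a b c d"
  shows "max (edge_length {a, b}) (edge_length {c, d}) = edge_length {a, c} + edge_length {a, d}"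
    "edge_length {b, c} = edge_length {a, d}" "edge_length {b, d} = edge_length {a, c}"
proof -
  have d: "fst d = fst a + fst b - fst c" "snd d = snd a + snd b - snd c"
    using q unfolding flip_quad_def by auto
  have "int (edge_length {b, c}) = int (edge_length {a, d})" unfolding edge_length_pair d by (simp add: abs_minus_commute)
  thus "edge_length {b, c} = edge_length {a, d}" by simp
  have "int (edge_length {b, d}) = int (edge_length {a, c})" unfolding edge_length_pair d by (simp add: abs_minus_commute)
  thus "edge_length {b, d} = edge_length {a, c}" by simp
  define p where "p = fst c - fst a"
  define r where "r = fst d - fst a"
  define q' where "q' = snd c - snd a"
  define s where "s = snd d - snd a"
  have "p * s - q' * r = - ori a b c" unfolding p_def r_def q'_def s_def d ori_def by (simp add: algebra_simps)
  hence det: "\<bar>p * s - q' * r\<bar> = 1" using flip_quad_ori[OF q] by simp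
  have ab: "fst b - fst a = p + r" "snd b - snd a = q' + s" unfolding p_def r_def q'_def s_def d by simp_all
  have cd: "fst d - fst c = r - p" "snd d - snd c = s - q'" unfolding p_def r_def q'_def s_def by simp_all
  have L: "int (edge_length {a, b}) = \<bar>p + r\<bar> + \<bar>q' + s\<bar>" "int (edge_length {c, d}) = \<bar>r - p\<bar> + \<bar>s - q'\<bar>"
    "int (edge_length {a, c}) = \<bar>p\<bar> + \<bar>q'\<bar>" "int (edge_length {a, d}) = \<bar>r\<bar> + \<bar>s\<bar>"
    unfolding edge_length_pair ab cd p_def q'_def r_def s_def by simp_all
  let ?m = "int (edge_length {a, c}) + int (edge_length {a, d})"
  have le: "int (edge_length {a, b}) \<le> ?m" "int (edge_length {c, d}) \<le> ?m"
  proof -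
    have "\<bar>p + r\<bar> + \<bar>q' + s\<bar> \<le> (\<bar>p\<bar> + \<bar>r\<bar>) + (\<bar>q'\<bar> + \<bar>s\<bar>)" by (intro add_mono abs_triangle_ineq)
    also have "\<dots> = ?m" unfolding L by (simp only: ac_simps)
    finally show "int (edge_length {a, b}) \<le> ?m" unfolding L(1) .
    have "\<bar>r - p\<bar> + \<bar>s - q'\<bar> \<le> (\<bar>r\<bar> + \<bar>p\<bar>) + (\<bar>s\<bar> + \<bar>q'\<bar>)" by (intro add_mono abs_triangle_ineq4)
    also have "\<dots> = ?m" unfolding L by (simp only: ac_simps)
    finally show "int (edge_length {c, d}) \<le> ?m" unfolding L(2) .
  qed
  have "int (edge_length {a, b}) = ?m \<or> int (edge_length {c, d}) = ?m"
    using unimodular_same_quadrant[OF det]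
  proof
    assume h: "p * r \<ge> 0 \<and> q' * s \<ge> 0"
    have "\<bar>p + r\<bar> = \<bar>p\<bar> + \<bar>r\<bar>" "\<bar>q' + s\<bar> = \<bar>q'\<bar> + \<bar>s\<bar>"
      using abs_add_same_sign[of p r] abs_add_same_sign[of q' s] h by simp_all
    hence "int (edge_length {a, b}) = ?m" unfolding L by (simp only: ac_simps)
    thus ?thesis ..
  next
    assume h: "p * r \<le> 0 \<and> q' * s \<le> 0"
    have "\<bar>r + (- p)\<bar> = \<bar>r\<bar> + \<bar>- p\<bar>" "\<bar>s + (- q')\<bar> = \<bar>s\<bar> + \<bar>- q'\<bar>"
      using h by (intro abs_add_same_sign; simp add: mult.commute)+
    hence "\<bar>r - p\<bar> = \<bar>r\<bar> + \<bar>p\<bar>" "\<bar>s - q'\<bar> = \<bar>s\<bar> + \<bar>q'\<bar>" by (simp_all only: abs_minus_cancel diff_conv_add_uminus)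
    hence "int (edge_length {c, d}) = ?m" unfolding L by (simp only: ac_simps)
    thus ?thesis ..
  qed
  thus "max (edge_length {a, b}) (edge_length {c, d}) = edge_length {a, c} + edge_length {a, d}"
    using le by (auto simp: max_def)
qed

lemma zero_sum_nonpos_products:
  fixes x y z :: int
  assumes "x + y + z = 0" "x * y \<le> 0" "y * z \<le> 0" "z * x \<le> 0"
  shows "x = 0 \<or> y = 0 \<or> z = 0"
proof -
  have z: "z = - x - y" using assms(1) by linarith
  show ?thesis using assms unfolding z by (auto simp: mult_le_0_iff)
qed

text \<open>Two of the three side vectors lie in a common closed quadrant, and the third side is then as long as
these two together. Otherwise all products of corresponding coordinates of two side vectors would be
nonpositive; as the side vectors add up to zero, each coordinate vanishes for one of the three sides
and yields at most one negative product, which excludes at most two of the three pairs.\<close>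

lemma unimodular_longest_side:
  assumes "\<bar>ori a b c\<bar> = 1"
  obtains "(fst b - fst a) * (fst c - fst b) \<ge> 0" "(snd b - snd a) * (snd c - snd b) \<ge> 0"
  | "(fst c - fst b) * (fst a - fst c) \<ge> 0" "(snd c - snd b) * (snd a - snd c) \<ge> 0"
  | "(fst a - fst c) * (fst b - fst a) \<ge> 0" "(snd a - snd c) * (snd b - snd a) \<ge> 0"
proof -
  define x1 y1 z1 x2 y2 z2 where d: "x1 = fst b - fst a" "y1 = fst c - fst b" "z1 = fst a - fst c"
    "x2 = snd b - snd a" "y2 = snd c - snd b" "z2 = snd a - snd c"
  have "x1 * y2 - x2 * y1 = ori a b c" "y1 * z2 - y2 * z1 = ori a b c" "z1 * x2 - z2 * x1 = ori a b c"
    unfolding d ori_def by (simp_all add: algebra_simps)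
  hence o: "\<bar>x1 * y2 - x2 * y1\<bar> = 1" "\<bar>y1 * z2 - y2 * z1\<bar> = 1" "\<bar>z1 * x2 - z2 * x1\<bar> = 1" using assms by auto
  have s: "x1 + y1 + z1 = 0" "x2 + y2 + z2 = 0" unfolding d by simp_all
  have "(x1 * y1 \<ge> 0 \<and> x2 * y2 \<ge> 0) \<or> (y1 * z1 \<ge> 0 \<and> y2 * z2 \<ge> 0) \<or> (z1 * x1 \<ge> 0 \<and> z2 * x2 \<ge> 0)"
  proof (rule ccontr)
    assume n: "\<not> ?thesis"
    hence np: "x1 * y1 \<le> 0" "x2 * y2 \<le> 0" "y1 * z1 \<le> 0" "y2 * z2 \<le> 0" "z1 * x1 \<le> 0" "z2 * x2 \<le> 0"
      using unimodular_same_quadrant[OF o(1)] unimodular_same_quadrant[OF o(2)] unimodular_same_quadrant[OF o(3)]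
      by blast+
    have "x1 = 0 \<or> y1 = 0 \<or> z1 = 0" using zero_sum_nonpos_products[OF s(1) np(1,3,5)] .
    moreover have "x2 = 0 \<or> y2 = 0 \<or> z2 = 0" using zero_sum_nonpos_products[OF s(2) np(2,4,6)] .
    ultimately show False using n by auto
  qed
  thus ?thesis using that unfolding d by blast
qed

section \<open>Connecting triangulations by flips\<close>

lemma apex_multiple:
  assumes "coprime (fst c - fst a) (snd c - snd a)" "ori c a b = ori c a b'"
  obtains k where "fst b' = fst b + k * (fst c - fst a)" "snd b' = snd b + k * (snd c - snd a)"
proof -
  have "(fst c - fst a) * (snd b' - snd b) = (snd c - snd a) * (fst b' - fst b)"
    using assms(2) unfolding ori_def by (simp add: algebra_simps)
  then obtain k where "fst b' - fst b = k * (fst c - fst a)" "snd b' - snd b = k * (snd c - snd a)"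
    by (rule coprime_parallel_multiple[OF assms(1)])
  thus ?thesis using that[of k] by simp
qed

text \<open>Here \<open>{a, c}\<close> is longer than \<open>{a, b}\<close>, hence common to both triangulations. The face of \<open>T\<close> over it
has another apex \<open>b' = b + k * (c - a)\<close>. According to the sign of \<open>k\<close>, the edge from \<open>b'\<close> to \<open>a\<close> or to
\<open>c\<close> is longer than \<open>{a, b}\<close> as well, so it belongs to \<open>S\<close>; but it crosses a side of the face of \<open>S\<close>.\<close>

lemma longest_difference_no_longer_side:
  assumes S: "S \<in> triangulations m n" and T: "T \<in> triangulations m n"
    and E: "{a, b} \<in> S" "{a, c} \<in> S" "{b, c} \<in> S" and nT: "{a, b} \<notin> T"
    and o: "\<bar>ori a b c\<bar> = 1"
    and q: "(fst b - fst a) * (fst c - fst b) \<ge> 0" "(snd b - snd a) * (snd c - snd b) \<ge> 0"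
    and longest: "\<And>f. f \<in> (S - T) \<union> (T - S) \<Longrightarrow> edge_length f \<le> edge_length {a, b}"
  shows False
proof -
  define x1 y1 x2 y2 where d: "x1 = fst b - fst a" "y1 = fst c - fst b" "x2 = snd b - snd a" "y2 = snd c - snd b"
  have ca: "fst c - fst a = x1 + y1" "snd c - snd a = x2 + y2" unfolding d by simp_all
  have xy: "x1 * y1 \<ge> 0" "x2 * y2 \<ge> 0" using q unfolding d .
  have sum: "\<bar>x1 + y1\<bar> = \<bar>x1\<bar> + \<bar>y1\<bar>" "\<bar>x2 + y2\<bar> = \<bar>x2\<bar> + \<bar>y2\<bar>"
    using abs_add_same_sign xy by blast+
  have lab: "int (edge_length {a, b}) = \<bar>x1\<bar> + \<bar>x2\<bar>" unfolding edge_length_pair d ..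
  have lbc: "int (edge_length {b, c}) = \<bar>y1\<bar> + \<bar>y2\<bar>" unfolding edge_length_pair d ..
  have "b \<noteq> c" using o by auto
  hence ypos: "\<bar>y1\<bar> + \<bar>y2\<bar> > 0" using edge_length_pos[of b c] lbc by simp
  have both: "f \<in> S" if "f \<in> T" "int (edge_length f) > \<bar>x1\<bar> + \<bar>x2\<bar>" for f
    using longest[of f] that lab by fastforce
  have "int (edge_length {a, c}) = \<bar>x1 + y1\<bar> + \<bar>x2 + y2\<bar>" unfolding edge_length_pair ca ..
  hence "edge_length {a, c} > edge_length {a, b}" using sum lab ypos by linarith
  hence acT: "{a, c} \<in> T" using longest[of "{a, c}"] E(2) by fastforce
  have bL: "b \<in> lattice_points m n" using edge_subset_lattice[OF triangulation_edges[OF S E(1)]] by blast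
  have oc: "ori c a b = ori a b c" "ori a c b = - ori a b c" by (simp_all add: ori_def algebra_simps)
  have "\<exists>b'. ori c a b' = ori a b c \<and> {a, b'} \<in> T \<and> {c, b'} \<in> T"
  proof (cases "ori a b c = 1")
    case True
    have "{c, a} \<in> T" using acT by (simp add: insert_commute)
    from triangle_on_side[OF T this bL] show ?thesis using True oc by auto
  next
    case False
    hence m1: "ori a b c = -1" using o by linarith
    have "ori c a b' = - ori a c b'" for b' by (simp add: ori_def algebra_simps)
    thus ?thesis using triangle_on_side[OF T acT bL] m1 oc by auto
  qed
  then obtain b' where b': "ori c a b' = ori a b c" "{a, b'} \<in> T" "{c, b'} \<in> T" by blast
  have cop: "coprime (fst c - fst a) (snd c - snd a)" using triangulation_edge_coprime[OF T acT] .
  obtain k where k: "fst b' = fst b + k * (fst c - fst a)" "snd b' = snd b + k * (snd c - snd a)"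
    by (rule apex_multiple[OF cop, of b b']) (use b'(1) oc in simp)
  have "b' \<noteq> b" using b'(2) nT by auto
  hence "k \<noteq> 0" using k by (auto simp: prod_eq_iff)
  have "ori a b c = 1 \<or> ori a b c = -1" using o by linarith
  hence sq: "ori a b c * ori a b c = 1" by auto
  show False
  proof (cases "k \<ge> 1")
    case True
    have ab': "fst b' - fst a = x1 + k * (x1 + y1)" "snd b' - snd a = x2 + k * (x2 + y2)"
      unfolding k d by (simp_all add: algebra_simps)
    have "int (edge_length {a, b'}) \<ge> (\<bar>x1 + y1\<bar> + \<bar>x1\<bar>) + (\<bar>x2 + y2\<bar> + \<bar>x2\<bar>)"
      unfolding edge_length_pair ab' by (rule add_mono[OF abs_shear[OF xy(1) True] abs_shear[OF xy(2) True]])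
    hence "int (edge_length {a, b'}) > \<bar>x1\<bar> + \<bar>x2\<bar>" using sum ypos by linarith
    hence abS: "{a, b'} \<in> S" by (rule both[OF b'(2)])
    have "ori a b' b = - k * ori a b c" "ori a b' c = ori a b c" "ori b c a = ori a b c" "ori b c b' = - k * ori a b c"
      unfolding ori_def k by (simp_all add: algebra_simps)
    hence "ori a b' b * ori a b' c = - k * (ori a b c * ori a b c)"
      "ori b c a * ori b c b' = - k * (ori a b c * ori a b c)" by simp_all
    hence "crosses {a, b'} {b, c}" using True sq by (intro proper_imp_crosses) simp_all
    thus False using triangulation_noncrossing[OF S abS E(3)] by blast
  next
    case False
    hence k1: "- k \<ge> 1" using \<open>k \<noteq> 0\<close> by linarith
    have "fst b' - fst c = - (y1 + (- k) * (y1 + x1))" "snd b' - snd c = - (y2 + (- k) * (y2 + x2))"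
      unfolding k d by (simp_all add: algebra_simps)
    hence ab': "\<bar>fst b' - fst c\<bar> = \<bar>y1 + (- k) * (y1 + x1)\<bar>" "\<bar>snd b' - snd c\<bar> = \<bar>y2 + (- k) * (y2 + x2)\<bar>"
      by (simp_all only: abs_minus_cancel)
    have yx: "y1 * x1 \<ge> 0" "y2 * x2 \<ge> 0" using xy by (simp_all add: mult.commute)
    have "\<bar>fst b' - fst c\<bar> \<ge> \<bar>y1 + x1\<bar> + \<bar>y1\<bar>" unfolding ab' by (rule abs_shear[OF yx(1) k1])
    moreover have "\<bar>snd b' - snd c\<bar> \<ge> \<bar>y2 + x2\<bar> + \<bar>y2\<bar>" unfolding ab' by (rule abs_shear[OF yx(2) k1])
    moreover have "\<bar>y1 + x1\<bar> = \<bar>x1\<bar> + \<bar>y1\<bar>" "\<bar>y2 + x2\<bar> = \<bar>x2\<bar> + \<bar>y2\<bar>" using sum by (simp_all add: add.commute)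
    ultimately have "int (edge_length {c, b'}) > \<bar>x1\<bar> + \<bar>x2\<bar>"
      unfolding edge_length_pair using sum ypos by linarith
    hence cbS: "{c, b'} \<in> S" by (rule both[OF b'(3)])
    have "ori c b' a = - ori a b c" "ori c b' b = - k * ori a b c" "ori a b b' = k * ori a b c"
      unfolding ori_def k by (simp_all add: algebra_simps)
    hence "ori c b' a * ori c b' b = k * (ori a b c * ori a b c)"
      "ori a b c * ori a b b' = k * (ori a b c * ori a b c)" by simp_all
    hence "crosses {c, b'} {a, b}" using k1 sq by (intro proper_imp_crosses) simp_all
    thus False using triangulation_noncrossing[OF S cbS E(1)] by blast
  qed
qed

lemma unit_sum_distinct:
  fixes p q a b :: int
  assumes "p + q = a + b" "\<bar>b - a\<bar> = 1"
  shows "p \<noteq> q"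
proof
  assume "p = q"
  hence "2 * p = 2 * a + (b - a)" using assms(1) by linarith
  moreover have "b - a = 1 \<or> b - a = -1" using assms(2) by linarith
  ultimately have "2 * p = 2 * a + 1 \<or> 2 * p = 2 * a - 1" by auto
  thus False by presburger
qed

lemma unit_sum_pair:
  fixes p q a b :: int
  assumes "p + q = a + b" "\<bar>q - p\<bar> = 1" "\<bar>b - a\<bar> = 1"
  shows "p = a \<and> q = b \<or> p = b \<and> q = a"
proof -
  have "q - p = b - a \<or> q - p = a - b" using assms(2,3) by linarith
  thus ?thesis using assms(1) by auto
qed

text \<open>By the preceding lemma \<open>{a, b}\<close> is the sum of the two other sides, with coordinates of equal sign, in
both faces next to it. This determines the apexes up to symmetry and makes the faces a parallelogram
whose other diagonal is not longer.\<close>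

lemma longest_difference_flippable:
  assumes S: "S \<in> triangulations m n" and T: "T \<in> triangulations m n"
    and e: "e \<in> S" "e \<notin> T"
    and longest: "\<And>f. f \<in> (S - T) \<union> (T - S) \<Longrightarrow> edge_length f \<le> edge_length e"
  shows "\<exists>e'. flips_to S e e' \<and> (e' \<in> T \<or> edge_length e' < edge_length e)"
proof -
  obtain a b where ab: "e = {a, b}" "a \<noteq> b" using triangulation_edges[OF S e(1)] edge_endpoints by metis
  have ba: "{b, a} = {a, b}" by (rule insert_commute)
  have abS: "{a, b} \<in> S" "{b, a} \<in> S" "{a, b} \<notin> T" "{b, a} \<notin> T" using e unfolding ab(1) ba by simp_all
  have long: "edge_length f \<le> edge_length {a, b}" "edge_length f \<le> edge_length {b, a}"
    if "f \<in> (S - T) \<union> (T - S)" for f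
    using longest[OF that] unfolding ab(1) ba by simp_all
  have side: "\<exists>q\<in>lattice_points m n. ori x y q > 0" if "{x, y} = {a, b}" for x y
  proof (rule ccontr)
    assume "\<not> ?thesis"
    hence "ori y x q \<ge> 0" if "q \<in> lattice_points m n" for q using that ori_flip[of y x q] by force
    moreover have yx: "{y, x} = {a, b}" using that insert_commute[of y x "{}"] by simp
    moreover have "{y, x} \<in> edges m n" using triangulation_edges[OF S abS(1)] unfolding yx .
    ultimately have "{y, x} \<in> T"
      using hull_edge_in_triangulation[OF T, of y x] by blast
    thus False using abS unfolding yx by blast
  qed
  have apex: "\<exists>c. tri S x y c \<and> (fst c - fst x) * (fst y - fst c) \<ge> 0 \<and> (snd c - snd x) * (snd y - snd c) \<ge> 0"
    if xy: "{x, y} = {a, b}" for x y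
  proof -
    obtain q where "q \<in> lattice_points m n" "ori x y q > 0" using side[OF xy] by blast
    moreover have yx: "{y, x} = {x, y}" by (rule insert_commute)
    have xyS: "{x, y} \<in> S" "{y, x} \<in> S" "{x, y} \<notin> T" "{y, x} \<notin> T"
      using abS unfolding yx xy by simp_all
    ultimately obtain c where c: "ori x y c = 1" "{x, c} \<in> S" "{y, c} \<in> S"
      using triangle_on_side[OF S xyS(1)] by blast
    have lg: "edge_length f \<le> edge_length {x, y}" "edge_length f \<le> edge_length {y, x}"
      if "f \<in> (S - T) \<union> (T - S)" for f
      using long[OF that] unfolding yx xy by simp_all
    have o: "\<bar>ori x y c\<bar> = 1" "\<bar>ori y x c\<bar> = 1" using c ori_flip[of y x c] by auto
    have "(fst c - fst y) * (fst x - fst c) \<ge> 0 \<and> (snd c - snd y) * (snd x - snd c) \<ge> 0"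
    proof (rule unimodular_longest_side[OF o(1)])
      assume "(fst y - fst x) * (fst c - fst y) \<ge> 0" "(snd y - snd x) * (snd c - snd y) \<ge> 0"
      thus ?thesis using longest_difference_no_longer_side[OF S T xyS(1) c(2,3) xyS(3) o(1)] lg by blast
    next
      assume h: "(fst x - fst c) * (fst y - fst x) \<ge> 0" "(snd x - snd c) * (snd y - snd x) \<ge> 0"
      have "(fst x - fst y) * (fst c - fst x) \<ge> 0" "(snd x - snd y) * (snd c - snd x) \<ge> 0"
        using h by (simp_all add: algebra_simps)
      thus ?thesis using longest_difference_no_longer_side[OF S T xyS(2) c(3,2) xyS(4) o(2)] lg by blast
    qed blast
    hence "(fst c - fst x) * (fst y - fst c) \<ge> 0 \<and> (snd c - snd x) * (snd y - snd c) \<ge> 0"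
      by (simp add: algebra_simps)
    thus ?thesis using c xyS unfolding tri_def by blast
  qed
  obtain c where c: "tri S a b c" "(fst c - fst a) * (fst b - fst c) \<ge> 0" "(snd c - snd a) * (snd b - snd c) \<ge> 0"
    using apex[of a b] by auto
  obtain d where d: "tri S b a d" "(fst d - fst b) * (fst a - fst d) \<ge> 0" "(snd d - snd b) * (snd a - snd d) \<ge> 0"
    using apex[of b a] by (auto simp: insert_commute)
  have o: "ori a b c = 1" "ori b a d = 1" using c d unfolding tri_def by auto
  have ne: "a \<noteq> c" "b \<noteq> c" "a \<noteq> d" "b \<noteq> d" using o by auto
  define x1 y1 x2 y2 where v: "x1 = fst c - fst a" "y1 = fst b - fst c" "x2 = snd c - snd a" "y2 = snd b - snd c"
  have xy: "x1 * y1 \<ge> 0" "x2 * y2 \<ge> 0" using c unfolding v by auto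
  have lab: "int (edge_length {a, b}) = \<bar>x1 + y1\<bar> + \<bar>x2 + y2\<bar>" unfolding edge_length_pair v by simp
  have lad: "edge_length {a, d} < edge_length {a, b}" "edge_length {b, d} < edge_length {a, b}"
  proof -
    have "\<bar>(fst d - fst b) + (fst a - fst d)\<bar> = \<bar>fst d - fst b\<bar> + \<bar>fst a - fst d\<bar>"
      "\<bar>(snd d - snd b) + (snd a - snd d)\<bar> = \<bar>snd d - snd b\<bar> + \<bar>snd a - snd d\<bar>"
      using abs_add_same_sign d by blast+
    hence "int (edge_length {a, b}) = int (edge_length {a, d}) + int (edge_length {b, d})"
      unfolding edge_length_pair by (simp add: abs_minus_commute)
    thus "edge_length {a, d} < edge_length {a, b}" "edge_length {b, d} < edge_length {a, b}"
      using edge_length_pos[of a d] edge_length_pos[of b d] ne by linarith+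
  qed
  have cop: "coprime (fst b - fst a) (snd b - snd a)" using triangulation_edge_coprime[OF S abS(1)] .
  obtain k where k: "fst c + fst d - fst a - fst b = k * (fst b - fst a)"
     "snd c + snd d - snd a - snd b = k * (snd b - snd a)"
    by (rule opposite_apexes[OF cop o])
  have yx: "y1 * x1 \<ge> 0" "y2 * x2 \<ge> 0" using xy by (simp_all add: mult.commute)
  have "\<not> k \<ge> 1"
  proof
    assume "k \<ge> 1"
    have da: "fst d - fst a = y1 + k * (y1 + x1)" "snd d - snd a = y2 + k * (y2 + x2)" using k unfolding v by auto
    have "\<bar>fst d - fst a\<bar> \<ge> \<bar>y1 + x1\<bar> + \<bar>y1\<bar>" "\<bar>snd d - snd a\<bar> \<ge> \<bar>y2 + x2\<bar> + \<bar>y2\<bar>"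
      unfolding da by (rule abs_shear[OF yx(1) \<open>k \<ge> 1\<close>], rule abs_shear[OF yx(2) \<open>k \<ge> 1\<close>])
    moreover have "\<bar>y1 + x1\<bar> = \<bar>x1 + y1\<bar>" "\<bar>y2 + x2\<bar> = \<bar>x2 + y2\<bar>" by (simp_all add: add.commute)
    ultimately have "int (edge_length {a, d}) \<ge> int (edge_length {a, b})"
      unfolding lab unfolding edge_length_pair by linarith
    thus False using lad by simp
  qed
  moreover have "\<not> k \<le> -1"
  proof
    assume "k \<le> -1"
    hence k1: "- k \<ge> 1" by simp
    have bd: "fst b - fst d = x1 + (- k) * (x1 + y1)" "snd b - snd d = x2 + (- k) * (x2 + y2)" using k unfolding v by auto
    have "\<bar>fst b - fst d\<bar> \<ge> \<bar>x1 + y1\<bar> + \<bar>x1\<bar>" "\<bar>snd b - snd d\<bar> \<ge> \<bar>x2 + y2\<bar> + \<bar>x2\<bar>"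
      unfolding bd by (rule abs_shear[OF xy(1) k1], rule abs_shear[OF xy(2) k1])
    hence "int (edge_length {b, d}) \<ge> int (edge_length {a, b})"
      unfolding lab unfolding edge_length_pair by linarith
    thus False using lad by simp
  qed
  ultimately have "k = 0" by linarith
  hence s: "fst a + fst b = fst c + fst d" "snd a + snd b = snd c + snd d" using k by auto
  have fq: "flip_quad S a b c d" using c d s unfolding flip_quad_def by auto
  hence fl: "flips_to S e {c, d}" using flips_toI[OF S] ab by simp
  note len = flip_quad_lengths[OF fq]
  have "int (edge_length {a, b}) = int (edge_length {a, c}) + int (edge_length {b, c})"
    unfolding lab abs_add_same_sign[OF xy(1)] abs_add_same_sign[OF xy(2)] unfolding edge_length_pair v
    by (simp add: abs_minus_commute)
  hence eq: "edge_length {a, b} = edge_length {a, c} + edge_length {a, d}" using len(2) by linarith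
  show ?thesis
  proof (cases "edge_length {c, d} < edge_length {a, b}")
    case True
    thus ?thesis using fl ab by blast
  next
    case False
    \<comment> \<open>equally long diagonals force a unit square, whose centre carries only two edges of length at most two\<close>
    hence leq: "edge_length {c, d} = edge_length {a, b}" using len eq by linarith
    have dd: "fst d - fst c = y1 - x1" "snd d - snd c = y2 - x2" using s unfolding v by auto
    have "\<bar>y1 - x1\<bar> + \<bar>y2 - x2\<bar> = \<bar>x1 + y1\<bar> + \<bar>x2 + y2\<bar>"
      using leq lab edge_length_pair[of c d] unfolding dd by simp
    moreover have "\<bar>y1 - x1\<bar> \<le> \<bar>x1 + y1\<bar>" "\<bar>y2 - x2\<bar> \<le> \<bar>x2 + y2\<bar>"
      using xy by (auto simp: zero_le_mult_iff)
    ultimately have eqs: "\<bar>y1 - x1\<bar> = \<bar>x1 + y1\<bar>" "\<bar>y2 - x2\<bar> = \<bar>x2 + y2\<bar>" by linarith+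
    have z: "x1 = 0 \<or> y1 = 0" "x2 = 0 \<or> y2 = 0" using eqs by linarith+
    have "(x1 + y1) * x2 - (x2 + y2) * x1 = - ori b a c" unfolding v ori_def by (simp add: algebra_simps)
    hence "(x1 + y1) * x2 - (x2 + y2) * x1 = 1" using o(1) ori_flip[of b a c] by simp
    hence det: "y1 * x2 - y2 * x1 = 1" by (simp add: algebra_simps)
    have unit: "\<bar>x1 + y1\<bar> = 1 \<and> \<bar>x2 + y2\<bar> = 1 \<and> \<bar>y1 - x1\<bar> = 1 \<and> \<bar>y2 - x2\<bar> = 1"
    proof (cases "x1 = 0")
      case True
      hence "y1 * x2 = 1" using det by simp
      hence "\<bar>y1\<bar> = 1" "\<bar>x2\<bar> = 1" by (metis abs_mult abs_one dvd_triv_left dvd_triv_right zdvd1_eq)+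
      moreover have "y2 = 0" using z \<open>\<bar>x2\<bar> = 1\<close> by auto
      ultimately show ?thesis using True by simp
    next
      case False
      hence "y1 = 0" using z by simp
      hence "(- y2) * x1 = 1" using det by simp
      hence "\<bar>- y2\<bar> = 1" "\<bar>x1\<bar> = 1" by (metis abs_mult abs_one dvd_triv_left dvd_triv_right zdvd1_eq)+
      moreover have "x2 = 0" using z \<open>\<bar>- y2\<bar> = 1\<close> by auto
      ultimately show ?thesis using \<open>y1 = 0\<close> by simp
    qed
    have mp: "edge_midpoint e \<in> midpoints m n" using edge_midpoint_in_midpoints[OF triangulation_edges[OF S e(1)]] .
    obtain f where f: "f \<in> T" "edge_midpoint f = edge_midpoint e" using triangulation_covers_midpoints[OF T mp] by blast
    have "f \<notin> S" using triangulation_same_midpoint[OF S _ e(1) f(2)] f(1) e(2) by blast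
    hence lf: "edge_length f \<le> edge_length {a, b}" using long f by blast
    obtain p q where pq: "f = {p, q}" "p \<noteq> q" using triangulation_edges[OF T f(1)] edge_endpoints by metis
    have spq: "fst p + fst q = fst a + fst b" "snd p + snd q = snd a + snd b"
      using edge_midpoint_eq_iff[OF pq(2) ab(2)] f(2) unfolding pq(1) ab(1) by auto
    have bA: "fst b - fst a = x1 + y1" "snd b - snd a = x2 + y2" unfolding v by simp_all
    have "\<bar>fst q - fst p\<bar> + \<bar>snd q - snd p\<bar> \<le> 2"
      using lf lab unit edge_length_pair[of p q] unfolding pq(1) by linarith
    moreover have bu: "\<bar>fst b - fst a\<bar> = 1" "\<bar>snd b - snd a\<bar> = 1" unfolding bA using unit by auto
    have "fst q \<noteq> fst p" "snd q \<noteq> snd p"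
      using unit_sum_distinct[OF spq(1) bu(1)] unit_sum_distinct[OF spq(2) bu(2)] by auto
    ultimately have qu: "\<bar>fst q - fst p\<bar> = 1" "\<bar>snd q - snd p\<bar> = 1" by linarith+
    have pc: "fst p = fst a \<and> fst q = fst b \<or> fst p = fst b \<and> fst q = fst a"
        "snd p = snd a \<and> snd q = snd b \<or> snd p = snd b \<and> snd q = snd a"
      using unit_sum_pair[OF spq(1) qu(1) bu(1)] unit_sum_pair[OF spq(2) qu(2) bu(2)] by blast+
    have du: "\<bar>fst d - fst c\<bar> = 1" "\<bar>snd d - snd c\<bar> = 1" unfolding dd using unit by auto
    have cc: "fst c = fst a \<and> fst d = fst b \<or> fst c = fst b \<and> fst d = fst a"
        "snd c = snd a \<and> snd d = snd b \<or> snd c = snd b \<and> snd d = snd a"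
      using unit_sum_pair[OF s(1)[symmetric] du(1) bu(1)] unit_sum_pair[OF s(2)[symmetric] du(2) bu(2)] by blast+
    have "{p, q} \<noteq> {a, b}" using f(1) e(2) pq ab by auto
    moreover have "c \<noteq> a" "c \<noteq> b" using ne by auto
    ultimately have "{p, q} = {c, d}" 
      using pc cc unfolding doubleton_eq_iff prod_eq_iff by (elim disjE conjE) simp_all
    hence "{c, d} \<in> T" using f pq by simp
    thus ?thesis using fl by blast
  qed
qed

text \<open>The potential that decreases along a flip path from \<open>S\<close> to \<open>T\<close>.\<close>

definition diff_length :: "edge set \<Rightarrow> edge set \<Rightarrow> nat" where
  "diff_length S T = (\<Sum>f\<in>(S - T) \<union> (T - S). edge_length f)"

lemma diff_length_sym: "diff_length S T = diff_length T S"
  unfolding diff_length_def by (simp add: Un_commute)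

lemma edge_length_edge_pos: "e \<in> edges m n \<Longrightarrow> edge_length e > 0"
  by (metis edge_endpoints edge_length_pos)

lemma diff_length_flip:
  assumes S: "S \<in> triangulations m n" and T: "T \<in> triangulations m n"
    and e: "e \<in> S" "e \<notin> T" and f: "flips_to S e e'"
    and short: "e' \<in> T \<or> edge_length e' < edge_length e"
  shows "diff_length (flip_edge S e e') T < diff_length S T"
proof -
  let ?D = "(S - T) \<union> (T - S)" and ?S = "flip_edge S e e'"
  let ?D' = "(?S - T) \<union> (T - ?S)"
  have fin: "finite ?D" using card_triangulation(1)[OF S] card_triangulation(1)[OF T] by simp
  have D: "(\<Sum>f\<in>?D. edge_length f) = edge_length e + (\<Sum>f\<in>?D - {e}. edge_length f)"
    using fin e by (intro sum.remove) auto
  have pos: "edge_length e > 0" using edge_length_edge_pos[OF triangulation_edges[OF S e(1)]] .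
  show ?thesis
  proof (cases "e' \<in> T")
    case True
    hence "?D' \<subseteq> ?D - {e}" using e unfolding flip_edge_def by auto
    hence "(\<Sum>f\<in>?D'. edge_length f) \<le> (\<Sum>f\<in>?D - {e}. edge_length f)"
      using fin by (intro sum_mono2) auto
    thus ?thesis unfolding diff_length_def using D pos by linarith
  next
    case False
    hence lt: "edge_length e' < edge_length e" using short by simp
    have "?D' \<subseteq> insert e' (?D - {e})" using e unfolding flip_edge_def by auto
    hence "(\<Sum>f\<in>?D'. edge_length f) \<le> (\<Sum>f\<in>insert e' (?D - {e}). edge_length f)"
      using fin by (intro sum_mono2) auto
    also have "\<dots> \<le> edge_length e' + (\<Sum>f\<in>?D - {e}. edge_length f)"
      using fin by (cases "e' \<in> ?D - {e}") (auto simp: insert_absorb)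
    finally show ?thesis unfolding diff_length_def using D lt by linarith
  qed
qed

lemma diff_length_le:
  assumes S: "S \<in> triangulations m n" and T: "T \<in> triangulations m n"
  shows "diff_length S T \<le> 2 * card (midpoints m n) * (m + n)"
proof -
  let ?D = "(S - T) \<union> (T - S)"
  have fin: "finite S" "finite T" using card_triangulation(1) S T by blast+
  have "diff_length S T \<le> of_nat (card ?D) * (m + n)"
    unfolding diff_length_def
    by (rule sum_bounded_above) (use edge_length_le triangulation_edges[OF S] triangulation_edges[OF T] in blast)
  moreover have "card ?D \<le> card (S \<union> T)" using fin by (intro card_mono) auto
  moreover have "card (S \<union> T) \<le> card S + card T" by (rule card_Un_le)
  moreover have "card S + card T = 2 * card (midpoints m n)" using card_triangulation(2) S T by simp
  ultimately have "diff_length S T \<le> card ?D * (m + n)" "card ?D \<le> 2 * card (midpoints m n)" by auto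
  thus ?thesis by (meson mult_le_mono1 order_trans)
qed

lemma total_length_eq_sum:
  assumes T: "T \<in> triangulations m n"
  shows "total_length m n T = (\<Sum>e\<in>T. edge_length e)"
proof -
  have img: "edge_midpoint ` T = midpoints m n"
  proof
    show "edge_midpoint ` T \<subseteq> midpoints m n"
      using edge_midpoint_in_midpoints triangulation_edges[OF T] by blast
    show "midpoints m n \<subseteq> edge_midpoint ` T"
    proof
      fix x assume x: "x \<in> midpoints m n"
      show "x \<in> edge_midpoint ` T" using edge_at_in[OF T x] by (intro image_eqI[of _ _ "edge_at T x"]) auto
    qed
  qed
  have inj: "inj_on edge_midpoint T" using triangulation_same_midpoint[OF T] by (auto intro: inj_onI)
  have "total_length m n T = (\<Sum>e\<in>T. edge_length (edge_at T (edge_midpoint e)))"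
    unfolding total_length_def img[symmetric] using inj by (simp add: sum.reindex)
  also have "\<dots> = (\<Sum>e\<in>T. edge_length e)" using edge_at_eq[OF T] by (intro sum.cong) auto
  finally show ?thesis .
qed

lemma total_length_flip:
  assumes T: "T \<in> triangulations m n" and f: "flips_to T e e'"
  shows "total_length m n (flip_edge T e e') + edge_length e = total_length m n T + edge_length e'"
proof -
  note F = flips_to_flip_edge[OF T f]
  have fin: "finite T" using card_triangulation(1)[OF T] .
  have "(\<Sum>e\<in>flip_edge T e e'. edge_length e) = edge_length e' + (\<Sum>e\<in>T - {e}. edge_length e)"
    unfolding flip_edge_def using fin F(5) by simp
  moreover have "(\<Sum>e\<in>T. edge_length e) = edge_length e + (\<Sum>e\<in>T - {e}. edge_length e)"
    using fin F(4) by (rule sum.remove)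
  ultimately show ?thesis unfolding total_length_eq_sum[OF T] total_length_eq_sum[OF F(1)] by simp
qed

section \<open>Locality and rates of updates\<close>

definition quad_sides :: "point \<Rightarrow> point \<Rightarrow> point \<Rightarrow> point \<Rightarrow> edge set" where
  "quad_sides a b c d = {{a, c}, {b, c}, {a, d}, {b, d}}"

lemma quad_sides_flip: "quad_sides c d b a = quad_sides a b c d"
  unfolding quad_sides_def by (auto simp: insert_commute)

lemma card_quad_sides: "card (quad_sides a b c d) \<le> 4"
  unfolding quad_sides_def by (rule card_insert_le_m1; simp)+

lemma tri_containing_diagonal:
  assumes S: "S \<in> triangulations m n" and q: "flip_quad S a b c d" and t: "tri S u v w" and uv: "{u, v} = {a, b}"
  shows "{u, w} \<in> quad_sides a b c d" "{v, w} \<in> quad_sides a b c d"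
proof -
  have tt: "tri S a b c" "tri S b a d" using q unfolding flip_quad_def by auto
  have "(u = a \<and> v = b) \<or> (u = b \<and> v = a)" using uv by (rule doubleton_eq_iff[THEN iffD1])
  hence "(u = a \<and> v = b \<and> w = c) \<or> (u = b \<and> v = a \<and> w = d)"
  proof
    assume h: "u = a \<and> v = b"
    have "w = c" by (rule tri_unique[OF S _ tt(1)]) (use t h in simp)
    thus ?thesis using h by simp
  next
    assume h: "u = b \<and> v = a"
    have "w = d" by (rule tri_unique[OF S _ tt(2)]) (use t h in simp)
    thus ?thesis using h by simp
  qed
  thus "{u, w} \<in> quad_sides a b c d" "{v, w} \<in> quad_sides a b c d" unfolding quad_sides_def by auto
qed

lemma tri_avoids_diagonal:
  assumes S: "S \<in> triangulations m n" and q: "flip_quad S a b c d" and t: "tri S u v w"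
    and e: "{u, v} \<notin> quad_sides a b c d" "{u, v} \<noteq> {a, b}"
  shows "{u, w} \<noteq> {a, b}" "{v, w} \<noteq> {a, b}"
proof -
  show "{v, w} \<noteq> {a, b}"
  proof
    assume h: "{v, w} = {a, b}"
    have "{v, u} \<in> quad_sides a b c d"
      by (rule tri_containing_diagonal(1)[OF S q tri_rotate[OF t] h])
    thus False using e(1) by (simp add: insert_commute)
  qed
  show "{u, w} \<noteq> {a, b}"
  proof
    assume h: "{u, w} = {a, b}"
    hence h': "{w, u} = {a, b}" by (simp add: insert_commute)
    have "{u, v} \<in> quad_sides a b c d"
      by (rule tri_containing_diagonal(2)[OF S q tri_rotate[OF tri_rotate[OF t]] h'])
    thus False using e(1) by simp
  qed
qed

text \<open>The faces next to \<open>e\<close> do not have \<open>{a, b}\<close> as a side, since the only two faces with that side have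
their remaining sides among the sides of the parallelogram. They survive the flip of \<open>{a, b}\<close>.\<close>

lemma flips_to_local:
  assumes S: "S \<in> triangulations m n" and q: "flip_quad S a b c d"
    and e: "e \<notin> quad_sides a b c d" "e \<noteq> {a, b}" and f: "flips_to S e f"
  shows "flips_to (flip_edge S {a, b} {c, d}) e f"
proof -
  let ?T = "flip_edge S {a, b} {c, d}"
  have T: "?T \<in> triangulations m n" using flip_quad_triangulation(1)[OF S q] .
  obtain p r s t where pr: "e = {p, r}" "f = {s, t}" and q': "flip_quad S p r s t"
    by (rule flips_toE[OF S f])
  have t1: "tri S p r s" and t2: "tri S r p t" using q' unfolding flip_quad_def by auto
  have e2: "{r, p} \<notin> quad_sides a b c d" "{r, p} \<noteq> {a, b}" using e pr by (auto simp: insert_commute)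
  have keep: "x \<in> ?T" if "x \<in> S" "x \<noteq> {a, b}" for x using that unfolding flip_edge_def by simp
  have "tri ?T p r s" using t1 tri_avoids_diagonal[OF S q t1] e pr keep unfolding tri_def by simp
  moreover have "tri ?T r p t" using t2 tri_avoids_diagonal[OF S q t2 e2] e2 keep unfolding tri_def by simp
  ultimately have "flip_quad ?T p r s t" using q' unfolding flip_quad_def by simp
  thus ?thesis unfolding pr by (rule flips_toI[OF T])
qed

lemma flip_quad_persists:
  assumes S: "S \<in> triangulations m n" and q: "flip_quad S a b c d"
    and e: "e \<notin> quad_sides a b c d" "e \<noteq> {a, b}"
  shows "flip_quad (flip_edge S e f) a b c d"
proof -
  have keep: "x \<in> flip_edge S e f" if "x \<in> S" "x \<noteq> e" for x using that unfolding flip_edge_def by simp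
  have "{b, a} \<noteq> e" using e by (auto simp: insert_commute)
  moreover have "{a, c} \<noteq> e" "{b, c} \<noteq> e" "{a, d} \<noteq> e" "{b, d} \<noteq> e" using e unfolding quad_sides_def by auto
  ultimately show ?thesis using q e(2) keep unfolding flip_quad_def tri_def by simp
qed

definition flip_rate :: "real \<Rightarrow> edge \<Rightarrow> edge \<Rightarrow> real" where
  "flip_rate lam e e' = lam ^ edge_length e' / (lam ^ edge_length e' + lam ^ edge_length e)"

lemma flip_rate_bounds: "0 < lam \<Longrightarrow> 0 < flip_rate lam e e'" "0 < lam \<Longrightarrow> flip_rate lam e e' < 1"
  unfolding flip_rate_def by (simp_all add: add_pos_pos)

lemma flip_rate_reverse: "0 < lam \<Longrightarrow> flip_rate lam e' e = 1 - flip_rate lam e e'"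
proof -
  assume l: "0 < lam"
  hence "lam ^ edge_length e' + lam ^ edge_length e > 0" by (simp add: add_pos_pos)
  thus ?thesis unfolding flip_rate_def by (simp add: field_simps)
qed

abbreviation flip_weight :: "edge \<Rightarrow> edge \<Rightarrow> real" where
  "flip_weight e e' \<equiv> 16 ^ max (edge_length e) (edge_length e')"

text \<open>A flip that lengthens an edge by \<open>k\<close> has rate at most \<open>lam ^ k\<close>, which compensates the factor \<open>16 ^ k\<close>
in the distance.\<close>

lemma flip_rate_weight:
  assumes l: "0 < lam" "lam \<le> 1 / 16"
  shows "flip_rate lam e e' * flip_weight e e' \<le> 16 ^ edge_length e"
proof (cases "edge_length e' \<le> edge_length e")
  case True
  have "flip_rate lam e e' * 16 ^ edge_length e \<le> 1 * 16 ^ edge_length e"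
    using flip_rate_bounds(2)[OF l(1), of e e'] by (intro mult_right_mono) auto
  thus ?thesis using True by (simp add: max_def)
next
  case False
  then obtain k where k: "edge_length e' = edge_length e + k" using le_Suc_ex[of "edge_length e" "edge_length e'"] by auto
  let ?p = "lam ^ edge_length e"
  have p: "?p > 0" using l by simp
  have "flip_rate lam e e' \<le> lam ^ edge_length e' / ?p"
    unfolding flip_rate_def using l by (intro divide_left_mono) (auto simp: add_pos_pos)
  also have "\<dots> = lam ^ k" unfolding k power_add using l p by simp
  also have "\<dots> \<le> (1 / 16) ^ k" using l by (intro power_mono) auto
  finally have "flip_rate lam e e' * 16 ^ edge_length e' \<le> (1 / 16) ^ k * 16 ^ edge_length e'"
    by (intro mult_right_mono) auto
  also have "\<dots> = 16 ^ edge_length e" unfolding k power_add by (simp add: power_divide)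
  finally show ?thesis using False by (simp add: max_def)
qed

lemma update_expectation_flip:
  fixes F :: "edge set \<Rightarrow> real"
  assumes T: "T \<in> triangulations m n" and l: "0 < lam" and f: "flips_to T (edge_at T x) e'"
  shows "measure_pmf.expectation (update_at lam T x) F =
     flip_rate lam (edge_at T x) e' * F (flip_edge T (edge_at T x) e') + (1 - flip_rate lam (edge_at T x) e') * F T"
proof -
  have fl: "flippable T (edge_at T x)" using f unfolding flippable_def by blast
  have fe: "flipped T (edge_at T x) = e'" by (rule flipped_eq[OF T f])
  have b: "0 \<le> flip_rate lam (edge_at T x) e'" "flip_rate lam (edge_at T x) e' \<le> 1"
    using flip_rate_bounds[OF l, of "edge_at T x" e'] by auto
  have "update_at lam T x = map_pmf (\<lambda>b. if b then flip_edge T (edge_at T x) e' else T)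
     (bernoulli_pmf (flip_rate lam (edge_at T x) e'))"
    unfolding update_at_def Let_def fe flip_rate_def flip_edge_def using fl by simp
  thus ?thesis using b by (simp add: mult.commute)
qed

lemma finite_set_pmf_update: "finite (set_pmf (update_at lam T x))"
  unfolding update_at_def Let_def by auto

section \<open>Contraction\<close>

locale constrained_glauber =
  fixes m n :: nat and lam :: real and eta :: "real \<times> real \<Rightarrow> edge" and Delta :: "(real \<times> real) set"
  assumes con: "constraints m n eta Delta" and lam: "0 < lam" "lam \<le> 1 / 16"
begin

abbreviation Omega :: "edge set set" where "Omega \<equiv> compatible m n eta Delta"

abbreviation law :: "nat \<Rightarrow> edge set \<Rightarrow> edge set pmf" where
  "law t T \<equiv> glauber_law m n lam Delta t T"

abbreviation mu :: "edge set pmf" where "mu \<equiv> gibbs m n lam eta Delta"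

definition free :: "(real \<times> real) set" where "free = midpoints m n - Delta"

lemma finite_free: "finite free" unfolding free_def using finite_midpoints by simp

lemma Omega_iff: "T \<in> Omega \<longleftrightarrow> T \<in> triangulations m n \<and> eta ` Delta \<subseteq> T"
proof
  assume T: "T \<in> Omega"
  hence t: "T \<in> triangulations m n" unfolding compatible_def by simp
  have "eta x \<in> T" if x: "x \<in> Delta" for x
  proof -
    have "x \<in> midpoints m n" using con x unfolding constraints_def by blast
    hence "edge_at T x \<in> T" by (rule edge_at_in(1)[OF t])
    moreover have "edge_at T x = eta x" using T x unfolding compatible_def by simp
    ultimately show ?thesis by simp
  qed
  thus "T \<in> triangulations m n \<and> eta ` Delta \<subseteq> T" using t by blast
next
  assume T: "T \<in> triangulations m n \<and> eta ` Delta \<subseteq> T"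
  have "edge_at T x = eta x" if x: "x \<in> Delta" for x
  proof -
    have "edge_midpoint (eta x) = x" using con x unfolding constraints_def by blast
    moreover have "eta x \<in> T" using T x by blast
    ultimately show ?thesis using edge_at_eq[of T m n "eta x"] T by simp
  qed
  thus "T \<in> Omega" using T unfolding compatible_def by simp
qed

lemma Omega_triangulation: "T \<in> Omega \<Longrightarrow> T \<in> triangulations m n"
  using Omega_iff by simp

lemma finite_Omega: "finite Omega"
proof -
  have "Omega \<subseteq> Pow (edges m n)" using Omega_triangulation triangulation_edges by blast
  thus ?thesis using finite_edges by (meson finite_Pow_iff finite_subset)
qed

lemma Omega_nonempty: "Omega \<noteq> {}"
proof -
  let ?A = "{T. T \<subseteq> edges m n \<and> noncrossing T}"
  have P0: "eta ` Delta \<in> ?A" using con unfolding constraints_def by blast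
  have fin: "finite ?A" by (rule finite_subset[of _ "Pow (edges m n)"]) (auto simp: finite_edges)
  obtain T where T: "T \<in> ?A" "eta ` Delta \<subseteq> T" "\<forall>T'\<in>?A. T \<subseteq> T' \<longrightarrow> T = T'"
    using finite_has_maximal2[OF fin P0] by blast
  have "T \<in> triangulations m n" using T unfolding triangulations_def by blast
  thus ?thesis using T(2) Omega_iff by blast
qed

lemma flip_in_Omega:
  assumes T: "T \<in> Omega" and f: "flips_to T e e'" and x: "edge_midpoint e \<in> free"
  shows "flip_edge T e e' \<in> Omega"
proof -
  have "e \<notin> eta ` Delta"
  proof
    assume "e \<in> eta ` Delta"
    then obtain y where y: "y \<in> Delta" "e = eta y" by blast
    hence "edge_midpoint e = y" using con unfolding constraints_def by blast
    thus False using x y unfolding free_def by simp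
  qed
  hence "eta ` Delta \<subseteq> flip_edge T e e'" using T Omega_iff unfolding flip_edge_def by blast
  thus ?thesis using flips_to_flip_edge(1)[OF Omega_triangulation[OF T] f] Omega_iff by blast
qed

definition flip_lipschitz :: "(edge set \<Rightarrow> real) \<Rightarrow> real \<Rightarrow> bool" where
  "flip_lipschitz F K \<longleftrightarrow> 0 \<le> K \<and> (\<forall>T\<in>Omega. \<forall>e e'. flips_to T e e' \<longrightarrow> edge_midpoint e \<in> free \<longrightarrow>
     \<bar>F (flip_edge T e e') - F T\<bar> \<le> K * flip_weight e e')"

lemma flip_lipschitzD:
  assumes "flip_lipschitz F K" "T \<in> Omega" "flips_to T e e'" "edge_midpoint e \<in> free"
  shows "\<bar>F (flip_edge T e e') - F T\<bar> \<le> K * flip_weight e e'"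
  using assms unfolding flip_lipschitz_def by blast

lemma flip_lipschitz_step:
  assumes L: "flip_lipschitz F K" and T: "T \<in> Omega" and f: "flips_to T e e'" and x: "edge_midpoint e \<in> free"
  shows "\<bar>F (flip_edge T e e') - F T\<bar> \<le> K * 16 ^ (m + n)"
proof -
  note F = flips_to_flip_edge[OF Omega_triangulation[OF T] f]
  have "edge_length e \<le> m + n" "edge_length e' \<le> m + n"
    using edge_length_le F(7) triangulation_edges[OF Omega_triangulation[OF T] F(4)] by blast+
  hence "(16::real) ^ max (edge_length e) (edge_length e') \<le> 16 ^ (m + n)" by (intro power_increasing) auto
  moreover have "K \<ge> 0" using L unfolding flip_lipschitz_def by simp
  ultimately have "K * flip_weight e e' \<le> K * 16 ^ (m + n)" by (rule mult_left_mono)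
  thus ?thesis using flip_lipschitzD[OF L T f x] by linarith
qed

lemma difference_free:
  assumes S: "S \<in> Omega" and T: "T \<in> Omega" and e: "e \<in> S" "e \<notin> T"
  shows "edge_midpoint e \<in> free"
proof -
  note St = Omega_triangulation[OF S]
  have mp: "edge_midpoint e \<in> midpoints m n"
    using edge_midpoint_in_midpoints[OF triangulation_edges[OF St e(1)]] .
  have "edge_midpoint e \<notin> Delta"
  proof
    assume d: "edge_midpoint e \<in> Delta"
    hence "edge_at S (edge_midpoint e) = eta (edge_midpoint e)" using S unfolding compatible_def by simp
    hence "e = eta (edge_midpoint e)" using edge_at_eq[OF St e(1)] by simp
    moreover have "eta (edge_midpoint e) \<in> T" using T d Omega_iff by blast
    ultimately show False using e(2) by simp
  qed
  thus ?thesis using mp unfolding free_def by simp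
qed

text \<open>Follow the flip path given by \<open>longest_difference_flippable\<close>, flipping in whichever of the two
triangulations contains the longest edge of the symmetric difference. Constraint edges are common to
both, so the path stays in \<open>Omega\<close>.\<close>

lemma flip_lipschitz_global:
  assumes L: "flip_lipschitz F K"
  shows "S \<in> Omega \<Longrightarrow> T \<in> Omega \<Longrightarrow> \<bar>F S - F T\<bar> \<le> K * 16 ^ (m + n) * real (diff_length S T)"
proof (induction "diff_length S T" arbitrary: S T rule: less_induct)
  case less
  let ?B = "K * 16 ^ (m + n)"
  have B: "?B \<ge> 0" using L unfolding flip_lipschitz_def by simp
  note St = Omega_triangulation[OF less.prems(1)] and Tt = Omega_triangulation[OF less.prems(2)]
  let ?D = "(S - T) \<union> (T - S)"
  show ?case
  proof (cases "?D = {}")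
    case True
    hence "S = T" by blast
    thus ?thesis using B by simp
  next
    case False
    have fin: "finite ?D" using card_triangulation(1)[OF St] card_triangulation(1)[OF Tt] by simp
    have step: "\<bar>F A - F B'\<bar> \<le> ?B * real (diff_length A B')"
      if A: "A \<in> Omega" and B': "B' \<in> Omega" and e: "e \<in> A" "e \<notin> B'"
        and D: "(A - B') \<union> (B' - A) = ?D" and mx: "\<And>f. f \<in> ?D \<Longrightarrow> edge_length f \<le> edge_length e"
        and dl: "diff_length A B' = diff_length S T" for A B' e
    proof -
      note At = Omega_triangulation[OF A] and Bt = Omega_triangulation[OF B']
      have mx': "edge_length f \<le> edge_length e" if "f \<in> (A - B') \<union> (B' - A)" for f
        using mx that unfolding D by blast
      obtain e' where e': "flips_to A e e'" "e' \<in> B' \<or> edge_length e' < edge_length e"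
        using longest_difference_flippable[OF At Bt e mx'] by blast
      let ?A = "flip_edge A e e'"
      have fr: "edge_midpoint e \<in> free" using difference_free[OF A B' e] .
      have A': "?A \<in> Omega" using flip_in_Omega[OF A e'(1) fr] .
      have lt: "diff_length ?A B' < diff_length A B'" using diff_length_flip[OF At Bt e e'] .
      have "\<bar>F ?A - F B'\<bar> \<le> ?B * real (diff_length ?A B')"
        using less.hyps[of ?A B'] lt dl A' B' by simp
      moreover have "\<bar>F ?A - F A\<bar> \<le> ?B" using flip_lipschitz_step[OF L A e'(1) fr] .
      ultimately have "\<bar>F A - F B'\<bar> \<le> ?B * (real (diff_length ?A B') + 1)" by (simp add: algebra_simps)
      also have "\<dots> \<le> ?B * real (diff_length A B')" using lt B by (intro mult_left_mono) auto
      finally show ?thesis .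
    qed
    have "Max (edge_length ` ?D) \<in> edge_length ` ?D" using fin False by (intro Max_in) auto
    then obtain e where e: "Max (edge_length ` ?D) = edge_length e" "e \<in> ?D" by (rule imageE)
    have mx: "edge_length f \<le> edge_length e" if "f \<in> ?D" for f
      unfolding e(1)[symmetric] using fin that by (intro Max_ge) auto
    from e(2) consider "e \<in> S" "e \<notin> T" | "e \<in> T" "e \<notin> S" by blast
    thus ?thesis
    proof cases
      case 1
      thus ?thesis using step[OF less.prems 1 refl mx refl] by simp
    next
      case 2
      have "\<bar>F T - F S\<bar> \<le> ?B * real (diff_length T S)"
        by (rule step[OF less.prems(2,1) 2 _ mx diff_length_sym]) (simp_all add: Un_commute)
      thus ?thesis using diff_length_sym[of S T] by (simp add: abs_minus_commute)
    qed
  qed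
qed

definition upd :: "edge set \<Rightarrow> real \<times> real \<Rightarrow> (edge set \<Rightarrow> real) \<Rightarrow> real" where
  "upd T x F = measure_pmf.expectation (update_at lam T x) F"

lemma upd_flip:
  "T \<in> Omega \<Longrightarrow> flips_to T (edge_at T x) e' \<Longrightarrow> upd T x F =
     flip_rate lam (edge_at T x) e' * F (flip_edge T (edge_at T x) e') + (1 - flip_rate lam (edge_at T x) e') * F T"
  unfolding upd_def by (rule update_expectation_flip[OF Omega_triangulation lam(1)])

lemma upd_stay: "\<not> flippable T (edge_at T x) \<Longrightarrow> upd T x F = F T"
  unfolding upd_def update_at_def Let_def by simp

lemma upd_move:
  assumes L: "flip_lipschitz F K" and T: "T \<in> Omega" and x: "x \<in> free"
  shows "\<bar>upd T x F - F T\<bar> \<le> K * 16 ^ edge_length (edge_at T x)"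
proof (cases "flippable T (edge_at T x)")
  case False
  thus ?thesis using L upd_stay[OF False, of F] unfolding flip_lipschitz_def by simp
next
  case True
  let ?e = "edge_at T x"
  obtain e' where f: "flips_to T ?e e'" using True unfolding flippable_def by blast
  let ?p = "flip_rate lam ?e e'"
  have xm: "x \<in> midpoints m n" using x unfolding free_def by simp
  have fr: "edge_midpoint ?e \<in> free" using edge_at_in(2)[OF Omega_triangulation[OF T] xm] x by simp
  have "upd T x F - F T = ?p * (F (flip_edge T ?e e') - F T)"
    unfolding upd_flip[OF T f] by (simp add: algebra_simps)
  hence "\<bar>upd T x F - F T\<bar> = ?p * \<bar>F (flip_edge T ?e e') - F T\<bar>"
    using flip_rate_bounds(1)[OF lam(1), of ?e e'] by (simp add: abs_mult)
  also have "\<dots> \<le> ?p * (K * flip_weight ?e e')"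
    using flip_lipschitzD[OF L T f fr] flip_rate_bounds(1)[OF lam(1), of ?e e'] by (intro mult_left_mono) auto
  also have "\<dots> = K * (?p * flip_weight ?e e')" by simp
  also have "\<dots> \<le> K * 16 ^ edge_length ?e"
    using flip_rate_weight[OF lam, of ?e e'] L unfolding flip_lipschitz_def by (intro mult_left_mono) auto
  finally show ?thesis .
qed

text \<open>The heat-bath rule forgets which of the two diagonals was present.\<close>

lemma upd_contract_same:
  assumes S: "S \<in> Omega" and f: "flips_to S e e'" and fr: "edge_midpoint e \<in> free"
  shows "upd (flip_edge S e e') (edge_midpoint e) F = upd S (edge_midpoint e) F"
proof -
  let ?T = "flip_edge S e e'"
  note St = Omega_triangulation[OF S]
  note R = flips_to_flip_edge[OF St f]
  have T: "?T \<in> Omega" using flip_in_Omega[OF S f fr] .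
  have e1: "edge_at S (edge_midpoint e) = e" using edge_at_eq[OF St R(4)] .
  have "e' \<in> ?T" unfolding flip_edge_def by simp
  hence e2: "edge_at ?T (edge_midpoint e) = e'" using edge_at_eq[OF R(1)] R(6) by metis
  have "upd S (edge_midpoint e) F = flip_rate lam e e' * F ?T + (1 - flip_rate lam e e') * F S"
    using upd_flip[OF S, of "edge_midpoint e" e' F] f unfolding e1 by simp
  moreover have "upd ?T (edge_midpoint e) F = flip_rate lam e' e * F S + (1 - flip_rate lam e' e) * F ?T"
    using upd_flip[OF T, of "edge_midpoint e" e F] R(2) unfolding e2 R(3) by simp
  ultimately show ?thesis using flip_rate_reverse[OF lam(1), of e' e] by simp
qed

text \<open>The edge at \<open>x\<close> has the same flip with the same rate before and after the flip of \<open>{a, b}\<close>, and both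
flips commute. So the difference is an average of two differences across the flip of \<open>{a, b}\<close>.\<close>

lemma upd_contract_far:
  assumes L: "flip_lipschitz F K" and S: "S \<in> Omega" and q: "flip_quad S a b c d"
    and fr: "edge_midpoint {a, b} \<in> free" and x: "x \<in> free"
    and e: "edge_at S x \<notin> quad_sides a b c d" "edge_at S x \<noteq> {a, b}"
  shows "\<bar>upd (flip_edge S {a, b} {c, d}) x F - upd S x F\<bar>
    \<le> K * flip_weight {a, b} {c, d}"
proof -
  let ?T = "flip_edge S {a, b} {c, d}" and ?e = "edge_at S x"
  let ?W = "K * flip_weight {a, b} {c, d}"
  note St = Omega_triangulation[OF S]
  have f0: "flips_to S {a, b} {c, d}" using flips_toI[OF St q] .
  note R = flips_to_flip_edge[OF St f0]
  have T: "?T \<in> Omega" using flip_in_Omega[OF S f0 fr] .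
  have xm: "x \<in> midpoints m n" using x unfolding free_def by simp
  note ein = edge_at_in[OF St xm]
  have eT: "?e \<in> ?T" using ein(1) e(2) unfolding flip_edge_def by simp
  have eTx: "edge_at ?T x = ?e" using edge_at_eq[OF R(1) eT] ein(2) by simp
  have iff: "flips_to ?T ?e g \<longleftrightarrow> flips_to S ?e g" for g
  proof
    assume "flips_to S ?e g"
    thus "flips_to ?T ?e g" by (rule flips_to_local[OF St q e])
  next
    assume g: "flips_to ?T ?e g"
    have "?e \<noteq> {c, d}" using ein(1) R(5) by auto
    moreover have "?e \<notin> quad_sides c d b a" using e(1) quad_sides_flip by simp
    ultimately have "flips_to (flip_edge ?T {c, d} {b, a}) ?e g"
      using flips_to_local[OF R(1) flip_quad_triangulation(2)[OF St q] _ _ g] by blast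
    moreover have "{b, a} = {a, b}" by (rule insert_commute)
    ultimately show "flips_to S ?e g" using R(3) by simp
  qed
  have d0: "\<bar>F ?T - F S\<bar> \<le> ?W" using flip_lipschitzD[OF L S f0 fr] .
  show ?thesis
  proof (cases "flippable S ?e")
    case False
    have "\<not> flippable ?T (edge_at ?T x)" using False iff unfolding eTx flippable_def by simp
    thus ?thesis using upd_stay[OF False, of F] upd_stay[of ?T x F] d0 by simp
  next
    case True
    obtain g where g: "flips_to S ?e g" using True unfolding flippable_def by blast
    have gT: "flips_to ?T (edge_at ?T x) g" using iff g unfolding eTx by simp
    let ?p = "flip_rate lam ?e g"
    let ?S' = "flip_edge S ?e g" and ?T' = "flip_edge ?T ?e g"
    have fre: "edge_midpoint ?e \<in> free" using ein(2) x by simp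
    have S': "?S' \<in> Omega" using flip_in_Omega[OF S g fre] .
    have q': "flip_quad ?S' a b c d" using flip_quad_persists[OF St q e] .
    have "flips_to ?S' {a, b} {c, d}" using flips_toI[OF Omega_triangulation[OF S'] q'] .
    from flip_lipschitzD[OF L S' this fr]
    have d1: "\<bar>F (flip_edge ?S' {a, b} {c, d}) - F ?S'\<bar> \<le> ?W" .
    have "g \<noteq> {a, b}" using flips_to_flip_edge(5)[OF St g] R(4) by auto
    moreover have "?e \<noteq> {c, d}" using ein(1) R(5) by auto
    ultimately have eq: "flip_edge ?S' {a, b} {c, d} = ?T'" using e(2) unfolding flip_edge_def by auto
    have p: "0 \<le> ?p" "0 \<le> 1 - ?p" using flip_rate_bounds[OF lam(1), of ?e g] by auto
    have "upd ?T x F - upd S x F = ?p * (F ?T' - F ?S') + (1 - ?p) * (F ?T - F S)"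
      unfolding upd_flip[OF S g] upd_flip[OF T gT] unfolding eTx by (simp add: algebra_simps)
    hence "\<bar>upd ?T x F - upd S x F\<bar> \<le> \<bar>?p * (F ?T' - F ?S')\<bar> + \<bar>(1 - ?p) * (F ?T - F S)\<bar>"
      using abs_triangle_ineq by metis
    also have "\<dots> = ?p * \<bar>F ?T' - F ?S'\<bar> + (1 - ?p) * \<bar>F ?T - F S\<bar>"
      using p by (simp add: abs_mult)
    also have "\<dots> \<le> ?p * ?W + (1 - ?p) * ?W"
      using d0 d1 p unfolding eq by (intro add_mono mult_left_mono) auto
    also have "\<dots> = ?W" by (simp add: algebra_simps)
    finally show ?thesis .
  qed
qed

text \<open>By \<open>upd_move\<close> each of the two updates adds at most a sixteenth of the distance, because a side is shorter than the longer diagonal.\<close>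

lemma upd_contract_side:
  assumes L: "flip_lipschitz F K" and S: "S \<in> Omega" and q: "flip_quad S a b c d"
    and fr: "edge_midpoint {a, b} \<in> free" and x: "x \<in> free"
    and e: "edge_at S x \<in> quad_sides a b c d"
  shows "\<bar>upd (flip_edge S {a, b} {c, d}) x F - upd S x F\<bar>
    \<le> 9 / 8 * (K * flip_weight {a, b} {c, d})"
proof -
  let ?T = "flip_edge S {a, b} {c, d}" and ?e = "edge_at S x"
  let ?M = "max (edge_length {a, b}) (edge_length {c, d})"
  note St = Omega_triangulation[OF S]
  have f0: "flips_to S {a, b} {c, d}" using flips_toI[OF St q] .
  note R = flips_to_flip_edge[OF St f0]
  note s = flip_quad_sides[OF q]
  have T: "?T \<in> Omega" using flip_in_Omega[OF S f0 fr] .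
  have K: "K \<ge> 0" using L unfolding flip_lipschitz_def by simp
  have xm: "x \<in> midpoints m n" using x unfolding free_def by simp
  note ein = edge_at_in[OF St xm]
  have "?e \<noteq> {a, b}" using e s unfolding quad_sides_def by (auto simp: doubleton_eq_iff)
  hence eT: "?e \<in> ?T" using ein(1) unfolding flip_edge_def by simp
  have eTx: "edge_at ?T x = ?e" using edge_at_eq[OF R(1) eT] ein(2) by simp
  have "edge_length ?e = edge_length {a, c} \<or> edge_length ?e = edge_length {a, d}"
    using e flip_quad_lengths(2,3)[OF q] unfolding quad_sides_def by auto
  moreover have "edge_length {a, c} > 0" "edge_length {a, d} > 0" using edge_length_pos s by blast+
  ultimately have "edge_length ?e + 1 \<le> ?M" using flip_quad_lengths(1)[OF q] by auto
  hence "(16::real) ^ (edge_length ?e + 1) \<le> 16 ^ ?M" by (intro power_increasing) auto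
  hence "(16::real) ^ edge_length ?e \<le> 16 ^ ?M / 16" by simp
  hence "K * 16 ^ edge_length ?e \<le> K * (16 ^ ?M / 16)" using K by (rule mult_left_mono)
  moreover have "\<bar>upd S x F - F S\<bar> \<le> K * 16 ^ edge_length ?e" using upd_move[OF L S x] .
  moreover have "\<bar>upd ?T x F - F ?T\<bar> \<le> K * 16 ^ edge_length ?e" using upd_move[OF L T x] unfolding eTx .
  moreover have "\<bar>F ?T - F S\<bar> \<le> K * 16 ^ ?M" using flip_lipschitzD[OF L S f0 fr] .
  moreover have "\<bar>upd ?T x F - upd S x F\<bar>
      \<le> \<bar>upd ?T x F - F ?T\<bar> + \<bar>F ?T - F S\<bar> + \<bar>upd S x F - F S\<bar>" by linarith
  moreover have "K * (16 ^ ?M / 16) = (K * 16 ^ ?M) / 16" by simp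
  ultimately show ?thesis by linarith
qed

definition step_exp :: "(edge set \<Rightarrow> real) \<Rightarrow> edge set \<Rightarrow> real" where
  "step_exp F T = measure_pmf.expectation (glauber_step m n lam Delta T) F"

lemma finite_set_pmf_step: "finite (set_pmf (glauber_step m n lam Delta T))"
proof (cases "free = {}")
  case True
  thus ?thesis unfolding glauber_step_def free_def by simp
next
  case False
  thus ?thesis using finite_free finite_set_pmf_update unfolding glauber_step_def free_def by auto
qed

lemma step_exp_eq:
  assumes "free \<noteq> {}"
  shows "step_exp F T = (\<Sum>x\<in>free. upd T x F) / real (card free)"
proof -
  have "step_exp F T = measure_pmf.expectation (pmf_of_set free \<bind> update_at lam T) F"
    using assms unfolding step_exp_def glauber_step_def free_def by simp
  also have "\<dots> = (\<Sum>x\<in>free. upd T x F /\<^sub>R real (card free))"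
    unfolding upd_def by (rule pmf_expectation_bind_pmf_of_set[OF assms finite_free finite_set_pmf_update])
  also have "\<dots> = (\<Sum>x\<in>free. upd T x F) / real (card free)"
    by (simp add: divide_inverse mult.commute sum_distrib_left)
  finally show ?thesis .
qed

text \<open>The flipped midpoint contributes \<open>0\<close>, each of the others at most the distance \<open>W\<close>, and at most four
sides an extra \<open>W / 8\<close>. The sum is at most \<open>(N - 1) * W + W / 2\<close>.\<close>

lemma step_exp_contract:
  assumes L: "flip_lipschitz F K"
  shows "flip_lipschitz (step_exp F) ((1 - 1 / (2 * real (card free))) * K)"
proof -
  have K: "K \<ge> 0" using L unfolding flip_lipschitz_def by simp
  have r0: "0 \<le> 1 - 1 / (2 * real (card free))"
    by (cases "card free = 0") (auto simp: field_simps)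
  have "\<bar>step_exp F (flip_edge S e e') - step_exp F S\<bar>
      \<le> (1 - 1 / (2 * real (card free))) * K * flip_weight e e'"
    if S: "S \<in> Omega" and f: "flips_to S e e'" and fr: "edge_midpoint e \<in> free" for S e e'
  proof -
    note St = Omega_triangulation[OF S]
    obtain a b c d where ab: "e = {a, b}" "e' = {c, d}" and q: "flip_quad S a b c d" by (rule flips_toE[OF St f])
    let ?T = "flip_edge S e e'" and ?W = "K * flip_weight e e'"
    let ?Q = "quad_sides a b c d" and ?x = "edge_midpoint e"
    let ?N = "real (card free)"
    have ne: "free \<noteq> {}" using fr by blast
    have N: "?N > 0" using ne finite_free by (simp add: card_gt_0_iff)
    have W: "?W \<ge> 0" using K by simp
    define g where "g x = (if x = ?x then 0 else ?W) + (if edge_at S x \<in> ?Q then ?W / 8 else 0)" for x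
    have bound: "\<bar>upd ?T x F - upd S x F\<bar> \<le> g x" if x: "x \<in> free" for x
    proof (cases "x = ?x")
      case True
      thus ?thesis using upd_contract_same[OF S f fr, of F] W unfolding g_def by simp
    next
      case False
      have xm: "x \<in> midpoints m n" using x unfolding free_def by simp
      have nab: "edge_at S x \<noteq> {a, b}" using edge_at_in(2)[OF St xm] False unfolding ab by auto
      show ?thesis
      proof (cases "edge_at S x \<in> ?Q")
        case True
        have "\<bar>upd ?T x F - upd S x F\<bar> \<le> 9 / 8 * ?W"
          using upd_contract_side[OF L S q _ x True] fr unfolding ab by blast
        thus ?thesis using False True unfolding g_def by simp
      next
        case nQ: False
        have "\<bar>upd ?T x F - upd S x F\<bar> \<le> ?W"
          using upd_contract_far[OF L S q _ x nQ nab] fr unfolding ab by blast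
        thus ?thesis using False nQ unfolding g_def by simp
      qed
    qed
    have "step_exp F ?T - step_exp F S = (\<Sum>x\<in>free. upd ?T x F - upd S x F) / ?N"
      unfolding step_exp_eq[OF ne] by (simp add: sum_subtractf diff_divide_distrib)
    hence "\<bar>step_exp F ?T - step_exp F S\<bar> = \<bar>\<Sum>x\<in>free. upd ?T x F - upd S x F\<bar> / ?N"
      using N by simp
    also have "\<dots> \<le> (\<Sum>x\<in>free. g x) / ?N"
    proof (rule divide_right_mono)
      have "\<bar>\<Sum>x\<in>free. upd ?T x F - upd S x F\<bar> \<le> (\<Sum>x\<in>free. \<bar>upd ?T x F - upd S x F\<bar>)" by (rule sum_abs)
      also have "\<dots> \<le> (\<Sum>x\<in>free. g x)" by (rule sum_mono) (rule bound)
      finally show "\<bar>\<Sum>x\<in>free. upd ?T x F - upd S x F\<bar> \<le> (\<Sum>x\<in>free. g x)" .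
    qed (use N in simp)
    also have "(\<Sum>x\<in>free. g x) \<le> (?N - 1 / 2) * ?W"
    proof -
      have "(\<Sum>x\<in>free. g x) = (\<Sum>x\<in>free. if x = ?x then 0 else ?W) + (\<Sum>x\<in>free. if edge_at S x \<in> ?Q then ?W / 8 else 0)"
        unfolding g_def by (rule sum.distrib)
      moreover have "(\<Sum>x\<in>free. if x = ?x then 0 else ?W) = (?N - 1) * ?W"
      proof -
        have "(\<Sum>x\<in>free. if x = ?x then 0 else ?W) = (\<Sum>x\<in>free - {?x}. ?W)"
          by (subst sum.remove[OF finite_free fr]) (simp add: sum.cong)
        also have "\<dots> = real (card (free - {?x})) * ?W" by simp
        also have "real (card (free - {?x})) = ?N - 1"
          using fr finite_free N by (simp add: of_nat_diff Suc_leI)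
        finally show ?thesis .
      qed
      moreover have "(\<Sum>x\<in>free. if edge_at S x \<in> ?Q then ?W / 8 else 0) \<le> 4 * (?W / 8)"
      proof -
        let ?A = "{x \<in> free. edge_at S x \<in> ?Q}"
        have "(\<Sum>x\<in>free. if edge_at S x \<in> ?Q then ?W / 8 else 0) = real (card ?A) * (?W / 8)"
          using finite_free by (simp add: sum.If_cases Int_def)
        moreover have "card ?A \<le> 4"
        proof -
          have "inj_on (edge_at S) ?A"
            unfolding inj_on_def free_def using edge_at_in(2)[OF St] by (metis (no_types, lifting) DiffD1 mem_Collect_eq)
          moreover have "edge_at S ` ?A \<subseteq> ?Q" by blast
          moreover have "finite ?Q" unfolding quad_sides_def by simp
          ultimately have "card ?A \<le> card ?Q" by (rule card_inj_on_le)
          thus ?thesis using card_quad_sides[of a b c d] by linarith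
        qed
        moreover have "real (card ?A) * (?W / 8) \<le> 4 * (?W / 8)"
          using W \<open>card ?A \<le> 4\<close> by (intro mult_right_mono) auto
        ultimately show ?thesis by linarith
      qed
      ultimately show ?thesis by (simp add: algebra_simps)
    qed
    hence "(\<Sum>x\<in>free. g x) / ?N \<le> (?N - 1 / 2) * ?W / ?N" using N by (intro divide_right_mono) auto
    also have "\<dots> = (1 - 1 / (2 * ?N)) * ?W" using N by (simp add: field_simps)
    finally show ?thesis by (simp add: mult.assoc)
  qed
  thus ?thesis unfolding flip_lipschitz_def using K r0 by auto
qed

section \<open>Stationarity and mixing\<close>

lemma flip_lipschitz_iterate:
  "flip_lipschitz F K \<Longrightarrow> flip_lipschitz ((step_exp ^^ t) F) ((1 - 1 / (2 * real (card free))) ^ t * K)"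
proof (induction t)
  case (Suc t)
  show ?case using step_exp_contract[OF Suc.IH[OF Suc.prems]] by (simp add: mult.assoc)
qed simp

lemma finite_set_pmf_law: "finite (set_pmf (law t T))"
proof (induction t)
  case (Suc t)
  thus ?case using finite_set_pmf_step unfolding glauber_law_def by simp
qed (simp add: glauber_law_def)

lemma law_expectation:
  fixes F :: "edge set \<Rightarrow> real"
  shows "measure_pmf.expectation (law t T) F = (step_exp ^^ t) F T"
proof (induction t arbitrary: F)
  case 0
  thus ?case by (simp add: glauber_law_def)
next
  case (Suc t)
  let ?p = "law t T"
  have "law (Suc t) T = ?p \<bind> glauber_step m n lam Delta"
    unfolding glauber_law_def by simp
  hence "measure_pmf.expectation (law (Suc t) T) F
      = (\<Sum>S\<in>set_pmf ?p. pmf ?p S *\<^sub>R step_exp F S)"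
    unfolding step_exp_def
    using pmf_expectation_bind[OF finite_set_pmf_law[of t T] finite_set_pmf_step subset_refl, where h = F] by simp
  also have "\<dots> = measure_pmf.expectation ?p (step_exp F)"
    by (rule integral_measure_pmf[symmetric]) (auto simp: finite_set_pmf_law)
  also have "\<dots> = (step_exp ^^ Suc t) F T" unfolding Suc.IH by (simp only: funpow_Suc_right o_apply)
  finally show ?case .
qed

definition weight :: "edge set \<Rightarrow> real" where
  "weight T = lam ^ total_length m n T"

lemma weight_pos: "weight T > 0" unfolding weight_def using lam by simp

lemma detailed_balance:
  assumes T: "T \<in> Omega" and f: "flips_to T e e'"
  shows "weight (flip_edge T e e') * flip_rate lam e' e = weight T * flip_rate lam e e'"
proof -
  have "total_length m n (flip_edge T e e') + edge_length e = total_length m n T + edge_length e'"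
    by (rule total_length_flip[OF Omega_triangulation[OF T] f])
  hence "weight (flip_edge T e e') * lam ^ edge_length e = weight T * lam ^ edge_length e'"
    unfolding weight_def by (metis power_add)
  thus ?thesis unfolding flip_rate_def by (simp add: add.commute)
qed

text \<open>Flipping at \<open>x\<close> is an involution on the triangulations whose edge at \<open>x\<close> is flippable, and detailed
balance makes the flows in both directions cancel.\<close>

lemma upd_stationary:
  assumes x: "x \<in> free"
  shows "(\<Sum>T\<in>Omega. weight T * upd T x F) = (\<Sum>T\<in>Omega. weight T * F T)"
proof -
  have xm: "x \<in> midpoints m n" using x unfolding free_def by simp
  define A where "A = {T \<in> Omega. flippable T (edge_at T x)}"
  define g where "g T = flip_edge T (edge_at T x) (flipped T (edge_at T x))" for T
  define r where "r T = flip_rate lam (edge_at T x) (flipped T (edge_at T x))" for T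
  have finA: "finite A" unfolding A_def using finite_Omega by simp
  have fl: "flips_to T (edge_at T x) (flipped T (edge_at T x))" if "T \<in> A" for T
  proof -
    obtain e' where e': "flips_to T (edge_at T x) e'" using \<open>T \<in> A\<close> unfolding A_def flippable_def by blast
    have "T \<in> triangulations m n" using \<open>T \<in> A\<close> Omega_triangulation unfolding A_def by blast
    from flipped_eq[OF this e'] show ?thesis using e' by simp
  qed
  have main: "g T \<in> A \<and> g (g T) = T \<and> weight (g T) * r (g T) = weight T * r T" if T: "T \<in> A" for T
  proof -
    let ?e = "edge_at T x" and ?e' = "flipped T (edge_at T x)"
    have TO: "T \<in> Omega" using T unfolding A_def by simp
    note Tt = Omega_triangulation[OF TO]
    note R = flips_to_flip_edge[OF Tt fl[OF T]]
    have mid: "edge_midpoint ?e = x" using edge_at_in(2)[OF Tt xm] .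
    have gO: "g T \<in> Omega" unfolding g_def using flip_in_Omega[OF TO fl[OF T]] mid x by simp
    have "?e' \<in> g T" unfolding g_def flip_edge_def by simp
    hence eg: "edge_at (g T) x = ?e'" using edge_at_eq[OF Omega_triangulation[OF gO]] R(6) mid by metis
    have fb: "flips_to (g T) (edge_at (g T) x) ?e" unfolding eg using R(2) unfolding g_def .
    hence gA: "g T \<in> A" using gO unfolding A_def flippable_def by blast
    have fe: "flipped (g T) (edge_at (g T) x) = ?e" by (rule flipped_eq[OF Omega_triangulation[OF gO] fb])
    have "g (g T) = flip_edge (g T) ?e' ?e" using fe eg unfolding g_def[of "g T"] by simp
    also have "\<dots> = T" using R(3) unfolding g_def .
    finally have gg: "g (g T) = T" .
    have "r (g T) = flip_rate lam ?e' ?e" unfolding r_def[of "g T"] eg fe[unfolded eg] ..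
    hence "weight (g T) * r (g T) = weight T * r T"
      using detailed_balance[OF TO fl[OF T]] unfolding g_def r_def[of T] by simp
    thus ?thesis using gA gg by blast
  qed
  have bij: "bij_betw g A A" by (rule bij_betw_byWitness[where f' = g]) (use main in auto)
  have upd: "weight T * upd T x F = weight T * F T + (if T \<in> A then weight T * r T * F (g T) - weight T * r T * F T else 0)"
    if T: "T \<in> Omega" for T
  proof (cases "T \<in> A")
    case True
    have "upd T x F = r T * F (g T) + (1 - r T) * F T"
      using upd_flip[OF T fl[OF True], of F] unfolding g_def r_def .
    thus ?thesis using True by (simp only: if_True) (simp add: algebra_simps)
  next
    case False
    hence "\<not> flippable T (edge_at T x)" using T unfolding A_def by blast
    thus ?thesis using upd_stay[of T x F] False by simp
  qed
  have "(\<Sum>T\<in>Omega. weight T * upd T x F) = (\<Sum>T\<in>Omega. weight T * F T + (if T \<in> A then weight T * r T * F (g T) - weight T * r T * F T else 0))"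
    by (rule sum.cong) (simp_all add: upd)
  also have "\<dots> = (\<Sum>T\<in>Omega. weight T * F T) + (\<Sum>T\<in>Omega. if T \<in> A then weight T * r T * F (g T) - weight T * r T * F T else 0)"
    by (rule sum.distrib)
  also have "(\<Sum>T\<in>Omega. if T \<in> A then weight T * r T * F (g T) - weight T * r T * F T else 0)
     = (\<Sum>T\<in>Omega \<inter> A. weight T * r T * F (g T) - weight T * r T * F T)"
    by (rule sum.inter_restrict[OF finite_Omega, symmetric])
  also have "Omega \<inter> A = A" unfolding A_def by blast
  also have "(\<Sum>T\<in>A. weight T * r T * F (g T) - weight T * r T * F T)
     = (\<Sum>T\<in>A. weight T * r T * F (g T)) - (\<Sum>T\<in>A. weight T * r T * F T)" by (rule sum_subtractf)
  also have "(\<Sum>T\<in>A. weight T * r T * F (g T)) = (\<Sum>T\<in>A. weight (g T) * r (g T) * F (g T))"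
    by (rule sum.cong) (use main in auto)
  also have "\<dots> = (\<Sum>T\<in>A. weight T * r T * F T)"
    by (rule sum.reindex_bij_betw[OF bij, of "\<lambda>T. weight T * r T * F T"])
  finally show ?thesis by simp
qed

lemma step_stationary: "(\<Sum>T\<in>Omega. weight T * step_exp F T) = (\<Sum>T\<in>Omega. weight T * F T)"
proof (cases "free = {}")
  case True
  have "step_exp F T = F T" for T
    using True unfolding step_exp_def glauber_step_def free_def by simp
  thus ?thesis by simp
next
  case False
  have N: "real (card free) > 0" using False finite_free by (simp add: card_gt_0_iff)
  have "(\<Sum>T\<in>Omega. weight T * step_exp F T) = (\<Sum>T\<in>Omega. \<Sum>x\<in>free. weight T * upd T x F) / real (card free)"
    unfolding step_exp_eq[OF False] by (simp add: sum_divide_distrib sum_distrib_left)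
  also have "(\<Sum>T\<in>Omega. \<Sum>x\<in>free. weight T * upd T x F) = (\<Sum>x\<in>free. \<Sum>T\<in>Omega. weight T * upd T x F)"
    by (rule sum.swap)
  also have "\<dots> = (\<Sum>x\<in>free. \<Sum>T\<in>Omega. weight T * F T)"
    by (rule sum.cong) (simp_all add: upd_stationary)
  finally show ?thesis using N by simp
qed

lemma iterate_stationary: "(\<Sum>T\<in>Omega. weight T * (step_exp ^^ t) F T) = (\<Sum>T\<in>Omega. weight T * F T)"
  by (induction t) (simp_all add: step_stationary)

definition Z :: real where "Z = (\<Sum>T\<in>Omega. weight T)"

lemma Z_pos: "Z > 0"
  unfolding Z_def using finite_Omega Omega_nonempty weight_pos by (rule sum_pos)

lemma pmf_gibbs: "pmf (mu) T = (if T \<in> Omega then weight T / Z else 0)"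
proof -
  let ?f = "\<lambda>T. if T \<in> Omega then weight T / Z else 0"
  have nn: "0 \<le> ?f T" for T using weight_pos[of T] Z_pos by simp
  have "(\<integral>\<^sup>+ T. ennreal (?f T) \<partial>count_space UNIV) = (\<Sum>T\<in>Omega. ennreal (?f T))"
    by (rule nn_integral_count_space'[OF finite_Omega]) auto
  also have "\<dots> = ennreal (\<Sum>T\<in>Omega. ?f T)" by (rule sum_ennreal) (rule nn)
  also have "(\<Sum>T\<in>Omega. ?f T) = 1"
  proof -
    have "(\<Sum>T\<in>Omega. ?f T) = (\<Sum>T\<in>Omega. weight T) / Z" by (simp add: sum_divide_distrib)
    thus ?thesis using Z_pos unfolding Z_def by simp
  qed
  finally have one: "(\<integral>\<^sup>+ T. ennreal (?f T) \<partial>count_space UNIV) = 1" by simp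
  have "mu = embed_pmf ?f"
    unfolding gibbs_def partition_function_def Z_def weight_def ..
  thus ?thesis using pmf_embed_pmf[OF nn one] by simp
qed

lemma gibbs_expectation:
  fixes F :: "edge set \<Rightarrow> real"
  shows "measure_pmf.expectation (mu) F = (\<Sum>T\<in>Omega. weight T * F T) / Z"
proof -
  have "measure_pmf.expectation (mu) F = (\<Sum>T\<in>Omega. pmf (mu) T *\<^sub>R F T)"
    by (rule integral_measure_pmf[OF finite_Omega]) (auto simp: set_pmf_eq pmf_gibbs split: if_splits)
  also have "\<dots> = (\<Sum>T\<in>Omega. weight T * F T / Z)" by (rule sum.cong) (simp_all add: pmf_gibbs)
  finally show ?thesis by (simp add: sum_divide_distrib)
qed

lemma prob_eq_expectation: "measure_pmf.prob p A = measure_pmf.expectation p (indicator A :: _ \<Rightarrow> real)"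
  by simp

text \<open>Without free midpoints there are no flips, and the constant \<open>0\<close> expresses that all triangulations in
\<open>Omega\<close> coincide.\<close>

lemma indicator_flip_lipschitz: "flip_lipschitz (indicator A) (if free = {} then 0 else 1)"
proof -
  have "\<bar>indicator A S - indicator A T\<bar> \<le> (1::real) * 16 ^ k" for S T :: "edge set" and k :: nat
  proof -
    have "\<bar>indicator A S - indicator A T\<bar> \<le> (1::real)" by (simp add: indicator_def)
    also have "\<dots> \<le> 16 ^ k" by (rule one_le_power) simp
    finally show ?thesis by simp
  qed
  thus ?thesis unfolding flip_lipschitz_def by auto
qed

text \<open>By stationarity the Gibbs probability of \<open>A\<close> is the average, over starting points, of the probability
of being in \<open>A\<close> after \<open>t\<close> steps. Its distance to the latter probability for one starting point is at
most the oscillation over all starting points. The hypothesis \<open>small\<close> is restricted to a nonempty set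
of free midpoints, because otherwise \<open>Omega\<close> is a single triangulation.\<close>

lemma total_variation_bound:
  assumes T: "T \<in> Omega"
    and small: "free \<noteq> {} \<Longrightarrow> (1 - 1 / (2 * real (card free))) ^ t * 16 ^ (m + n)
        * real (2 * card (midpoints m n) * (m + n)) \<le> 1 / 4"
  shows "total_variation (law t T) (mu) \<le> 1 / 4"
  unfolding total_variation_def
proof (rule cSUP_least)
  fix A :: "edge set set"
  let ?F = "(step_exp ^^ t) (indicator A)"
  let ?K = "(1 - 1 / (2 * real (card free))) ^ t * (if free = {} then 0 else 1)"
  have L: "flip_lipschitz ?F ?K" by (rule flip_lipschitz_iterate[OF indicator_flip_lipschitz])
  have osc: "\<bar>?F T - ?F S\<bar> \<le> 1 / 4" if S: "S \<in> Omega" for S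
  proof -
    have K0: "?K \<ge> 0" using L unfolding flip_lipschitz_def by simp
    have "\<bar>?F T - ?F S\<bar> \<le> ?K * 16 ^ (m + n) * real (diff_length T S)"
      by (rule flip_lipschitz_global[OF L T S])
    also have "\<dots> \<le> ?K * 16 ^ (m + n) * real (2 * card (midpoints m n) * (m + n))"
      using diff_length_le[OF Omega_triangulation[OF T] Omega_triangulation[OF S]] K0
      by (intro mult_left_mono) (auto simp del: of_nat_mult)
    also have "\<dots> \<le> 1 / 4" using small by (cases "free = {}") auto
    finally show ?thesis .
  qed
  have "measure_pmf.prob (law t T) A = ?F T"
    unfolding prob_eq_expectation law_expectation ..
  moreover have "measure_pmf.prob (mu) A = (\<Sum>S\<in>Omega. weight S * ?F S) / Z"
    unfolding prob_eq_expectation gibbs_expectation iterate_stationary ..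
  moreover have "?F T = (\<Sum>S\<in>Omega. weight S * ?F T) / Z"
    using Z_pos unfolding sum_distrib_right[symmetric] Z_def[symmetric] by simp
  ultimately have "measure_pmf.prob (law t T) A - measure_pmf.prob (mu) A
     = ((\<Sum>S\<in>Omega. weight S * ?F T) - (\<Sum>S\<in>Omega. weight S * ?F S)) / Z"
    unfolding diff_divide_distrib by linarith
  hence "\<bar>measure_pmf.prob (law t T) A - measure_pmf.prob (mu) A\<bar>
     = \<bar>(\<Sum>S\<in>Omega. weight S * ?F T) - (\<Sum>S\<in>Omega. weight S * ?F S)\<bar> / Z"
    using Z_pos by simp
  also have "\<dots> = \<bar>\<Sum>S\<in>Omega. weight S * (?F T - ?F S)\<bar> / Z"
    by (simp add: sum_subtractf right_diff_distrib)
  also have "\<dots> \<le> (\<Sum>S\<in>Omega. weight S * (1 / 4)) / Z"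
  proof (rule divide_right_mono)
    have "\<bar>\<Sum>S\<in>Omega. weight S * (?F T - ?F S)\<bar> \<le> (\<Sum>S\<in>Omega. \<bar>weight S * (?F T - ?F S)\<bar>)" by (rule sum_abs)
    also have "\<dots> \<le> (\<Sum>S\<in>Omega. weight S * (1 / 4))"
    proof (rule sum_mono)
      fix S assume "S \<in> Omega"
      hence "weight S * \<bar>?F T - ?F S\<bar> \<le> weight S * (1 / 4)" using osc weight_pos[of S] by (intro mult_left_mono) auto
      thus "\<bar>weight S * (?F T - ?F S)\<bar> \<le> weight S * (1 / 4)" using weight_pos[of S] by (simp add: abs_mult)
    qed
    finally show "\<bar>\<Sum>S\<in>Omega. weight S * (?F T - ?F S)\<bar> \<le> (\<Sum>S\<in>Omega. weight S * (1 / 4))" .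
  qed (use Z_pos in simp)
  also have "\<dots> = 1 / 4"
    using Z_pos unfolding sum_distrib_right[symmetric] Z_def[symmetric] by simp
  finally show "\<bar>measure_pmf.prob (law t T) A - measure_pmf.prob (mu) A\<bar> \<le> 1 / 4" .
qed simp

text \<open>With \<open>s = m + n\<close> the contraction factor is at most \<open>exp (- 16 * s) \<le> 65536 powr (- s)\<close>, while the
diameter is at most \<open>16 ^ s * 8 * s ^ 3\<close>, and \<open>4 * 8 * s ^ 3 \<le> 64 ^ s\<close> for \<open>s \<ge> 2\<close>.\<close>

lemma decay_bound:
  assumes mn: "1 \<le> m" "1 \<le> n" and ne: "free \<noteq> {}"
  shows "(1 - 1 / (2 * real (card free))) ^ (32 * card free * (m + n)) * 16 ^ (m + n)
        * real (2 * card (midpoints m n) * (m + n)) \<le> 1 / 4"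
proof -
  define s where "s = m + n"
  have s2: "s \<ge> 2" using mn unfolding s_def by simp
  let ?N = "card free"
  have N: "?N > 0" using ne finite_free by (simp add: card_gt_0_iff)
  have "1 - 1 / (2 * real ?N) \<le> exp (- 1 / (2 * real ?N))" using exp_ge_add_one_self[of "- 1 / (2 * real ?N)"] by simp
  moreover have "0 \<le> 1 - 1 / (2 * real ?N)" using N by (simp add: field_simps)
  ultimately have "(1 - 1 / (2 * real ?N)) ^ (32 * ?N * s) \<le> exp (- 1 / (2 * real ?N)) ^ (32 * ?N * s)"
    by (rule power_mono)
  also have "\<dots> = exp (real (32 * ?N * s) * (- 1 / (2 * real ?N)))" by (rule exp_of_nat_mult[symmetric])
  also have "real (32 * ?N * s) * (- 1 / (2 * real ?N)) = real (16 * s) * (- 1)" using N by simp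
  also have "exp (real (16 * s) * (- 1)) = exp (- 1 :: real) ^ (16 * s)" by (rule exp_of_nat_mult)
  also have "\<dots> \<le> (1 / 2) ^ (16 * s)"
  proof (rule power_mono)
    have "exp (1::real) \<ge> 2" using exp_ge_add_one_self[of "1::real"] by simp
    thus "exp (- 1 :: real) \<le> 1 / 2" by (simp add: exp_minus field_simps)
  qed simp
  finally have dec: "(1 - 1 / (2 * real ?N)) ^ (32 * ?N * s) \<le> (1 / 65536) ^ s"
    by (simp add: power_mult power_one_over)
  have "card (midpoints m n) \<le> (2 * m + 1) * (2 * n + 1)" by (rule card_midpoints)
  also have "\<dots> \<le> (2 * s) * (2 * s)" using mn unfolding s_def by (intro mult_le_mono) auto
  finally have c: "2 * card (midpoints m n) * s \<le> 8 * s ^ 3" by (simp add: power3_eq_cube)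
  have "s ^ 3 \<le> (2 ^ s) ^ 3" by (intro power_mono) (auto simp: less_imp_le)
  also have "((2::nat) ^ s) ^ 3 = (2 ^ 3) ^ s" by (simp only: power_mult[symmetric] mult.commute)
  also have "(2 ^ 3) ^ s = (8::nat) ^ s" by simp
  finally have "8 * s ^ 3 \<le> 8 * 8 ^ s" by simp
  moreover have "(8::nat) * 8 ^ s * 4 \<le> 8 ^ s * 8 ^ s"
  proof -
    have "(32::nat) \<le> 8 ^ 2" by simp
    also have "\<dots> \<le> 8 ^ s" using s2 by (intro power_increasing) auto
    finally have "32 * (8::nat) ^ s \<le> 8 ^ s * 8 ^ s" by simp
    thus ?thesis by simp
  qed
  ultimately have "2 * card (midpoints m n) * s * 4 \<le> 8 ^ s * 8 ^ s" using c by linarith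
  hence "2 * card (midpoints m n) * s * 4 \<le> 64 ^ s" by (simp add: power_mult_distrib[symmetric])
  hence "real (2 * card (midpoints m n) * s * 4) \<le> real (64 ^ s)" by (rule of_nat_mono)
  hence cr: "real (2 * card (midpoints m n) * s) \<le> 64 ^ s / 4" by simp
  have "(1 - 1 / (2 * real ?N)) ^ (32 * ?N * s) * 16 ^ s * real (2 * card (midpoints m n) * s)
     \<le> (1 / 65536) ^ s * 16 ^ s * (64 ^ s / 4)"
    using dec cr \<open>0 \<le> 1 - 1 / (2 * real ?N)\<close> by (intro mult_mono) auto
  also have "\<dots> = (1 / 64) ^ s / 4" by (simp add: power_mult_distrib[symmetric])
  also have "\<dots> \<le> 1 / 4" by (simp add: power_le_one)
  finally show ?thesis unfolding s_def .
qed

lemma mixing_time_le: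
  assumes mn: "1 \<le> m" "1 \<le> n"
  shows "mixing_time m n lam eta Delta \<le> enat (32 * card free * (m + n))"
proof -
  let ?t = "32 * card free * (m + n)"
  have "(MAX T \<in> Omega. total_variation (law ?t T) (mu)) \<le> 1 / 4"
  proof (rule Max.boundedI)
    show "finite ((\<lambda>T. total_variation (law ?t T) (mu)) ` Omega)"
      using finite_Omega by simp
    show "(\<lambda>T. total_variation (law ?t T) (mu)) ` Omega \<noteq> {}"
      using Omega_nonempty by simp
    show "v \<le> 1 / 4" if "v \<in> (\<lambda>T. total_variation (law ?t T) (mu)) ` Omega" for v
      using that total_variation_bound[OF _ decay_bound[OF mn]] by blast
  qed
  thus ?thesis unfolding mixing_time_def by (intro Inf_lower imageI) simp
qed

end

theorem theorem1p3:
  shows "\<exists>lam1 C :: real. 0 < lam1 \<and> lam1 < 1 \<and> 0 < C \<and>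
    (\<forall>(lam :: real) (m :: nat) (n :: nat) (\<eta> :: real \<times> real \<Rightarrow> edge) (\<Delta> :: (real \<times> real) set).
      0 < lam \<and> lam < lam1 \<and> 1 \<le> m \<and> 1 \<le> n \<and> constraints m n \<eta> \<Delta> \<longrightarrow>
        ereal_of_enat (mixing_time m n lam \<eta> \<Delta>)
          \<le> ereal (C * (real m * real n * (real m + real n))))"
proof (rule exI[of _ "1 / 16"], rule exI[of _ 288], intro conjI allI impI)
  fix lam :: real and m n :: nat and \<eta> :: "real \<times> real \<Rightarrow> edge" and \<Delta> :: "(real \<times> real) set"
  assume h: "0 < lam \<and> lam < 1 / 16 \<and> 1 \<le> m \<and> 1 \<le> n \<and> constraints m n \<eta> \<Delta>"
  interpret constrained_glauber m n lam \<eta> \<Delta>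
    by unfold_locales (use h in auto)
  have mn: "1 \<le> m" "1 \<le> n" using h by auto
  \<comment> \<open>the constant is \<open>32 * 9\<close>, as there are at most \<open>9 * m * n\<close> midpoints\<close>
  have "card free \<le> card (midpoints m n)" unfolding free_def by (rule card_mono[OF finite_midpoints]) auto
  also have "\<dots> \<le> (2 * m + 1) * (2 * n + 1)" by (rule card_midpoints)
  also have "\<dots> \<le> (3 * m) * (3 * n)" using mn by (intro mult_le_mono) auto
  finally have "32 * card free * (m + n) \<le> 32 * ((3 * m) * (3 * n)) * (m + n)"
    by (intro mult_le_mono) auto
  also have "\<dots> = 288 * (m * n * (m + n))" by (simp add: algebra_simps)
  finally have "real (32 * card free * (m + n)) \<le> real (288 * (m * n * (m + n)))" by (rule of_nat_mono)
  also have "\<dots> = 288 * (real m * real n * (real m + real n))" by simp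
  finally have t: "real (32 * card free * (m + n)) \<le> 288 * (real m * real n * (real m + real n))" .
  have "ereal_of_enat (mixing_time m n lam \<eta> \<Delta>) \<le> ereal_of_enat (enat (32 * card free * (m + n)))"
    using mixing_time_le[OF mn] by (simp only: ereal_of_enat_le_iff)
  also have "\<dots> = ereal (real (32 * card free * (m + n)))" by (simp only: ereal_of_enat_simps)
  also have "\<dots> \<le> ereal (288 * (real m * real n * (real m + real n)))" using t by (simp only: ereal_less_eq)
  finally show "ereal_of_enat (mixing_time m n lam \<eta> \<Delta>) \<le> ereal (288 * (real m * real n * (real m + real n)))" .
qed simp_all

end
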